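(* Assume that $b,\sigma,g,\Phi,h$ satisfy the assumptions listed in the context. Then, in the class of continuous functions on $[0,T]\times\mathbb{R}^n$ which grow at most polynomially at infinity, there exists at most one viscosity solution of $$\min\Big(u(t,x)-h(t,x),\;-\frac{\partial u}{\partial t}(t,x)-\sup_{v\in U}\big\{\mathcal{L}(t,x,v)u(t,x)+g(t,x,u(t,x),\nabla u(t,x)\sigma(t,x,v),v)\big\}\Big)=0,\qquad u(T,x)=\Phi(x).$$
   Context: Let $T>0$ and let $U\subset\mathbb{R}^k$ be a compact set. Assumptions: $b:[0,T]\times\mathbb{R}^n\times U\to\mathbb{R}^n$, $\sigma:[0,T]\times\mathbb{R}^n\times U\to\mathbb{R}^{n\times d}$, $g:[0,T]\times\mathbb{R}^n\times\mathbb{R}\times\mathbb{R}^d\times U\to\mathbb{R}$, $h:[0,T]\times\mathbb{R}^n\to\mathbb{R}$ and $\Phi:\mathbb{R}^n\to\mathbb{R}$ are such that $b,\sigma,g,h$ are continuous in $t$ and, for some $L>0$ and all arguments, $$|b(t,x,v)-b(t,x',v')|+|\sigma(t,x,v)-\sigma(t,x',v')|\le L(|x-x'|+|v-v'|),$$ $$|g(t,x,y,z,v)-g(t,x',y',z',v')|+|\Phi(x)-\Phi(x')|+|h(t,x)-h(t,x')|\le L(|x-x'|+|y-y'|+|z-z'|+|v-v'|).$$ $\mathcal{L}(t,x,v)\varphi=\frac12\mathrm{Tr}\big((\sigma\sigma^T)(t,x,v)D^2\varphi\big)+\langle b(t,x,v),D\varphi\rangle$. Viscosity solutions: let $S^n$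 be the set of symmetric $n\times n$ matrices. For $u\in C((0,T)\times\mathbb{R}^n)$ and $(t,x)\in(0,T)\times\mathbb{R}^n$, $\mathcal{P}^{2,+}u(t,x)$ is the set of $(p,q,X)\in\mathbb{R}\times\mathbb{R}^n\times S^n$ with $$u(s,y)\le u(t,x)+p(s-t)+\langle q,y-x\rangle+\tfrac12\langle X(y-x),y-x\rangle+o(|s-t|+|y-x|^2)$$ as $(s,y)\to(t,x)$, and $\mathcal{P}^{2,-}u(t,x)$ is defined with $\ge$ instead of $\le$. For $u\in C([0,T]\times\mathbb{R}^n)$ write $$F(t,x,p,q,X)=\min\Big(u(t,x)-h(t,x),-p-\sup_{v\in U}\big\{\tfrac12\mathrm{Tr}((\sigma\sigma^T)(t,x,v)X)+\langle b(t,x,v),q\rangle+g(t,x,u(t,x),q\sigma(t,x,v),v)\big\}\Big).$$ $u\in C([0,T]\times\mathbb{R}^n)$ is a viscosity subsolution if $u(T,x)\le\Phi(x)$ for all $x\in\mathbb{R}^n$ and $F(t,x,p,q,X)\le0$ for every $(t,x)\in(0,T)\times\mathbb{R}^n$ and $(p,q,X)\in\mathcal{P}^{2,+}u(t,x)$; a viscosity supersolution if $u(T,x)\ge\Phi(x)$ for all $x$ and $F(t,x,p,q,X)\ge0$ for every $(t,x)\in(0,T)\times\mathbb{R}^n$ and $(p,q,X)\in\mathcal{P}^{2,-}u(t,x)$ (in particular $u\ge h$); a viscosity solution if it is both. *)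

theory Defs
  imports "HOL-Analysis.Analysis" "HOL-Library.Landau_Symbols"
begin

text \<open>
  Functions on \<open>[0,T] \<times> R^n\<close> are curried total functions; their values for \<open>t \<notin> {0..T}\<close>
  play no role.  The norm on \<^typ>\<open>real^'d^'n\<close> is the Frobenius norm.
\<close>

text \<open>
  The jets are used only at interior times \<open>0 < t < T\<close>, so near \<open>(t, x)\<close> only values of \<open>u\<close> on
  \<open>(0,T) \<times> R^n\<close> matter.  The remainder \<open>r\<close> is the \<open>o(\<bar>s - t\<bar> + \<bar>y - x\<bar>^2)\<close> term.
\<close>

definition parabolic_superjet ::
  "(real \<Rightarrow> real^'n \<Rightarrow> real) \<Rightarrow> real \<Rightarrow> real^'n \<Rightarrow> (real \<times> (real^'n) \<times> (real^'n^'n)) set"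
where
  "parabolic_superjet u t x = {(p, q, X). transpose X = X \<and>
     (\<exists>r \<in> o[at (t, x)](\<lambda>(s, y). \<bar>s - t\<bar> + (norm (y - x))\<^sup>2).
        \<forall>\<^sub>F (s, y) in at (t, x).
          u s y \<le> u t x + p * (s - t) + q \<bullet> (y - x) + 1/2 * ((X *v (y - x)) \<bullet> (y - x)) + r (s, y))}"

definition parabolic_subjet ::
  "(real \<Rightarrow> real^'n \<Rightarrow> real) \<Rightarrow> real \<Rightarrow> real^'n \<Rightarrow> (real \<times> (real^'n) \<times> (real^'n^'n)) set"
where
  "parabolic_subjet u t x = {(p, q, X). transpose X = X \<and>
     (\<exists>r \<in> o[at (t, x)](\<lambda>(s, y). \<bar>s - t\<bar> + (norm (y - x))\<^sup>2).
        \<forall>\<^sub>F (s, y) in at (t, x).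
          u s y \<ge> u t x + p * (s - t) + q \<bullet> (y - x) + 1/2 * ((X *v (y - x)) \<bullet> (y - x)) + r (s, y))}"

text \<open>
  The supremum is over reals: it is a genuine one whenever \<open>U\<close> is nonempty and compact and the
  coefficients are continuous in \<open>v\<close>, since the set is then nonempty and bounded.
\<close>

definition obstacle_HJB ::
  "(real \<Rightarrow> real^'n \<Rightarrow> real^'k \<Rightarrow> real^'n) \<Rightarrow>
   (real \<Rightarrow> real^'n \<Rightarrow> real^'k \<Rightarrow> real^'d^'n) \<Rightarrow>
   (real \<Rightarrow> real^'n \<Rightarrow> real \<Rightarrow> real^'d \<Rightarrow> real^'k \<Rightarrow> real) \<Rightarrow>
   (real \<Rightarrow> real^'n \<Rightarrow> real) \<Rightarrow> (real^'k) set \<Rightarrow>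
   (real \<Rightarrow> real^'n \<Rightarrow> real) \<Rightarrow>
   real \<Rightarrow> real^'n \<Rightarrow> real \<Rightarrow> real^'n \<Rightarrow> real^'n^'n \<Rightarrow> real"
where
  "obstacle_HJB b \<sigma> g h U u t x p q X =
     min (u t x - h t x)
         (- p -
          (SUP v\<in>U. 1/2 * trace ((\<sigma> t x v ** transpose (\<sigma> t x v)) ** X)
                      + b t x v \<bullet> q
                      + g t x (u t x) (q v* \<sigma> t x v) v))"

definition viscosity_subsolution ::
  "real \<Rightarrow>
   (real \<Rightarrow> real^'n \<Rightarrow> real^'k \<Rightarrow> real^'n) \<Rightarrow>
   (real \<Rightarrow> real^'n \<Rightarrow> real^'k \<Rightarrow> real^'d^'n) \<Rightarrow>
   (real \<Rightarrow> real^'n \<Rightarrow> real \<Rightarrow> real^'d \<Rightarrow> real^'k \<Rightarrow> real) \<Rightarrow>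
   (real \<Rightarrow> real^'n \<Rightarrow> real) \<Rightarrow> (real^'n \<Rightarrow> real) \<Rightarrow> (real^'k) set \<Rightarrow>
   (real \<Rightarrow> real^'n \<Rightarrow> real) \<Rightarrow> bool"
where
  "viscosity_subsolution T b \<sigma> g h \<Phi> U u \<longleftrightarrow>
     continuous_on ({0..T} \<times> UNIV) (\<lambda>(t, x). u t x) \<and>
     (\<forall>x. u T x \<le> \<Phi> x) \<and>
     (\<forall>t\<in>{0<..<T}. \<forall>x. \<forall>(p, q, X)\<in>parabolic_superjet u t x.
        obstacle_HJB b \<sigma> g h U u t x p q X \<le> 0)"

definition viscosity_supersolution ::
  "real \<Rightarrow>
   (real \<Rightarrow> real^'n \<Rightarrow> real^'k \<Rightarrow> real^'n) \<Rightarrow>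
   (real \<Rightarrow> real^'n \<Rightarrow> real^'k \<Rightarrow> real^'d^'n) \<Rightarrow>
   (real \<Rightarrow> real^'n \<Rightarrow> real \<Rightarrow> real^'d \<Rightarrow> real^'k \<Rightarrow> real) \<Rightarrow>
   (real \<Rightarrow> real^'n \<Rightarrow> real) \<Rightarrow> (real^'n \<Rightarrow> real) \<Rightarrow> (real^'k) set \<Rightarrow>
   (real \<Rightarrow> real^'n \<Rightarrow> real) \<Rightarrow> bool"
where
  "viscosity_supersolution T b \<sigma> g h \<Phi> U u \<longleftrightarrow>
     continuous_on ({0..T} \<times> UNIV) (\<lambda>(t, x). u t x) \<and>
     (\<forall>x. u T x \<ge> \<Phi> x) \<and>
     (\<forall>t\<in>{0<..<T}. \<forall>x. \<forall>(p, q, X)\<in>parabolic_subjet u t x.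
        obstacle_HJB b \<sigma> g h U u t x p q X \<ge> 0)"

definition viscosity_solution ::
  "real \<Rightarrow>
   (real \<Rightarrow> real^'n \<Rightarrow> real^'k \<Rightarrow> real^'n) \<Rightarrow>
   (real \<Rightarrow> real^'n \<Rightarrow> real^'k \<Rightarrow> real^'d^'n) \<Rightarrow>
   (real \<Rightarrow> real^'n \<Rightarrow> real \<Rightarrow> real^'d \<Rightarrow> real^'k \<Rightarrow> real) \<Rightarrow>
   (real \<Rightarrow> real^'n \<Rightarrow> real) \<Rightarrow> (real^'n \<Rightarrow> real) \<Rightarrow> (real^'k) set \<Rightarrow>
   (real \<Rightarrow> real^'n \<Rightarrow> real) \<Rightarrow> bool"
where
  "viscosity_solution T b \<sigma> g h \<Phi> U u \<longleftrightarrow>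
     viscosity_subsolution T b \<sigma> g h \<Phi> U u \<and> viscosity_supersolution T b \<sigma> g h \<Phi> U u"

definition polynomial_growth :: "real \<Rightarrow> (real \<Rightarrow> real^'n \<Rightarrow> real) \<Rightarrow> bool" where
  "polynomial_growth T u \<longleftrightarrow>
     (\<exists>C m. \<forall>t\<in>{0..T}. \<forall>x. \<bar>u t x\<bar> \<le> C * (1 + norm x ^ m))"

end

theory Submission
  imports Defs
begin

text \<open>
  Comparison of a subsolution \<open>u\<close> with a supersolution \<open>v\<close>, by a route that needs neither
  Aleksandrov's theorem nor the Crandall--Ishii lemma.  Doubling only the space variable replaces
  \<open>v\<close> by a partial infimal convolution \<open>w\<close>.  Because \<open>\<sigma>\<close> is Lipschitz, a jet of \<open>w\<close> at \<open>(t, x)\<close> can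
  be tested against \<^emph>\<open>any\<close> diffusion matrix \<open>A\<close> at the price \<open>norm (A - \<sigma> t y c)\<^sup>2 / (2 * \<epsilon>)\<close>, where \<open>y\<close> is
  the minimising point; so near the doubling point \<open>w\<close> is a viscosity supersolution of linear inequalities
  with frozen coefficients, one for each control.  For constant coefficients convolution with a mollifier
  turns a viscosity supersolution into a classical one: \<open>w\<close> dominates, up to an error of second order in \<open>\<mu>\<close>,
  the resolvent \<open>(1 - \<mu> G)\<^bsup>-1\<^esup> w\<close> of a random walk with generator \<open>G\<close>, which is an average of translates of \<open>w\<close>
  and therefore commutes with the mollification.  The mollification of \<open>w\<close> thus serves as a smooth test
  function for \<open>u\<close>.
\<close>

text \<open>Two things block a direct mollification of \<open>w\<close>: the coefficients vary with
  the point, and \<open>g\<close> is nonlinear in the gradient; neither commutes with averaging.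
  Free choice of the test matrix removes the first: all jets of \<open>w\<close> near the doubling
  point are tested with the coefficients of one fixed point, and the price is small there because
  \<open>\<sigma>\<close> is Lipschitz and the doubling maximum makes
  \<open>norm (x - y)^2 / \<epsilon>\<close> small. The second is removed because the gradient of
  \<open>w\<close> is explicit, \<open>(x - y) / \<epsilon>\<close>, hence nearly constant:
  \<open>g\<close> moves to the right-hand side as a constant, and the gradient of the mollification
  is controlled by the same theorem, applied to first-order operators. A viscosity inequality cannot
  be integrated, but the resolvent bound \<open>R \<le> w + \<mu> * c + O(\<mu>^2)\<close> is
  pointwise and can be averaged; dividing by \<open>\<mu>\<close> then recovers the inequality for
  derivatives. The supersolution inequality holds for every control, so the control may be picked
  after mollification, by the subsolution; compactness of \<open>U\<close> makes the errors uniform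
  in it.\<close>

section \<open>Mollification by a truncated quartic kernel\<close>

text \<open>The parameter \<open>d\<close> is the square of the radius of the support.\<close>

definition kern :: "real \<Rightarrow> 'e::euclidean_space \<Rightarrow> real" where
  "kern d z = (max 0 (d - z \<bullet> z)) ^ 4"

text \<open>The directional derivatives of \<open>kern d\<close> at \<open>z\<close> are written out
  because all later arguments go through the explicit Taylor estimate
  \<open>kern_taylor\<close>.\<close>

definition kern1 :: "real \<Rightarrow> 'e::euclidean_space \<Rightarrow> 'e \<Rightarrow> real" where
  "kern1 d z h = - 8 * (max 0 (d - z \<bullet> z)) ^ 3 * (z \<bullet> h)"

definition kern2 :: "real \<Rightarrow> 'e::euclidean_space \<Rightarrow> 'e \<Rightarrow> 'e \<Rightarrow> real" where
  "kern2 d z h k = 48 * (max 0 (d - z \<bullet> z)) ^ 2 * ((z \<bullet> h) * (z \<bullet> k)) - 8 * (max 0 (d - z \<bullet> z)) ^ 3 * (h \<bullet> k)"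

text \<open>Inside the support the remainder is exactly \<open>- e^3 * (3 * p + q)\<close>. If one
  endpoint lies outside, every term is itself cubic, since the remaining positive part is at most
  \<open>\<bar>e\<bar>\<close> and at most 1. The 11 is \<open>1 + 4 + 6\<close>, the coefficients
  that occur when only the starting point is inside.\<close>

lemma truncated_quartic_taylor:
  fixes d a b :: real
  assumes "d \<le> 1" "0 \<le> a" "0 \<le> b"
  defines "p \<equiv> max 0 (d - a)" and "q \<equiv> max 0 (d - b)" and "e \<equiv> b - a"
  shows "\<bar>q ^ 4 - p ^ 4 + 4 * p ^ 3 * e - 6 * p ^ 2 * e ^ 2\<bar> \<le> 11 * \<bar>e\<bar> ^ 3"
proof -
  have p: "0 \<le> p" "p \<le> 1" and q: "0 \<le> q" "q \<le> 1" using assms by auto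
  consider "a \<le> d" "b \<le> d" | "p = 0" | "a \<le> d" "d \<le> b" unfolding p_def by linarith
  then show ?thesis
  proof cases
    case 1
    then have qe: "q = p - e" unfolding p_def q_def e_def by auto
    have "q ^ 4 - p ^ 4 + 4 * p ^ 3 * e - 6 * p ^ 2 * e ^ 2 = - (e ^ 3) * (3 * p + q)"
      unfolding qe by algebra
    moreover have "\<bar>3 * p + q\<bar> \<le> 11" using p q by auto
    ultimately show ?thesis
      using mult_left_mono[of "\<bar>3 * p + q\<bar>" 11 "\<bar>e\<bar> ^ 3"]
      by (simp add: abs_mult power_abs mult.commute)
  next
    case 2
    then have "q \<le> \<bar>e\<bar>" unfolding p_def q_def e_def by auto
    then have "q ^ 3 * q \<le> \<bar>e\<bar> ^ 3 * 1" using q by (intro mult_mono power_mono) auto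
    then have "q ^ 4 \<le> \<bar>e\<bar> ^ 3" by (simp add: eval_nat_numeral mult_ac)
    moreover have "0 \<le> \<bar>e\<bar> ^ 3" by simp
    ultimately have "q ^ 4 \<le> 11 * \<bar>e\<bar> ^ 3" by linarith
    then show ?thesis using 2 q by simp
  next
    case 3
    have q0: "q = 0" and pe: "p \<le> e" "0 \<le> e" using 3 unfolding p_def q_def e_def by auto
    have 1: "p ^ 3 * p \<le> e ^ 3 * 1" using p pe by (intro mult_mono power_mono) auto
    have 2: "p ^ 2 * p * e \<le> e ^ 2 * 1 * e" using p pe by (intro mult_mono power_mono) auto
    have 3: "p * p * e ^ 2 \<le> 1 * e * e ^ 2" using p pe by (intro mult_mono power_mono) auto
    have nn: "0 \<le> p ^ 4" "0 \<le> p ^ 3 * e" "0 \<le> p ^ 2 * e ^ 2" using p pe by auto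
    have "\<bar>- (p ^ 4) + 4 * (p ^ 3 * e) - 6 * (p ^ 2 * e ^ 2)\<bar> \<le> p ^ 4 + 4 * (p ^ 3 * e) + 6 * (p ^ 2 * e ^ 2)"
      using nn by linarith
    also have "\<dots> \<le> 11 * e ^ 3" using 1 2 3 by (simp add: eval_nat_numeral mult_ac)
    finally show ?thesis using q0 pe by (simp add: mult_ac)
  qed
qed

lemma kern_eq_0: "d \<le> 1 \<Longrightarrow> norm z > 1 \<Longrightarrow> kern d z = 0"
  and kern1_eq_0: "d \<le> 1 \<Longrightarrow> norm z > 1 \<Longrightarrow> kern1 d z h = 0"
  and kern2_eq_0: "d \<le> 1 \<Longrightarrow> norm z > 1 \<Longrightarrow> kern2 d z h k = 0"
proof -
  assume "d \<le> 1" "norm z > 1"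
  then have "max 0 (d - z \<bullet> z) = 0"
    by (smt (verit) norm_eq_sqrt_inner real_sqrt_gt_1_iff)
  then show "kern d z = 0" "kern1 d z h = 0" "kern2 d z h k = 0"
    by (simp_all add: kern_def kern1_def kern2_def)
qed

lemma kern_nonneg: "0 \<le> kern d z"
  by (simp add: kern_def)

text \<open>For \<open>norm z > 2\<close> both \<open>z\<close> and \<open>z + h\<close> lie outside
  the closed unit ball, which contains the support. Otherwise the increment \<open>e\<close> of
  \<open>z \<bullet> z\<close> is at most \<open>5 * norm h\<close>, and 2000 exceeds
  \<open>11 * 125 + 54\<close>.\<close>

lemma kern_taylor:
  fixes z h :: "'e::euclidean_space"
  assumes d: "d \<le> 1" and h: "norm h \<le> 1"
  shows "\<bar>kern d (z + h) - kern d z - kern1 d z h - 1/2 * kern2 d z h h\<bar>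
           \<le> 2000 * norm h ^ 3 * indicator (cball 0 2) z"
proof (cases "norm z \<le> 2")
  case False
  then have z: "norm z > 1" by auto
  have "norm z \<le> norm (z + h) + norm h" by (metis add_diff_cancel norm_triangle_ineq4)
  then have "norm (z + h) > 1" using False h by auto
  then show ?thesis using False z d by (simp add: kern_eq_0 kern1_eq_0 kern2_eq_0)
next
  case True
  define p where "p = max 0 (d - z \<bullet> z)"
  define q where "q = max 0 (d - (z + h) \<bullet> (z + h))"
  define c where "c = z \<bullet> h"
  define n where "n = norm h"
  define e where "e = 2 * c + n\<^sup>2"
  have p: "0 \<le> p" "p \<le> 1" using d inner_ge_zero[of z] by (auto simp: p_def simp del: inner_ge_zero)
  have n: "0 \<le> n" "n \<le> 1" "h \<bullet> h = n\<^sup>2" using h by (auto simp: n_def dot_square_norm)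
  have c: "\<bar>c\<bar> \<le> 2 * n"
    using Cauchy_Schwarz_ineq2[of z h] True mult_right_mono[OF True norm_ge_zero[of h]]
    unfolding c_def n_def by linarith
  have n2: "n\<^sup>2 \<le> n" using n by (simp add: power2_eq_square mult_left_le)
  have e: "\<bar>e\<bar> \<le> 5 * n" unfolding e_def using c n2 n by (smt (verit) zero_le_power2)
  have ee: "(z + h) \<bullet> (z + h) - z \<bullet> z = e"
    unfolding e_def c_def using n(3) by (simp add: inner_add_left inner_add_right inner_commute)
  have 1: "\<bar>q ^ 4 - p ^ 4 + 4 * p ^ 3 * e - 6 * p ^ 2 * e ^ 2\<bar> \<le> 11 * \<bar>e\<bar> ^ 3"
    using truncated_quartic_taylor[OF d, of "z \<bullet> z" "(z + h) \<bullet> (z + h)"]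
    unfolding p_def[symmetric] q_def[symmetric] ee by simp
  have e3: "\<bar>e\<bar> ^ 3 \<le> 125 * n ^ 3"
    using power_mono[OF e, of 3] by (simp add: power_mult_distrib)
  \<comment> \<open>Since \<open>e\<close> is quadratic in \<open>h\<close>, the Taylor polynomial
    in \<open>e\<close> also contains terms of order three and four in \<open>h\<close>; they form
    the second summand.\<close>
  have "kern d (z + h) - kern d z - kern1 d z h - 1/2 * kern2 d z h h
      = (q ^ 4 - p ^ 4 + 4 * p ^ 3 * e - 6 * p ^ 2 * e ^ 2) + p\<^sup>2 * (24 * (c * n\<^sup>2) + 6 * n ^ 4)"
    unfolding kern_def kern1_def kern2_def p_def[symmetric] q_def[symmetric] c_def[symmetric] n(3) e_def
    by algebra
  moreover have "\<bar>p\<^sup>2 * (24 * (c * n\<^sup>2) + 6 * n ^ 4)\<bar> \<le> 1 * (54 * n ^ 3)"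
    unfolding abs_mult
  proof (intro mult_mono)
    show "\<bar>p\<^sup>2\<bar> \<le> 1" using p by (simp add: power_le_one)
    have "\<bar>c * n\<^sup>2\<bar> \<le> 2 * n * n\<^sup>2" using mult_right_mono[OF c, of "n\<^sup>2"] by (simp add: abs_mult)
    moreover have "n ^ 4 \<le> n ^ 3" using n by (simp add: power_decreasing)
    moreover have "0 \<le> n ^ 4" by simp
    moreover have "2 * n * n\<^sup>2 = 2 * n ^ 3" by (simp add: eval_nat_numeral)
    ultimately show "\<bar>24 * (c * n\<^sup>2) + 6 * n ^ 4\<bar> \<le> 54 * n ^ 3" by linarith
  qed auto
  ultimately have "\<bar>kern d (z + h) - kern d z - kern1 d z h - 1/2 * kern2 d z h h\<bar> \<le> 11 * (125 * n ^ 3) + 54 * n ^ 3"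
    using 1 e3 by linarith
  also have "\<dots> \<le> 2000 * n ^ 3" using n by simp
  finally show ?thesis using True by (simp add: n_def)
qed

lemma integrable_compact_support:
  fixes f :: "'e::euclidean_space \<Rightarrow> real"
  assumes "continuous_on UNIV f" "compact S" "\<And>y. y \<notin> S \<Longrightarrow> f y = 0"
  shows "integrable lborel f"
proof -
  have "integrable lborel (\<lambda>x. indicator S x *\<^sub>R f x)"
    by (intro borel_integrable_compact assms continuous_on_subset[OF assms(1)]) auto
  also have "(\<lambda>x. indicator S x *\<^sub>R f x) = f" using assms(3) by (auto simp: indicator_def fun_eq_iff)
  finally show ?thesis .
qed

lemma continuous_kern [continuous_intros]:
  fixes g :: "'a::topological_space \<Rightarrow> 'e::euclidean_space"
  assumes "continuous_on S g"
  shows "continuous_on S (\<lambda>y. kern d (g y))" "continuous_on S (\<lambda>y. kern1 d (g y) h)"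
    "continuous_on S (\<lambda>y. kern2 d (g y) h k)"
  unfolding kern_def kern1_def kern2_def by (intro continuous_intros assms)+

lemma integrable_kernel:
  fixes f :: "'e::euclidean_space \<Rightarrow> real"
  assumes "continuous_on UNIV f" "d \<le> 1"
  shows "integrable lborel (\<lambda>y. f y * kern d (y - z))"
    "integrable lborel (\<lambda>y. f y * kern1 d (y - z) h)"
    "integrable lborel (\<lambda>y. f y * kern2 d (y - z) h k)"
  by (rule integrable_compact_support[of _ "cball z 1"];
      use assms in \<open>auto intro!: continuous_intros kern_eq_0 kern1_eq_0 kern2_eq_0 simp: dist_norm norm_minus_commute\<close>)+

definition kmass :: "'e::euclidean_space itself \<Rightarrow> real \<Rightarrow> real" where
  "kmass _ d = (\<integral>y. kern d (y::'e) \<partial>lborel)"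

lemma kmass_pos:
  assumes "0 < d" "d \<le> 1"
  shows "0 < kmass TYPE('e::euclidean_space) d"
proof -
  have 0: "integrable lborel (kern d :: 'e \<Rightarrow> real)"
    using integrable_kernel(1)[of "\<lambda>_. 1" d 0] assms by simp
  let ?B = "ball (0::'e) (sqrt (d / 2))"
  have b: "(d/2) ^ 4 * indicator ?B y \<le> kern d y" for y
  proof (cases "y \<in> ?B")
    case True
    then have "y \<bullet> y \<le> d / 2" using assms
      by (auto simp: norm_eq_sqrt_inner)
    then have "d / 2 \<le> max 0 (d - y \<bullet> y)" by linarith
    moreover have "0 \<le> d / 2" using assms by simp
    ultimately have "(d / 2) ^ 4 \<le> kern d y" unfolding kern_def by (rule power_mono)
    then show ?thesis using True by (simp del: power_divide)
  qed (auto simp: kern_nonneg)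
  have "0 < measure lborel ?B" using assms by (intro content_ball_pos) auto
  then have "0 < (d/2) ^ 4 * measure lborel ?B" using assms by auto
  also have "\<dots> = (\<integral>y. (d/2) ^ 4 * indicator ?B y \<partial>lborel)" by simp
  also have "\<dots> \<le> (\<integral>y. kern d (y::'e) \<partial>lborel)"
  proof (rule integral_mono)
    show "integrable lborel (\<lambda>y. (d/2) ^ 4 * indicator ?B y)"
      using emeasure_lborel_ball_finite[of "0::'e" "sqrt (d / 2)"]
      by (intro integrable_mult_right integrable_real_indicator) auto
  qed (use 0 b in auto)
  finally show ?thesis by (simp add: kmass_def)
qed

section \<open>Mollified functions and their second-order jets\<close>

definition avg :: "real \<Rightarrow> ('e::euclidean_space \<Rightarrow> real) \<Rightarrow> 'e \<Rightarrow> real" where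
  "avg d f z = (\<integral>y. f y * kern d (y - z) \<partial>lborel) / kmass TYPE('e) d"

text \<open>The derivative in \<open>z\<close> falls on the kernel, whose argument is
  \<open>y - z\<close>; hence the direction \<open>- h\<close> here, while in \<open>avg2\<close>
  the two signs cancel.\<close>

definition avg1 :: "real \<Rightarrow> ('e::euclidean_space \<Rightarrow> real) \<Rightarrow> 'e \<Rightarrow> 'e \<Rightarrow> real" where
  "avg1 d f z h = (\<integral>y. f y * kern1 d (y - z) (- h) \<partial>lborel) / kmass TYPE('e) d"

definition avg2 :: "real \<Rightarrow> ('e::euclidean_space \<Rightarrow> real) \<Rightarrow> 'e \<Rightarrow> 'e \<Rightarrow> 'e \<Rightarrow> real" where
  "avg2 d f z h k = (\<integral>y. f y * kern2 d (y - z) h k \<partial>lborel) / kmass TYPE('e) d"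

lemma integral_abs_le_cball:
  fixes f :: "'e::euclidean_space \<Rightarrow> real"
  assumes "integrable lborel f" "\<And>y. \<bar>f y\<bar> \<le> B * indicator (cball z 2) y"
  shows "\<bar>\<integral>y. f y \<partial>lborel\<bar> \<le> B * measure lborel (cball (0::'e) 2)"
proof -
  have "\<bar>\<integral>y. f y \<partial>lborel\<bar> \<le> (\<integral>y. \<bar>f y\<bar> \<partial>lborel)" by (rule integral_abs_bound)
  also have "\<dots> \<le> (\<integral>y. B * indicator (cball z 2) y \<partial>lborel)"
    by (intro integral_mono assms integrable_abs integrable_mult_right integrable_real_indicator)
       (use emeasure_lborel_cball_finite[of z 2] in auto)
  also have "\<dots> = B * measure lborel (cball z 2)" by simp
  also have "measure lborel (cball z 2) = measure lborel (cball (0::'e) 2)"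
    by (simp add: content_cball)
  finally show ?thesis .
qed

lemma linear_avg1:
  assumes "continuous_on UNIV f" "d \<le> 1"
  shows "linear (avg1 d f z)"
proof (rule linearI)
  fix a b :: 'a and c :: real
  have 1: "kern1 d y (- (a + b)) = kern1 d y (- a) + kern1 d y (- b)"
    "kern1 d y (- (c *\<^sub>R a)) = c * kern1 d y (- a)" for y
    by (auto simp: kern1_def inner_simps algebra_simps)
  show "avg1 d f z (a + b) = avg1 d f z a + avg1 d f z b"
    unfolding avg1_def 1 add_divide_distrib[symmetric]
    by (subst Bochner_Integration.integral_add[symmetric])
       (auto intro!: integrable_kernel assms simp: algebra_simps)
  show "avg1 d f z (c *\<^sub>R a) = c *\<^sub>R avg1 d f z a"
    unfolding avg1_def 1 by (simp add: mult.left_commute)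
qed

lemma avg2_sym: "avg2 d f z h k = avg2 d f z k h"
  by (simp add: avg2_def kern2_def inner_commute mult.commute)

lemma bilinear_avg2:
  assumes "continuous_on UNIV f" "d \<le> 1"
  shows "bilinear (avg2 d f z)"
proof -
  have "linear (avg2 d f z k)" for k
  proof (rule linearI)
    fix a b :: 'a and c :: real
    have 1: "kern2 d y k (a + b) = kern2 d y k a + kern2 d y k b"
      "kern2 d y k (c *\<^sub>R a) = c * kern2 d y k a" for y
      by (auto simp: kern2_def inner_simps algebra_simps)
    show "avg2 d f z k (a + b) = avg2 d f z k a + avg2 d f z k b"
      unfolding avg2_def 1 add_divide_distrib[symmetric]
      by (subst Bochner_Integration.integral_add[symmetric])
         (auto intro!: integrable_kernel assms simp: algebra_simps)
    show "avg2 d f z k (c *\<^sub>R a) = c *\<^sub>R avg2 d f z k a"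
      unfolding avg2_def 1 by (simp add: mult.left_commute)
  qed
  then show ?thesis unfolding bilinear_def by (subst avg2_sym[of d f z]) auto
qed

lemma avg_diff:
  assumes "continuous_on UNIV f" "continuous_on UNIV g" "d \<le> 1"
  shows "avg d (\<lambda>y. f y - g y) z = avg d f z - avg d g z"
    "avg1 d (\<lambda>y. f y - g y) z h = avg1 d f z h - avg1 d g z h"
    "avg2 d (\<lambda>y. f y - g y) z h k = avg2 d f z h k - avg2 d g z h k"
  unfolding avg_def avg1_def avg2_def diff_divide_distrib[symmetric]
  by (subst Bochner_Integration.integral_diff[symmetric];
      auto intro!: integrable_kernel assms simp: algebra_simps)+

lemma kern1_bound: "d \<le> 1 \<Longrightarrow> \<bar>kern1 d z h\<bar> \<le> 8 * norm h * indicator (cball 0 2) z"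
proof (cases "norm z > 1")
  case True then show "d \<le> 1 \<Longrightarrow> ?thesis" by (simp add: kern1_eq_0)
next
  case False
  assume d: "d \<le> 1"
  have p: "0 \<le> max 0 (d - z \<bullet> z)" "max 0 (d - z \<bullet> z) \<le> 1" using d inner_ge_zero[of z] by (auto simp del: inner_ge_zero)
  have "\<bar>z \<bullet> h\<bar> \<le> 1 * norm h"
    using Cauchy_Schwarz_ineq2[of z h] mult_right_mono[of "norm z" 1 "norm h"] False by auto
  then have "max 0 (d - z \<bullet> z) ^ 3 * \<bar>z \<bullet> h\<bar> \<le> 1 * norm h"
    using p by (intro mult_mono) (auto intro!: power_le_one)
  then show ?thesis using False by (simp add: kern1_def abs_mult)
qed

lemma kern2_bound: "d \<le> 1 \<Longrightarrow> \<bar>kern2 d z h k\<bar> \<le> 56 * (norm h * norm k) * indicator (cball 0 2) z"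
proof (cases "norm z > 1")
  case True then show "d \<le> 1 \<Longrightarrow> ?thesis" by (simp add: kern2_eq_0)
next
  case False
  assume d: "d \<le> 1"
  define p where "p = max 0 (d - z \<bullet> z)"
  have p: "0 \<le> p" "p \<le> 1" using d inner_ge_zero[of z] by (auto simp: p_def simp del: inner_ge_zero)
  have z: "\<bar>z \<bullet> h\<bar> \<le> norm h" for h
    using Cauchy_Schwarz_ineq2[of z h] mult_right_mono[of "norm z" 1 "norm h"] False by auto
  have "p ^ 2 * (\<bar>z \<bullet> h\<bar> * \<bar>z \<bullet> k\<bar>) \<le> 1 * (norm h * norm k)"
    using p z by (intro mult_mono) (auto intro!: power_le_one)
  moreover have "p ^ 3 * \<bar>h \<bullet> k\<bar> \<le> 1 * (norm h * norm k)"
    using p by (intro mult_mono) (auto intro!: power_le_one Cauchy_Schwarz_ineq2)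
  moreover have "\<bar>kern2 d z h k\<bar> \<le> 48 * (p ^ 2 * (\<bar>z \<bullet> h\<bar> * \<bar>z \<bullet> k\<bar>)) + 8 * (p ^ 3 * \<bar>h \<bullet> k\<bar>)"
    unfolding kern2_def p_def[symmetric]
    using p by (intro order.trans[OF abs_triangle_ineq4]) (simp add: abs_mult)
  ultimately show ?thesis using False by simp
qed

text \<open>One constant serves the first and second derivatives (with factors 8 and 56) and the
  Taylor remainder (with factor 2000) at once; the ball of radius 2 is the one in the indicators of
  those bounds.\<close>

definition kbound :: "'e::euclidean_space itself \<Rightarrow> real \<Rightarrow> real" where
  "kbound _ d = 2000 * measure lborel (cball (0::'e) 2) / kmass TYPE('e) d"

lemma kernel_quotient_bound:
  fixes f :: "'e::euclidean_space \<Rightarrow> real"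
  assumes "integrable lborel (\<lambda>y. f y * k y)" "\<And>y. \<bar>f y\<bar> \<le> N" "0 < d" "d \<le> 1"
    and "\<And>y. \<bar>k y\<bar> \<le> 2000 * B * indicator (cball 0 2) (y - z)"
  shows "\<bar>(\<integral>y. f y * k y \<partial>lborel) / kmass TYPE('e) d\<bar> \<le> kbound TYPE('e) d * N * B"
proof -
  have "\<bar>f y * k y\<bar> \<le> N * 2000 * B * indicator (cball z 2) y" for y
  proof -
    have "\<bar>f y\<bar> * \<bar>k y\<bar> \<le> N * (2000 * B * indicator (cball 0 2) (y - z))"
      using assms(2)[of y] by (intro mult_mono assms) auto
    moreover have "indicator (cball 0 2) (y - z) = (indicator (cball z 2) y :: real)"
      by (auto simp: indicator_def dist_norm norm_minus_commute)
    ultimately show ?thesis by (simp add: abs_mult mult_ac)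
  qed
  from integral_abs_le_cball[OF assms(1) this]
  have "\<bar>\<integral>y. f y * k y \<partial>lborel\<bar> \<le> N * 2000 * B * measure lborel (cball (0::'e) 2)" .
  then show ?thesis using kmass_pos[where 'e='e, OF assms(3,4)]
    unfolding kbound_def by (simp add: abs_divide divide_right_mono mult_ac)
qed

text \<open>All smoothness sits in the kernel, so the constants see \<open>f\<close> only through
  its bound \<open>N\<close>. They are therefore the same for \<open>w\<close> and for all its
  resolvents.\<close>

lemma avg_jet_bounds:
  fixes f :: "'e::euclidean_space \<Rightarrow> real"
  assumes "continuous_on UNIV f" "\<And>y. \<bar>f y\<bar> \<le> N" "0 < d" "d \<le> 1"
  shows "\<bar>avg1 d f z h\<bar> \<le> kbound TYPE('e) d * N * norm h"
    "\<bar>avg2 d f z h k\<bar> \<le> kbound TYPE('e) d * N * (norm h * norm k)"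
    "norm h \<le> 1 \<Longrightarrow> \<bar>avg d f (z + h) - avg d f z - avg1 d f z h - 1/2 * avg2 d f z h h\<bar>
       \<le> kbound TYPE('e) d * N * norm h ^ 3"
proof -
  show "\<bar>avg1 d f z h\<bar> \<le> kbound TYPE('e) d * N * norm h" unfolding avg1_def
    by (rule kernel_quotient_bound[OF integrable_kernel(2) assms(2,3,4)])
       (use assms in \<open>auto intro!: order.trans[OF kern1_bound] mult_right_mono\<close>)
  have 0: "0 \<le> norm h * norm k" by simp
  show "\<bar>avg2 d f z h k\<bar> \<le> kbound TYPE('e) d * N * (norm h * norm k)" unfolding avg2_def
    by (rule kernel_quotient_bound[OF integrable_kernel(3) assms(2,3,4)])
       (use assms 0 in \<open>auto intro!: order.trans[OF kern2_bound] mult_right_mono\<close>)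
  assume h: "norm h \<le> 1"
  have I: "integrable lborel (\<lambda>y. f y * (kern d (y - (z + h)) - kern d (y - z) - kern1 d (y - z) (- h) - 1/2 * kern2 d (y - z) h h))"
    using integrable_kernel[OF assms(1,4)] by (simp add: right_diff_distrib mult.left_commute)
  have "avg d f (z + h) - avg d f z - avg1 d f z h - 1/2 * avg2 d f z h h
     = (\<integral>y. f y * (kern d (y - (z + h)) - kern d (y - z) - kern1 d (y - z) (- h) - 1/2 * kern2 d (y - z) h h) \<partial>lborel) / kmass TYPE('e) d"
    unfolding avg_def avg1_def avg2_def right_diff_distrib
    using integrable_kernel[OF assms(1,4)]
    by (simp add: diff_divide_distrib mult.left_commute)
  also have "\<bar>\<dots>\<bar> \<le> kbound TYPE('e) d * N * norm h ^ 3"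
  proof (rule kernel_quotient_bound[OF I assms(2,3,4)])
    fix y
    have "kern2 d (y - z) (- h) (- h) = kern2 d (y - z) h h" by (simp add: kern2_def)
    then show "\<bar>kern d (y - (z + h)) - kern d (y - z) - kern1 d (y - z) (- h) - 1/2 * kern2 d (y - z) h h\<bar>
      \<le> 2000 * norm h ^ 3 * indicator (cball 0 2) (y - z)"
      using kern_taylor[OF assms(4), of "- h" "y - z"] h
      by (simp add: algebra_simps)
  qed
  finally show "\<bar>avg d f (z + h) - avg d f z - avg1 d f z h - 1/2 * avg2 d f z h h\<bar> \<le> kbound TYPE('e) d * N * norm h ^ 3" .
qed

text \<open>Substitution by a translation. No measurability of \<open>f\<close> is assumed: for a
  nonmeasurable integrand both integrals take the default value 0.\<close>

lemma avg_translate: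
  fixes f :: "'e::euclidean_space \<Rightarrow> real"
  shows "avg d f z = (\<integral>y. f (z + y) * kern d y \<partial>lborel) / kmass TYPE('e) d"
proof -
  have "(\<integral>y. f y * kern d (y - z) \<partial>lborel) = (\<integral>y. f y * kern d (y - z) \<partial>distr lborel borel ((+) z))"
    by (simp add: lborel_distr_plus)
  also have "\<dots> = (\<integral>y. f (z + y) * kern d (z + y - z) \<partial>lborel)"
  proof (cases "(\<lambda>y. f y * kern d (y - z)) \<in> borel_measurable borel")
    case True then show ?thesis by (subst integral_distr) auto
  next
    case False
    have "\<not> integrable lborel (\<lambda>y. f (z + y) * kern d (z + y - z))"
    proof
      assume "integrable lborel (\<lambda>y. f (z + y) * kern d (z + y - z))"
      then have "(\<lambda>y. f (z + y) * kern d (z + y - z)) \<in> borel_measurable borel" by simp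
      then have "(\<lambda>x. (\<lambda>y. f (z + y) * kern d (z + y - z)) (x - z)) \<in> borel_measurable borel"
        by (rule measurable_compose[rotated]) simp
      then show False using False by (simp add: algebra_simps)
    qed
    moreover have "\<not> integrable (distr lborel borel ((+) z)) (\<lambda>y. f y * kern d (y - z))"
      using False by (auto dest: borel_measurable_integrable)
    ultimately show ?thesis by (simp add: not_integrable_integral_eq)
  qed
  finally show ?thesis by (simp add: avg_def)
qed

section \<open>Random walks and their resolvents\<close>

text \<open>The step length makes \<open>gen b s\<close> the generator of the walk, up to an error of order \<open>sqrt D\<close>.\<close>

definition walk :: "real \<Rightarrow> 'e::euclidean_space \<Rightarrow> ('d::finite \<Rightarrow> 'e) \<Rightarrow> ('e \<Rightarrow> real) \<Rightarrow> 'e \<Rightarrow> real" where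
  "walk D b s f z =
     (\<Sum>i\<in>UNIV. f (z + (D *\<^sub>R b + sqrt (real CARD('d) * D) *\<^sub>R s i)) + f (z + (D *\<^sub>R b - sqrt (real CARD('d) * D) *\<^sub>R s i)))
       / (2 * real CARD('d))"

definition gen :: "'e::euclidean_space \<Rightarrow> ('d::finite \<Rightarrow> 'e) \<Rightarrow> ('e \<Rightarrow> real) \<Rightarrow> ('e \<Rightarrow> 'e \<Rightarrow> real) \<Rightarrow> real" where
  "gen b s l B = l b + 1/2 * (\<Sum>i\<in>UNIV. B (s i) (s i))"

text \<open>For \<open>0 < D \<le> 1\<close> no step of the walk is longer than
  \<open>step_size b s * sqrt D\<close>: the drift contributes \<open>D * norm b\<close>, and
  \<open>D \<le> sqrt D\<close>.\<close>

definition step_size :: "'e::euclidean_space \<Rightarrow> ('d::finite \<Rightarrow> 'e) \<Rightarrow> real" where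
  "step_size b s = norm b + sqrt (real CARD('d)) * (\<Sum>i\<in>UNIV. norm (s i))"

lemma walk_abs_le:
  fixes s :: "'d::finite \<Rightarrow> 'e::euclidean_space"
  assumes "\<And>z. \<bar>f z\<bar> \<le> N"
  shows "\<bar>walk D b s f z\<bar> \<le> N"
proof -
  have t: "\<bar>f x + f y\<bar> \<le> 2 * N" for x y using assms[of x] assms[of y] by linarith
  have "\<bar>\<Sum>i\<in>UNIV. f (z + (D *\<^sub>R b + sqrt (real CARD('d) * D) *\<^sub>R s i)) + f (z + (D *\<^sub>R b - sqrt (real CARD('d) * D) *\<^sub>R s i))\<bar>
     \<le> (\<Sum>i\<in>(UNIV::'d set). 2 * N)"
    by (intro order.trans[OF sum_abs] sum_mono t)
  then have "\<bar>\<Sum>i\<in>UNIV. f (z + (D *\<^sub>R b + sqrt (real CARD('d) * D) *\<^sub>R s i)) + f (z + (D *\<^sub>R b - sqrt (real CARD('d) * D) *\<^sub>R s i))\<bar>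
     \<le> N * (2 * real CARD('d))" by (simp add: mult_ac)
  then show ?thesis unfolding walk_def by (simp add: abs_divide divide_le_eq)
qed

lemma walk_diff: "walk D b s (\<lambda>y. f y - g y) z = walk D b s f z - walk D b s g z"
  unfolding walk_def diff_divide_distrib[symmetric] sum_subtractf[symmetric]
  by (simp add: algebra_simps)

lemma walk_shift: "walk D b s (\<lambda>y. f (y + h)) z = walk D b s f (z + h)"
  unfolding walk_def by (simp add: add_ac)

lemma continuous_walk:
  assumes "continuous_on UNIV f"
  shows "continuous_on UNIV (walk D b s f)"
  unfolding walk_def
  by (intro continuous_intros continuous_on_compose2[OF assms]) auto

lemma avg_shift: "avg d (\<lambda>y. f (y + h)) z = avg d f (z + h)"
  unfolding avg_translate by (simp add: add_ac)

lemma avg_cmult: "avg d (\<lambda>y. c * f y) z = c * avg d f z"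
  unfolding avg_def by (simp add: mult.assoc)

lemma avg_add:
  assumes "continuous_on UNIV f" "continuous_on UNIV g" "d \<le> 1"
  shows "avg d (\<lambda>y. f y + g y) z = avg d f z + avg d g z"
  unfolding avg_def add_divide_distrib[symmetric]
  by (subst Bochner_Integration.integral_add[symmetric];
      auto intro!: integrable_kernel assms simp: algebra_simps)

lemma avg_sum:
  assumes "\<And>i. i \<in> I \<Longrightarrow> continuous_on UNIV (f i)" "d \<le> 1" "finite I"
  shows "avg d (\<lambda>y. \<Sum>i\<in>I. f i y) z = (\<Sum>i\<in>I. avg d (f i) z)"
  using assms(3,1)
proof (induction I)
  case empty then show ?case by (simp add: avg_def)
next
  case (insert i I)
  then show ?case by (simp add: avg_add assms(2) continuous_on_sum)
qed

text \<open>A walk step is a finite average of translates, and convolution commutes with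
  translations. This is the point at which the coefficients must be constant.\<close>

lemma avg_walk:
  fixes s :: "'d::finite \<Rightarrow> 'e::euclidean_space"
  assumes f: "continuous_on UNIV f" and d: "d \<le> 1"
  shows "avg d (walk D b s f) z = walk D b s (avg d f) z"
proof -
  have c: "continuous_on UNIV (\<lambda>y. f (y + h))" for h
    by (intro continuous_intros continuous_on_compose2[OF f]) auto
  have "avg d (walk D b s f) z = avg d (\<lambda>y. (1 / (2 * real CARD('d))) *
     (\<Sum>i\<in>UNIV. f (y + (D *\<^sub>R b + sqrt (real CARD('d) * D) *\<^sub>R s i)) + f (y + (D *\<^sub>R b - sqrt (real CARD('d) * D) *\<^sub>R s i)))) z"
    unfolding walk_def by simp
  also have "\<dots> = walk D b s (avg d f) z"
    unfolding avg_cmult walk_def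
    by (subst avg_sum) (auto intro!: continuous_intros c d simp: avg_add[OF c c d] avg_shift)
  finally show ?thesis .
qed

lemma avg_close:
  fixes f :: "'e::euclidean_space \<Rightarrow> real"
  assumes "continuous_on UNIV f" "0 < d" "d \<le> 1" and e: "\<And>h. norm h \<le> sqrt d \<Longrightarrow> f (z + h) \<le> c"
  shows "avg d f z \<le> c"
proof -
  have k: "kern d y = 0" if "\<not> norm (y::'e) \<le> sqrt d" for y
  proof -
    have "d \<le> y \<bullet> y" using that by (auto simp: norm_eq_sqrt_inner)
    then show ?thesis by (simp add: kern_def)
  qed
  have s: "continuous_on UNIV (\<lambda>y. f (z + y))"
    by (intro continuous_intros continuous_on_compose2[OF assms(1)]) auto
  have le: "f (z + y) * kern d y \<le> c * kern d y" for y
    using e[of y] k[of y] kern_nonneg[of d y] by (cases "norm y \<le> sqrt d") (auto intro: mult_right_mono)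
  have "(\<integral>y. f (z + y) * kern d y \<partial>lborel) \<le> (\<integral>y. c * kern d (y::'e) \<partial>lborel)"
    by (rule integral_mono[OF _ _ le])
       (use integrable_kernel(1)[OF s assms(3), of 0] integrable_kernel(1)[of "\<lambda>_. c" d 0] assms in auto)
  then show ?thesis unfolding avg_translate using kmass_pos[where 'e='e, OF assms(2,3)]
    by (simp add: divide_le_eq kmass_def)
qed

lemma avg_close':
  fixes f :: "'e::euclidean_space \<Rightarrow> real"
  assumes f: "continuous_on UNIV f" and d: "0 < d" "d \<le> 1" and e: "\<And>h. norm h \<le> sqrt d \<Longrightarrow> c \<le> f (z + h)"
  shows "c \<le> avg d f z"
proof -
  have "avg d (\<lambda>y. - 1 * f y) z \<le> - c"
    using e by (intro avg_close) (auto intro!: continuous_intros f d)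
  then show ?thesis unfolding avg_cmult by simp
qed

text \<open>The steps come in pairs \<open>a + t i\<close>, \<open>a - t i\<close>; adding them
  cancels what is odd in \<open>t i\<close>, so that only \<open>l a\<close>, \<open>B a a\<close>
  and \<open>B (t i) (t i)\<close> survive. The factor \<open>CARD('d)\<close> under the root
  compensates for the averaging over the directions \<open>i\<close>. The drift term
  \<open>B a a\<close> is of order \<open>D^2\<close>, the cubic remainder of order
  \<open>D * sqrt D\<close>.\<close>

lemma walk_generator:
  fixes s :: "'d::finite \<Rightarrow> 'e::euclidean_space"
  assumes l: "linear l" and B: "bilinear B" "\<And>h k. \<bar>B h k\<bar> \<le> C * (norm h * norm k)"
    and f: "\<And>h. norm h \<le> 1 \<Longrightarrow> \<bar>f (z + h) - f z - l h - 1/2 * B h h\<bar> \<le> C * norm h ^ 3"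
    and D: "0 < D" "D \<le> 1" "step_size b s * sqrt D \<le> 1"
  shows "\<bar>walk D b s f z - f z - D * gen b s l B\<bar>
          \<le> C * (step_size b s ^ 3 + step_size b s ^ 2) * (D * sqrt D)"
proof -
  define S where "S = step_size b s"
  define m where "m = real CARD('d)"
  define a where "a = D *\<^sub>R b"
  define t where "t i = sqrt (m * D) *\<^sub>R s i" for i
  have C: "0 \<le> C"
  proof -
    obtain u :: 'e where "u \<in> Basis" by (meson nonempty_Basis ex_in_conv)
    then show ?thesis using B(2)[of u u] by auto
  qed
  have m: "m \<ge> 1" unfolding m_def by (simp add: Suc_leI)
  have DD: "D \<le> sqrt D" using D by (simp add: real_le_rsqrt power2_eq_square mult_left_le)
  have S0: "0 \<le> S" unfolding S_def step_size_def by (auto intro!: add_nonneg_nonneg sum_nonneg mult_nonneg_nonneg)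
  have bS: "norm b \<le> S" unfolding S_def step_size_def by (auto intro!: sum_nonneg mult_nonneg_nonneg)
  have st: "norm a + norm (t i) \<le> S * sqrt D" for i
  proof -
    have "norm (s i) \<le> (\<Sum>i\<in>UNIV. norm (s i))" by (rule member_le_sum) auto
    then have "sqrt m * norm (s i) \<le> sqrt m * (\<Sum>i\<in>UNIV. norm (s i))"
      using m by (intro mult_left_mono) auto
    then have "norm b + sqrt m * norm (s i) \<le> S" unfolding S_def step_size_def m_def by simp
    then have "(norm b + sqrt m * norm (s i)) * sqrt D \<le> S * sqrt D" using D by (intro mult_right_mono) auto
    moreover have "norm a \<le> norm b * sqrt D"
      unfolding a_def using D mult_right_mono[OF DD, of "norm b"] by (simp add: mult.commute)
    moreover have "norm (t i) = sqrt m * norm (s i) * sqrt D"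
      unfolding t_def using m D by (simp add: real_sqrt_mult)
    ultimately show ?thesis by (simp add: distrib_right)
  qed
  have n: "norm (a + t i) \<le> S * sqrt D" "norm (a - t i) \<le> S * sqrt D" for i
    using st[of i] norm_triangle_ineq[of a "t i"] norm_triangle_ineq4[of a "t i"] by linarith+
  have f1: "\<bar>f (z + h) - f z - l h - 1/2 * B h h\<bar> \<le> C * (S * sqrt D) ^ 3" if "norm h \<le> S * sqrt D" for h
  proof -
    have "norm h \<le> 1" using that D(3) S_def by auto
    from f[OF this] show ?thesis using that C by (smt (verit) mult_left_mono norm_ge_zero power_mono)
  qed
  have r: "\<bar>f (z + (a + t i)) + f (z + (a - t i)) - 2 * f z - 2 * l a - B a a - B (t i) (t i)\<bar>
       \<le> 2 * C * (S * sqrt D) ^ 3" for i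
  proof -
    have "l (a + t i) + l (a - t i) = 2 * l a"
      using linear_add[OF l] linear_diff[OF l] by simp
    moreover have "B (a + t i) (a + t i) + B (a - t i) (a - t i) = 2 * B a a + 2 * B (t i) (t i)"
      by (simp add: bilinear_ladd[OF B(1)] bilinear_radd[OF B(1)] bilinear_lsub[OF B(1)] bilinear_rsub[OF B(1)])
    ultimately show ?thesis using f1[OF n(1)[of i]] f1[OF n(2)[of i]] by linarith
  qed
  have "\<bar>(\<Sum>i\<in>UNIV. f (z + (a + t i)) + f (z + (a - t i)) - 2 * f z - 2 * l a - B a a - B (t i) (t i))\<bar>
      \<le> (\<Sum>i\<in>(UNIV::'d set). 2 * C * (S * sqrt D) ^ 3)"
    by (intro order.trans[OF sum_abs] sum_mono r)
  also have "(\<Sum>i\<in>UNIV. f (z + (a + t i)) + f (z + (a - t i)) - 2 * f z - 2 * l a - B a a - B (t i) (t i))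
     = 2 * m * (walk D b s f z - f z - l a - 1/2 * B a a - (\<Sum>i\<in>UNIV. B (t i) (t i)) / (2 * m))"
  proof -
    define X where "X = (\<Sum>i\<in>UNIV. f (z + (a + t i)) + f (z + (a - t i)))"
    define Y where "Y = (\<Sum>i\<in>UNIV. B (t i) (t i))"
    have 1: "walk D b s f z = X / (2 * m)" unfolding walk_def X_def a_def t_def m_def ..
    have 2: "(\<Sum>i\<in>UNIV. f (z + (a + t i)) + f (z + (a - t i)) - 2 * f z - 2 * l a - B a a - B (t i) (t i))
      = X - m * (2 * f z) - m * (2 * l a) - m * B a a - Y"
      unfolding X_def Y_def m_def sum_subtractf by simp
    have "X - m * (2 * F) - m * (2 * G) - m * H - Y = 2 * m * (X / (2 * m) - F - G - 1/2 * H - Y / (2 * m))" for F G H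
      using m by (simp add: field_simps)
    then show ?thesis unfolding 1 2 Y_def[symmetric] .
  qed
  also have "(\<Sum>i\<in>(UNIV::'d set). 2 * C * (S * sqrt D) ^ 3) = 2 * m * (C * (S * sqrt D) ^ 3)"
    by (simp add: m_def)
  finally have 1: "\<bar>walk D b s f z - f z - l a - 1/2 * B a a - (\<Sum>i\<in>UNIV. B (t i) (t i)) / (2 * m)\<bar>
      \<le> C * (S * sqrt D) ^ 3"
    using m by (simp add: abs_mult)
  have "B (t i) (t i) = m * D * B (s i) (s i)" for i
  proof -
    have "B (t i) (t i) = (sqrt (m * D) * sqrt (m * D)) * B (s i) (s i)"
      unfolding t_def by (simp add: bilinear_lmul[OF B(1)] bilinear_rmul[OF B(1)])
    then show ?thesis using m D by simp
  qed
  then have "(\<Sum>i\<in>UNIV. B (t i) (t i)) / (2 * m) = D * (1/2 * (\<Sum>i\<in>UNIV. B (s i) (s i)))"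
    using m by (simp add: sum_distrib_left[symmetric])
  moreover have "l a = D * l b" unfolding a_def using linear_scale[OF l] by simp
  ultimately have 2: "\<bar>walk D b s f z - f z - D * gen b s l B - 1/2 * B a a\<bar> \<le> C * (S * sqrt D) ^ 3"
    using 1 unfolding gen_def by (simp add: algebra_simps)
  have "\<bar>B a a\<bar> \<le> C * (norm a * norm a)" by (rule B)
  \<comment> \<open>One factor \<open>norm a\<close> is bounded by \<open>D * S\<close>, the other
    only by \<open>sqrt D * S\<close>, to match the order of the cubic remainder.\<close>
  also have "\<dots> \<le> C * ((D * S) * (sqrt D * S))"
  proof -
    have 1: "norm a \<le> D * S" unfolding a_def using D bS by (simp add: mult_left_mono)
    also have "\<dots> \<le> sqrt D * S" using DD S0 by (rule mult_right_mono)
    finally show ?thesis using 1 C by (intro mult_left_mono mult_mono) (auto intro: order.trans[OF norm_ge_zero])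
  qed
  finally have 3: "\<bar>B a a\<bar> \<le> C * S ^ 2 * (D * sqrt D)" by (simp add: power2_eq_square mult_ac)
  have 4: "(S * sqrt D) ^ 3 = S ^ 3 * (D * sqrt D)" using D by (simp add: power_mult_distrib eval_nat_numeral)
  have "\<bar>walk D b s f z - f z - D * gen b s l B\<bar> \<le> C * (S * sqrt D) ^ 3 + C * S ^ 2 * (D * sqrt D)"
    using 2 3 by linarith
  then show ?thesis unfolding 4 S_def[symmetric] by (simp add: algebra_simps)
qed

text \<open>\<open>R\<close> is the Neumann series with weights \<open>(1 - q) * q^k\<close> on the
  \<open>k\<close>-fold walk, a convex combination of averages of translates of \<open>w\<close>;
  hence it inherits the bound and every modulus of continuity. For
  \<open>q = \<mu> / (\<mu> + D)\<close> the fixed-point equation reads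
  \<open>R - \<mu> * ((walk R - R) / D) = w\<close>.\<close>

lemma walk_resolvent:
  fixes s :: "'d::finite \<Rightarrow> 'e::euclidean_space"
  assumes q: "0 \<le> q" "q < 1" and w: "continuous_on UNIV w" "\<And>z. \<bar>w z\<bar> \<le> N"
  obtains R where "continuous_on UNIV R" "\<And>z. \<bar>R z\<bar> \<le> N"
    "\<And>z. R z = (1 - q) * w z + q * walk D b s R z"
    "\<And>h e z. (\<And>z. \<bar>w (z + h) - w z\<bar> \<le> e) \<Longrightarrow> \<bar>R (z + h) - R z\<bar> \<le> e"
proof -
  define E where "E k = ((walk D b s) ^^ k) w" for k
  have E: "E 0 = w" "E (Suc k) = walk D b s (E k)" for k by (simp_all add: E_def)
  have Eb: "\<bar>E k z\<bar> \<le> N" for k z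
    by (induction k arbitrary: z) (auto simp: E w walk_abs_le)
  have Ec: "continuous_on UNIV (E k)" for k
    by (induction k) (auto simp: E w continuous_walk)
  have Ed: "\<bar>E k (z + h) - E k z\<bar> \<le> e" if "\<And>z. \<bar>w (z + h) - w z\<bar> \<le> e" for h e k z
  proof (induction k arbitrary: z)
    case 0 then show ?case using that by (simp add: E)
  next
    case (Suc k)
    have "E (Suc k) (z + h) - E (Suc k) z = walk D b s (\<lambda>y. E k (y + h) - E k y) z"
      unfolding E walk_diff walk_shift ..
    then show ?case using walk_abs_le[of "\<lambda>y. E k (y + h) - E k y" e] Suc by simp
  qed
  have gs: "(\<lambda>k. (1 - q) * q ^ k) sums 1"
    using sums_mult[OF geometric_sums[of q], of "1 - q"] q by simp
  \<comment> \<open>Weights of total mass 1: this single estimate yields convergence, the bound and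
    the modulus of continuity.\<close>
  have bd: "\<bar>\<Sum>k. (1 - q) * q ^ k * a k\<bar> \<le> e \<and> summable (\<lambda>k. (1 - q) * q ^ k * a k)"
    if "\<And>k. \<bar>a k\<bar> \<le> e" for a :: "nat \<Rightarrow> real" and e
  proof -
    have le: "\<bar>(1 - q) * q ^ k * a k\<bar> \<le> (1 - q) * q ^ k * e" for k
      using that[of k] q by (simp add: abs_mult mult_left_mono)
    have S: "(\<lambda>k. (1 - q) * q ^ k * e) sums e" using sums_mult2[OF gs, of e] by simp
    have A: "summable (\<lambda>k. \<bar>(1 - q) * q ^ k * a k\<bar>)"
      by (rule summable_comparison_test[OF _ sums_summable[OF S]]) (use le in auto)
    have "\<bar>\<Sum>k. (1 - q) * q ^ k * a k\<bar> \<le> (\<Sum>k. \<bar>(1 - q) * q ^ k * a k\<bar>)"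
      using A by (rule summable_rabs)
    also have "\<dots> \<le> (\<Sum>k. (1 - q) * q ^ k * e)"
      by (intro suminf_le le A sums_summable[OF S])
    finally show ?thesis using sums_unique[OF S] summable_rabs_cancel[OF A] by auto
  qed
  define R where "R z = (\<Sum>k. (1 - q) * q ^ k * E k z)" for z
  have sm: "summable (\<lambda>k. (1 - q) * q ^ k * E k z)" for z using bd[of "\<lambda>k. E k z" N] Eb by auto
  have 1: "continuous_on UNIV R"
  proof -
    have "uniform_limit UNIV (\<lambda>n z. \<Sum>k<n. (1 - q) * q ^ k * E k z) R sequentially"
      unfolding R_def
    proof (rule Weierstrass_m_test)
      show "norm ((1 - q) * q ^ k * E k z) \<le> (1 - q) * q ^ k * N" for k z
        using Eb[of k z] q by (simp add: abs_mult mult_left_mono)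
      show "summable (\<lambda>k. (1 - q) * q ^ k * N)" using sums_summable[OF sums_mult2[OF gs]] .
    qed
    then show ?thesis
      by (rule uniform_limit_theorem[rotated])
         (auto intro!: always_eventually continuous_intros Ec)
  qed
  have 2: "\<bar>R z\<bar> \<le> N" for z unfolding R_def using bd[of "\<lambda>k. E k z" N] Eb by auto
  have 3: "\<bar>R (z + h) - R z\<bar> \<le> e" if "\<And>z. \<bar>w (z + h) - w z\<bar> \<le> e" for h e z
  proof -
    have "R (z + h) - R z = (\<Sum>k. (1 - q) * q ^ k * (E k (z + h) - E k z))"
      unfolding R_def by (subst suminf_diff[OF sm sm]) (simp add: algebra_simps)
    then show ?thesis using bd[of "\<lambda>k. E k (z + h) - E k z" e] Ed[OF that] by auto
  qed
  have 4: "R z = (1 - q) * w z + q * walk D b s R z" for z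
  proof -
    have "walk D b s R z = (\<Sum>k. (1 - q) * q ^ k * walk D b s (E k) z)"
    proof -
      have s2: "summable (\<lambda>k. (1 - q) * q ^ k * (E k x + E k y))" for x y
        using summable_add[OF sm[of x] sm[of y]] by (simp add: distrib_left)
      have "R x + R y = (\<Sum>k. (1 - q) * q ^ k * (E k x + E k y))" for x y
        unfolding R_def by (subst suminf_add[OF sm sm]) (simp add: distrib_left)
      then have "walk D b s R z = (\<Sum>i\<in>UNIV. \<Sum>k. (1 - q) * q ^ k * (E k (z + (D *\<^sub>R b + sqrt (real CARD('d) * D) *\<^sub>R s i)) + E k (z + (D *\<^sub>R b - sqrt (real CARD('d) * D) *\<^sub>R s i)))) / (2 * real CARD('d))"
        unfolding walk_def by simp
      also have "\<dots> = (\<Sum>k. (\<Sum>i\<in>UNIV. (1 - q) * q ^ k * (E k (z + (D *\<^sub>R b + sqrt (real CARD('d) * D) *\<^sub>R s i)) + E k (z + (D *\<^sub>R b - sqrt (real CARD('d) * D) *\<^sub>R s i)))) / (2 * real CARD('d)))"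
        by (subst suminf_divide) (auto intro!: suminf_sum[symmetric] summable_sum s2)
      also have "\<dots> = (\<Sum>k. (1 - q) * q ^ k * walk D b s (E k) z)"
        unfolding walk_def by (simp add: sum_distrib_left)
      finally show ?thesis .
    qed
    moreover have "R z = (\<Sum>k. (1 - q) * q ^ Suc k * E (Suc k) z) + (1 - q) * w z"
      unfolding R_def using suminf_split_head[OF sm[of z]] by (simp add: E)
    moreover have "(\<Sum>k. (1 - q) * q ^ Suc k * E (Suc k) z) = q * (\<Sum>k. (1 - q) * q ^ k * walk D b s (E k) z)"
    proof -
      have "summable (\<lambda>k. (1 - q) * q ^ k * walk D b s (E k) z)"
        by (rule conjunct2[OF bd[of _ N]]) (rule walk_abs_le, rule Eb)
      from suminf_mult[OF this, of q, symmetric] show ?thesis unfolding E(2) by (simp add: mult.left_commute mult.assoc)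
    qed
    ultimately show ?thesis by simp
  qed
  show ?thesis by (rule that[of R]) (use 1 2 3 4 in auto)
qed

section \<open>Mollified viscosity supersolutions\<close>

text \<open>The pairs \<open>(l, B)\<close> range over the second-order subjets of \<open>w\<close>
  at \<open>P\<close>, the little-o being written as an arbitrarily small multiple of
  \<open>(norm h)^2\<close>. Time is later one coordinate of the Euclidean space, with drift
  component 1 in the parabolic inequality.\<close>

definition visc_super ::
  "'e::euclidean_space \<Rightarrow> ('d::finite \<Rightarrow> 'e) \<Rightarrow> real \<Rightarrow> ('e \<Rightarrow> real) \<Rightarrow> 'e \<Rightarrow> bool" where
  "visc_super b s c w P \<longleftrightarrow> (\<forall>l B. linear l \<longrightarrow> bilinear B \<longrightarrow> (\<forall>h k. B h k = B k h) \<longrightarrow>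
     (\<forall>\<eta>>0. \<forall>\<^sub>F h in nhds 0. w P + l h + 1/2 * B h h - \<eta> * (norm h)\<^sup>2 \<le> w (P + h)) \<longrightarrow>
     gen b s l B \<le> c)"

lemma gen_diff: "gen b s (\<lambda>h. l h - l' h) (\<lambda>h k. B h k - B' h k) = gen b s l B - gen b s l' B'"
  by (simp add: gen_def sum_subtractf algebra_simps)

lemma bilinear_diff_fun:
  "bilinear B \<Longrightarrow> bilinear B' \<Longrightarrow> bilinear (\<lambda>h k. B h k - B' h k)"
  unfolding bilinear_def by (auto intro!: linear_compose_sub)

lemma eventually_nhds_0_norm:
  fixes P :: "'e::real_normed_vector \<Rightarrow> bool"
  assumes "0 < \<delta>" "\<And>h. norm h \<le> \<delta> \<Longrightarrow> P h"
  shows "\<forall>\<^sub>F h in nhds 0. P h"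
  unfolding eventually_nhds_metric using assms by (intro exI[of _ \<delta>]) auto

text \<open>With \<open>quart2\<close>, the first and second derivative of the barrier
  \<open>(v \<bullet> v)^2\<close> at \<open>v\<close>.\<close>

definition quart1 :: "'e::euclidean_space \<Rightarrow> 'e \<Rightarrow> real" where
  "quart1 v h = 4 * (v \<bullet> v) * (v \<bullet> h)"
definition quart2 :: "'e::euclidean_space \<Rightarrow> 'e \<Rightarrow> 'e \<Rightarrow> real" where
  "quart2 v h k = 4 * (v \<bullet> v) * (h \<bullet> k) + 8 * ((v \<bullet> h) * (v \<bullet> k))"

lemma quart_expansion:
  fixes v h :: "'e::euclidean_space"
  assumes "norm v \<le> r" "norm h \<le> 1"
  shows "((v + h) \<bullet> (v + h))\<^sup>2 \<le> (v \<bullet> v)\<^sup>2 + quart1 v h + 1/2 * quart2 v h h + (4 * r + 1) * norm h ^ 3"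
proof -
  have "((v + h) \<bullet> (v + h))\<^sup>2 = (v \<bullet> v)\<^sup>2 + quart1 v h + 1/2 * quart2 v h h + (4 * (v \<bullet> h) * (h \<bullet> h) + (h \<bullet> h)\<^sup>2)"
    unfolding quart1_def quart2_def
    by (simp add: inner_add_left inner_add_right inner_commute[of h v]) algebra
  moreover have "v \<bullet> h \<le> r * norm h"
    using norm_cauchy_schwarz[of v h] mult_right_mono[OF assms(1), of "norm h"] by simp
  then have "(v \<bullet> h) * (h \<bullet> h) \<le> r * norm h * (norm h)\<^sup>2"
    by (simp add: dot_square_norm mult_right_mono)
  moreover have "(h \<bullet> h)\<^sup>2 \<le> norm h ^ 3"
    using assms(2) by (simp add: dot_square_norm flip: power_mult) (rule power_decreasing, auto)
  ultimately show ?thesis by (simp add: algebra_simps power2_eq_square power3_eq_cube)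
qed

text \<open>By Cauchy-Schwarz every term keeps a factor \<open>v \<bullet> v\<close>, so that the
  quartic barrier itself can absorb its generator by completing a square.\<close>

lemma quart_gen_bound:
  fixes s :: "'d::finite \<Rightarrow> 'e::euclidean_space"
  assumes "norm v \<le> r"
  shows "gen b s (quart1 v) (quart2 v) \<le> (4 * r * norm b + 6 * (\<Sum>i\<in>UNIV. (norm (s i))\<^sup>2)) * (v \<bullet> v)"
proof -
  have "v \<bullet> b \<le> r * norm b"
    using norm_cauchy_schwarz[of v b] mult_right_mono[OF assms(1), of "norm b"] by simp
  then have "4 * (v \<bullet> v) * (v \<bullet> b) \<le> 4 * (v \<bullet> v) * (r * norm b)" by (intro mult_left_mono) auto
  moreover have "quart2 v (s i) (s i) \<le> 12 * (v \<bullet> v) * (norm (s i))\<^sup>2" for i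
  proof -
    have "(v \<bullet> s i) * (v \<bullet> s i) \<le> (v \<bullet> v) * (s i \<bullet> s i)"
      using Cauchy_Schwarz_ineq[of v "s i"] by (simp add: power2_eq_square)
    then show ?thesis unfolding quart2_def by (simp add: dot_square_norm)
  qed
  then have "(\<Sum>i\<in>UNIV. quart2 v (s i) (s i)) \<le> (\<Sum>i\<in>UNIV. 12 * (v \<bullet> v) * (norm (s i))\<^sup>2)"
    by (intro sum_mono)
  ultimately show ?thesis unfolding gen_def quart1_def
    by (simp add: sum_distrib_left[symmetric] algebra_simps)
qed

lemma linear_quart1: "linear (quart1 v)"
  by (rule linearI) (simp_all add: quart1_def inner_simps algebra_simps)

lemma bilinear_quart2: "bilinear (quart2 v)"
  unfolding bilinear_def quart2_def
  by (auto intro!: linearI simp: inner_simps algebra_simps)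

lemma gen_cmult: "gen b s (\<lambda>h. c * l h) (\<lambda>h k. c * B h k) = c * gen b s l B"
  by (simp add: gen_def sum_distrib_left[symmetric] algebra_simps)

lemma bilinear_cmult_fun: "bilinear B \<Longrightarrow> bilinear (\<lambda>h k. c * B h k :: real)"
  unfolding bilinear_def by (auto intro!: linear_compose_scale_right[where 'b=real, unfolded real_scaleR_def])

lemma continuous_avg:
  fixes R :: "'e::euclidean_space \<Rightarrow> real"
  assumes R: "continuous_on UNIV R" "\<And>z. \<bar>R z\<bar> \<le> N" and k: "0 < k" "k \<le> 1"
  shows "continuous_on UNIV (avg k R)"
proof -
  note jets = avg_jet_bounds[OF R k]
  have N: "0 \<le> N" using R(2)[of 0] by linarith
  have kb: "0 \<le> kbound TYPE('e) k" unfolding kbound_def using kmass_pos[where 'e='e, OF k] by auto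
  have "isCont (avg k R) P" for P
  proof -
    \<comment> \<open>Three contributions, from the two derivatives and the remainder, each at most
      \<open>kbound * N * norm h\<close> when \<open>norm h \<le> 1\<close>.\<close>
    define C where "C = 3 * (kbound TYPE('e) k * N)"
    have C: "0 \<le> C" using kb N by (auto simp: C_def)
    have "\<bar>avg k R (P + h) - avg k R P\<bar> \<le> C * norm h" if h: "norm h \<le> 1" for h
    proof -
      have kN: "0 \<le> kbound TYPE('e) k * N" using kb N by auto
      have "norm h ^ 3 \<le> norm h" "norm h * norm h \<le> norm h"
        using h power_decreasing[of 1 3 "norm h"] by (auto simp: mult_left_le)
      then have "kbound TYPE('e) k * N * norm h ^ 3 \<le> kbound TYPE('e) k * N * norm h"
        "kbound TYPE('e) k * N * (norm h * norm h) \<le> kbound TYPE('e) k * N * norm h"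
        using kN by (auto intro!: mult_left_mono)
      then show ?thesis using jets(1)[of P h] jets(2)[of P h h] jets(3)[OF h, of P] h
        unfolding C_def by (simp add: algebra_simps)
    qed
    then have ev: "\<forall>\<^sub>F h in at 0. norm (avg k R (P + h) - avg k R P) \<le> norm h * C"
      unfolding eventually_at by (intro exI[of _ 1]) (auto simp: mult.commute)
    have "((\<lambda>h. norm h) \<longlongrightarrow> 0) (at (0::'e))" using tendsto_norm_zero_iff[of "\<lambda>h. h" "at (0::'e)"] by simp
    from tendsto_mult_right_zero[OF this, of C]
    have "((\<lambda>h. norm h * C) \<longlongrightarrow> 0) (at (0::'e))" by (simp add: mult.commute)
    from Lim_null_comparison[OF ev this]
    have "((\<lambda>h. avg k R (P + h) - avg k R P) \<longlongrightarrow> 0) (at 0)" .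
    then show ?thesis unfolding isCont_def by (subst LIM_offset_zero_iff) (auto simp: Lim_null[symmetric] LIM_zero_iff)
  qed
  then show ?thesis by (simp add: continuous_at_imp_continuous_on)
qed

text \<open>The resolvent equation is linear and translation invariant, so mollifying its solution
  mollifies its right-hand side.\<close>

lemma avg_resolvent:
  assumes R: "continuous_on UNIV R" and eq: "\<And>z. R z - \<mu> * ((walk D b s R z - R z) / D) = w z"
    and D: "0 < D" and k: "k \<le> 1"
  shows "avg k R P - \<mu> * ((walk D b s (avg k R) P - avg k R P) / D) = avg k w P"
proof -
  have lin: "avg k (\<lambda>y. a * R y - c * walk D b s R y) P = a * avg k R P - c * walk D b s (avg k R) P" for a c
    unfolding avg_walk[OF R(1) k, symmetric] avg_cmult[symmetric]
    by (rule avg_diff(1)) (auto intro!: continuous_intros R k continuous_walk)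
  have "w = (\<lambda>y. (1 + \<mu> / D) * R y - (\<mu> / D) * walk D b s R y)"
    using eq D by (auto simp: fun_eq_iff field_simps)
  then have "avg k w P = avg k (\<lambda>y. (1 + \<mu> / D) * R y - (\<mu> / D) * walk D b s R y) P" by simp
  also have "\<dots> = (1 + \<mu> / D) * avg k R P - (\<mu> / D) * walk D b s (avg k R) P"
    by (rule lin)
  finally show ?thesis by (simp add: diff_divide_distrib right_diff_distrib distrib_right)
qed

text \<open>
  The barrier is a quartic because its generator vanishes quadratically at the centre, so that it costs
  only \<open>O(\<mu>\<^sup>2)\<close>; a quadratic barrier would cost \<open>O(\<mu>)\<close>, the order of the quantity to be controlled.
\<close>

lemma resolvent_below:
  fixes s :: "'d::finite \<Rightarrow> 'e::euclidean_space"
  assumes w: "continuous_on UNIV w" "\<And>z. \<bar>w z\<bar> \<le> N" and R: "continuous_on UNIV R" "\<And>z. \<bar>R z\<bar> \<le> N"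
    and eq: "\<And>z. R z - \<mu> * ((walk D b s R z - R z) / D) = w z"
    and mu: "0 < \<mu>" "\<mu> \<le> 1" and D: "0 < D" "D \<le> 1" "step_size b s * sqrt D \<le> 1"
    and k: "0 < k" "k \<le> 1"
    and ek: "\<And>z h. norm h \<le> sqrt k \<Longrightarrow> \<bar>w (z + h) - w z\<bar> \<le> e" "\<And>z h. norm h \<le> sqrt k \<Longrightarrow> \<bar>R (z + h) - R z\<bar> \<le> e"
    and r: "0 < r" and visc: "\<And>P. P \<in> ball P0 r \<Longrightarrow> visc_super b s c w P"
  shows "R P0 \<le> w P0 + 2 * e + \<mu> * c
     + \<mu> * (kbound TYPE('e) k * N * (step_size b s ^ 3 + step_size b s ^ 2) * sqrt D)
     + (2 * N + \<bar>c\<bar>) / r ^ 4 * (4 * r * norm b + 6 * (\<Sum>i\<in>UNIV. (norm (s i))\<^sup>2))\<^sup>2 * \<mu>\<^sup>2"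
proof -
  \<comment> \<open>\<open>R\<close> is merely continuous; its mollification is an admissible test
    function. The price is one \<open>e\<close> for \<open>z\<close> against \<open>R\<close> and
    one for \<open>avg k w\<close> against \<open>w\<close>.\<close>
  define z where "z = avg k R"
  define K where "K = kbound TYPE('e) k * N * (step_size b s ^ 3 + step_size b s ^ 2) * sqrt D"
  \<comment> \<open>The barrier equals \<open>2 * N + \<bar>c\<bar>\<close> on the sphere of radius
    \<open>r\<close>, where \<open>w - z\<close> is at least \<open>- 2 * N\<close>.\<close>
  define Kb where "Kb = (2 * N + \<bar>c\<bar>) / r ^ 4"
  define \<Gamma> where "\<Gamma> = 4 * r * norm b + 6 * (\<Sum>i\<in>UNIV. (norm (s i))\<^sup>2)"
  define J where "J P = w P - z P + Kb * ((P - P0) \<bullet> (P - P0))\<^sup>2" for P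
  note jets = avg_jet_bounds[OF R k]
  have N: "0 \<le> N" using w(2)[of 0] by linarith
  have e0: "0 \<le> e" using ek(1)[of 0 0] k by simp
  have Kb: "0 \<le> Kb" unfolding Kb_def using N r by auto
  have \<Gamma>: "0 \<le> \<Gamma>" unfolding \<Gamma>_def using r by (auto intro!: add_nonneg_nonneg sum_nonneg)
  have kb: "0 \<le> kbound TYPE('e) k" unfolding kbound_def using kmass_pos[where 'e='e, OF k] by auto
  have S0: "0 \<le> step_size b s" unfolding step_size_def by (auto intro!: add_nonneg_nonneg sum_nonneg mult_nonneg_nonneg)
  have K: "0 \<le> K" unfolding K_def using kb N S0 D by auto
  have zb: "\<bar>z P\<bar> \<le> N" for P
    unfolding z_def using avg_close[OF R(1) k, of P N] avg_close'[OF R(1) k, of "-N" P] R(2)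
    by (smt (verit, best))
  have zc: "continuous_on UNIV z" unfolding z_def by (rule continuous_avg[OF R k])
  have J: "continuous_on UNIV J" unfolding J_def by (intro continuous_intros w zc)
  obtain P where P: "P \<in> cball P0 r" "\<And>Q. Q \<in> cball P0 r \<Longrightarrow> J P \<le> J Q"
  proof -
    have "cball P0 r \<noteq> {}" using r by simp
    from continuous_attains_inf[OF compact_cball this continuous_on_subset[OF J subset_UNIV]]
    show ?thesis using that by blast
  qed
  define v where "v = P - P0"
  have v: "norm v \<le> r" using P(1) by (simp add: v_def dist_norm norm_minus_commute)
  have main: "- (e + \<mu> * c + \<mu> * K + Kb * \<Gamma>\<^sup>2 * \<mu>\<^sup>2) \<le> J P"
  proof (cases "norm v = r")
    \<comment> \<open>A minimum on the sphere gives \<open>J P \<ge> \<bar>c\<bar>\<close>, which is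
      enough because \<open>\<mu> \<le> 1\<close>.\<close>
    case True
    then have "(v \<bullet> v)\<^sup>2 = r ^ 4" by (simp add: dot_square_norm flip: power_mult)
    then have "Kb * (v \<bullet> v)\<^sup>2 = 2 * N + \<bar>c\<bar>" using r by (simp add: Kb_def)
    then have "\<bar>c\<bar> \<le> J P" unfolding J_def v_def[symmetric] using w(2)[of P] zb[of P] by linarith
    moreover have "- (\<mu> * c) \<le> 1 * \<bar>c\<bar>" 
    proof -
      have "\<mu> * (- c) \<le> \<mu> * \<bar>c\<bar>" using mu by (intro mult_left_mono) auto
      also have "\<dots> \<le> 1 * \<bar>c\<bar>" using mu by (intro mult_right_mono) auto
      finally show ?thesis by simp
    qed
    moreover have "0 \<le> \<mu> * K" "0 \<le> Kb * \<Gamma>\<^sup>2 * \<mu>\<^sup>2" using mu K Kb by auto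
    ultimately show ?thesis using e0 by linarith
  next
    case False
    then have vr: "norm v < r" using v by simp
    then have Pb: "P \<in> ball P0 r" by (simp add: v_def dist_norm norm_minus_commute)
    \<comment> \<open>At an interior minimum of \<open>J\<close>, the jet of \<open>z\<close> minus
      that of the barrier is a subjet of \<open>w\<close>.\<close>
    define l where "l h = avg1 k R P h - Kb * quart1 v h" for h
    define B where "B h k' = avg2 k R P h k' - Kb * quart2 v h k'" for h k'
    have "gen b s l B \<le> c"
    proof (rule visc[OF Pb, unfolded visc_super_def, rule_format])
      show "linear l" unfolding l_def
        by (intro linear_compose_sub linear_avg1 R k linear_compose_scale_right[where 'b=real, unfolded real_scaleR_def] linear_quart1)
      show "bilinear B" unfolding B_def
        by (intro bilinear_diff_fun bilinear_avg2 R k bilinear_cmult_fun bilinear_quart2)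
      show "B h k' = B k' h" for h k' by (simp add: B_def avg2_sym[of k R P h k'] quart2_def inner_commute)
      fix \<eta> :: real assume \<eta>: "0 < \<eta>"
      define C where "C = kbound TYPE('e) k * N + Kb * (4 * r + 1)"
      have C: "0 \<le> C" using kb N Kb r by (auto simp: C_def)
      define \<delta> where "\<delta> = Min {1, r - norm v, \<eta> / (C + 1)}"
      have \<delta>: "0 < \<delta>" "\<delta> \<le> 1" "\<delta> \<le> r - norm v" "\<delta> \<le> \<eta> / (C + 1)"
        using vr \<eta> C by (auto simp: \<delta>_def)
      show "\<forall>\<^sub>F h in nhds 0. w P + l h + 1/2 * B h h - \<eta> * (norm h)\<^sup>2 \<le> w (P + h)"
      proof (rule eventually_nhds_0_norm[OF \<delta>(1)])
        fix h :: 'e assume h: "norm h \<le> \<delta>"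
        have h1: "norm h \<le> 1" using h \<delta> by linarith
        have "norm (v + h) \<le> r" using norm_triangle_ineq[of v h] h \<delta> by linarith
        then have "P + h \<in> cball P0 r" by (simp add: v_def dist_norm norm_minus_commute algebra_simps)
        from P(2)[OF this] have "J P \<le> J (P + h)" .
        moreover have "P + h - P0 = v + h" by (simp add: v_def)
        ultimately have "w P - z P + Kb * (v \<bullet> v)\<^sup>2 \<le> w (P + h) - z (P + h) + Kb * ((v + h) \<bullet> (v + h))\<^sup>2"
          unfolding J_def v_def[symmetric] by simp
        moreover have "Kb * ((v + h) \<bullet> (v + h))\<^sup>2 \<le> Kb * ((v \<bullet> v)\<^sup>2 + quart1 v h + 1/2 * quart2 v h h + (4 * r + 1) * norm h ^ 3)"
          by (rule mult_left_mono[OF quart_expansion[OF v h1] Kb])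
        moreover have "\<bar>z (P + h) - z P - avg1 k R P h - 1/2 * avg2 k R P h h\<bar> \<le> kbound TYPE('e) k * N * norm h ^ 3"
          unfolding z_def by (rule jets(3)[OF h1])
        moreover have "C * norm h ^ 3 \<le> \<eta> * (norm h)\<^sup>2"
        proof -
          have "(C + 1) * norm h \<le> \<eta>" using h \<delta>(4) C by (simp add: field_simps) (smt (verit) mult_left_mono)
          moreover have "(C + 1) * norm h = C * norm h + norm h" by (simp add: distrib_right)
          ultimately have "C * norm h \<le> \<eta>" using norm_ge_zero[of h] by linarith
          from mult_right_mono[OF this, of "(norm h)\<^sup>2"] show ?thesis by (simp add: power3_eq_cube power2_eq_square mult_ac)
        qed
        ultimately show "w P + l h + 1/2 * B h h - \<eta> * (norm h)\<^sup>2 \<le> w (P + h)"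
          unfolding l_def B_def C_def by (simp add: algebra_simps)
      qed
    qed
    then have A: "gen b s (avg1 k R P) (avg2 k R P) \<le> c + Kb * gen b s (quart1 v) (quart2 v)"
      unfolding l_def B_def gen_diff gen_cmult by simp
    have "\<bar>walk D b s z P - z P - D * gen b s (avg1 k R P) (avg2 k R P)\<bar> \<le> (K / sqrt D) * (D * sqrt D)"
      using walk_generator[OF linear_avg1[OF R(1) k(2)] bilinear_avg2[OF R(1) k(2)] jets(2) jets(3) D, of P] D
      unfolding K_def z_def by simp
    then have "walk D b s z P - z P \<le> D * (gen b s (avg1 k R P) (avg2 k R P) + K)"
      using D by (simp add: algebra_simps)
    then have G: "(walk D b s z P - z P) / D \<le> gen b s (avg1 k R P) (avg2 k R P) + K"
      using D by (simp add: divide_le_eq mult.commute)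
    have zw: "z P - \<mu> * ((walk D b s z P - z P) / D) = avg k w P"
      unfolding z_def using avg_resolvent[OF R(1) eq D(1) k(2)] .
    have "avg k w P \<le> w P + e" 
    proof (rule avg_close[OF w(1) k])
      show "w (P + h) \<le> w P + e" if "norm h \<le> sqrt k" for h using ek(1)[OF that, of P] by linarith
    qed
    then have "z P \<le> w P + e + \<mu> * ((walk D b s z P - z P) / D)" using zw by linarith
    also have "\<dots> \<le> w P + e + \<mu> * (c + Kb * gen b s (quart1 v) (quart2 v) + K)"
      using G A mu by (intro add_left_mono mult_left_mono) auto
    also have "\<dots> \<le> w P + e + \<mu> * (c + Kb * (\<Gamma> * (v \<bullet> v)) + K)"
      using quart_gen_bound[OF v, of b s] mu Kb unfolding \<Gamma>_def
      by (intro add_left_mono mult_left_mono add_mono order.refl) auto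
    finally have "- (e + \<mu> * c + \<mu> * K) + Kb * ((v \<bullet> v)\<^sup>2 - \<mu> * \<Gamma> * (v \<bullet> v)) \<le> J P"
      unfolding J_def v_def[symmetric] by (simp add: algebra_simps)
    \<comment> \<open>Completing the square in \<open>v \<bullet> v\<close>: the whole cost of the
      barrier is of order \<open>\<mu>^2\<close>.\<close>
    moreover have "- (\<Gamma>\<^sup>2 * \<mu>\<^sup>2) \<le> (v \<bullet> v)\<^sup>2 - \<mu> * \<Gamma> * (v \<bullet> v)"
    proof -
      have "0 \<le> (v \<bullet> v - \<mu> * \<Gamma> / 2)\<^sup>2" by simp
      moreover have "(v \<bullet> v - \<mu> * \<Gamma> / 2)\<^sup>2 = (v \<bullet> v)\<^sup>2 - \<mu> * \<Gamma> * (v \<bullet> v) + (\<mu> * \<Gamma>)\<^sup>2 / 4"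
        by (simp add: power2_eq_square algebra_simps)
      moreover have "(\<mu> * \<Gamma>)\<^sup>2 / 4 \<le> \<Gamma>\<^sup>2 * \<mu>\<^sup>2" by (simp add: power_mult_distrib)
      ultimately show ?thesis by linarith
    qed
    from mult_left_mono[OF this Kb] have "- (Kb * \<Gamma>\<^sup>2 * \<mu>\<^sup>2) \<le> Kb * ((v \<bullet> v)\<^sup>2 - \<mu> * \<Gamma> * (v \<bullet> v))" by (simp add: mult.assoc)
    ultimately show ?thesis by linarith
  qed
  have "J P \<le> J P0" using P(2)[of P0] r by simp
  then have "z P0 \<le> w P0 + e + \<mu> * c + \<mu> * K + Kb * \<Gamma>\<^sup>2 * \<mu>\<^sup>2" using main unfolding J_def by simp
  moreover have "R P0 - e \<le> z P0" unfolding z_def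

  proof (rule avg_close'[OF R(1) k])
    show "R P0 - e \<le> R (P0 + h)" if "norm h \<le> sqrt k" for h using ek(2)[OF that, of P0] by linarith
  qed
  ultimately show ?thesis unfolding K_def Kb_def \<Gamma>_def by simp
qed


lemma ex_sqrt_le:
  fixes K t :: real
  assumes "0 \<le> K" "0 < t"
  shows "\<exists>D>0. D \<le> 1 \<and> K * sqrt D \<le> t"
proof (intro exI conjI)
  let ?u = "min 1 (t / (K + 1))"
  have u: "0 < ?u" "?u \<le> 1" "?u \<le> t / (K + 1)" using assms by auto
  show "0 < ?u\<^sup>2" "?u\<^sup>2 \<le> 1" using u by (auto simp: power_le_one)
  have "K * ?u \<le> (K + 1) * (t / (K + 1))" using u assms by (intro mult_mono) auto
  then show "K * sqrt (?u\<^sup>2) \<le> t" using u assms by simp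
qed

text \<open>By \<open>resolvent_below\<close>, \<open>R\<close> exceeds \<open>w\<close> near
  \<open>P0\<close> by at most \<open>\<mu>\<close> times nearly \<open>c\<close>. Averaged with
  \<open>kern d\<close>, and by the resolvent equation for the averages, this bounds the difference
  quotient of \<open>avg d R\<close>, hence its generator; after mollification \<open>R\<close> and
  \<open>w\<close> differ only by \<open>O(\<mu>)\<close>. The radius \<open>2 * r\<close> leaves
  \<open>sqrt d \<le> r\<close> for the averaging and \<open>r\<close> for the barrier.\<close>

theorem avg_super:
  fixes s :: "'d::finite \<Rightarrow> 'e::euclidean_space"
  assumes w: "continuous_on UNIV w" "\<And>z. \<bar>w z\<bar> \<le> N"
    and uc: "\<And>e. 0 < e \<Longrightarrow> \<exists>\<delta>>0. \<forall>z h. norm h \<le> \<delta> \<longrightarrow> \<bar>w (z + h) - w z\<bar> \<le> e"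
    and d: "0 < d" "d \<le> 1" "sqrt d \<le> r"
    and visc: "\<And>P. P \<in> ball P0 (2 * r) \<Longrightarrow> visc_super b s c w P"
  shows "gen b s (avg1 d w P0) (avg2 d w P0) \<le> c"
proof (rule field_le_epsilon)
  fix t :: real assume t0: "0 < t"
  \<comment> \<open>Six errors \<open>\<tau>\<close>: three in the resolvent estimate, one from the
    walk as an approximation of the generator, two from replacing \<open>R\<close> by
    \<open>w\<close>.\<close>
  define \<tau> where "\<tau> = t / 6"
  have \<tau>: "0 < \<tau>" using t0 by (simp add: \<tau>_def)
  define S where "S = step_size b s"
  define kb where "kb = (\<lambda>k. kbound TYPE('e) k * N * (S ^ 3 + S ^ 2))"
  define A where "A = kbound TYPE('e) d * N * (norm b + 1/2 * (\<Sum>i\<in>UNIV. (norm (s i))\<^sup>2))"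
  define K2 where "K2 = (2 * N + \<bar>c\<bar>) / r ^ 4 * (4 * r * norm b + 6 * (\<Sum>i\<in>UNIV. (norm (s i))\<^sup>2))\<^sup>2"
  have r: "0 < r" using d by (meson less_le_trans real_sqrt_gt_zero)
  have N: "0 \<le> N" using w(2)[of 0] by linarith
  have S: "0 \<le> S" unfolding S_def step_size_def by (auto intro!: add_nonneg_nonneg sum_nonneg mult_nonneg_nonneg)
  have kb: "0 \<le> kb k" if "0 < k" "k \<le> 1" for k
    unfolding kb_def kbound_def using kmass_pos[where 'e='e, OF that] N S by auto
  have A: "0 \<le> A" unfolding A_def kbound_def using kmass_pos[where 'e='e, OF d(1,2)] N
    by (intro mult_nonneg_nonneg add_nonneg_nonneg sum_nonneg divide_nonneg_pos) auto
  have K2: "0 \<le> K2" unfolding K2_def using N r by auto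
  have kd: "0 \<le> kb d" using kb d by auto
  \<comment> \<open>Order of the choices: the auxiliary step \<open>D'\<close>, then
    \<open>\<mu>\<close>, then the small mollification parameter \<open>k\<close>, then the walk
    step \<open>D\<close>. Each depends on the earlier ones, since the constant \<open>kb k\<close>
    may blow up as \<open>k\<close> shrinks.\<close>
  obtain D' where D': "0 < D'" "D' \<le> 1" "(2 * kb d + S) * sqrt D' \<le> min \<tau> 1"
  proof -
    have "0 \<le> 2 * kb d + S" "0 < min \<tau> 1" using kd S \<tau> by auto
    from ex_sqrt_le[OF this] show ?thesis using that by blast
  qed
  have D'1: "2 * kb d * sqrt D' \<le> \<tau>" "S * sqrt D' \<le> 1"
  proof -
    have "0 \<le> 2 * kb d * sqrt D'" "0 \<le> S * sqrt D'" using D' kd S by auto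
    moreover have "2 * kb d * sqrt D' + S * sqrt D' \<le> min \<tau> 1" using D'(3) by (simp only: distrib_right)
    ultimately show "2 * kb d * sqrt D' \<le> \<tau>" "S * sqrt D' \<le> 1" by linarith+
  qed
  obtain m where m: "0 < m" "m \<le> 1" "(K2 + 2 * (A + kb d) / D') * sqrt m \<le> \<tau>"
  proof -
    have "0 \<le> K2 + 2 * (A + kb d) / D'" using K2 A kd D' by auto
    from ex_sqrt_le[OF this \<tau>] show ?thesis using that by blast
  qed
  define \<mu> where "\<mu> = sqrt m"
  have mu: "0 < \<mu>" "\<mu> \<le> 1" using m by (auto simp: \<mu>_def)
  have mu1: "K2 * \<mu> \<le> \<tau>" "2 * (A + kb d) / D' * \<mu> \<le> \<tau>"
  proof -
    have "0 \<le> K2 * \<mu>" "0 \<le> 2 * (A + kb d) / D' * \<mu>" using K2 A kd D' mu by auto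
    moreover have "K2 * \<mu> + 2 * (A + kb d) / D' * \<mu> \<le> \<tau>" using m(3) unfolding \<mu>_def[symmetric] by (simp add: distrib_right)
    ultimately show "K2 * \<mu> \<le> \<tau>" "2 * (A + kb d) / D' * \<mu> \<le> \<tau>" by linarith+
  qed
  \<comment> \<open>After division by \<open>\<mu>\<close>, the term \<open>2 * e\<close> of
    \<open>resolvent_below\<close> costs exactly one \<open>\<tau>\<close>.\<close>
  define e where "e = \<tau> * \<mu> / 2"
  have e: "0 < e" using \<tau> mu by (simp add: e_def)
  obtain \<delta> where \<delta>: "0 < \<delta>" "\<And>z h. norm h \<le> \<delta> \<Longrightarrow> \<bar>w (z + h) - w z\<bar> \<le> e" using uc[OF e] by blast
  define k where "k = (min 1 \<delta>)\<^sup>2"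
  have k: "0 < k" "k \<le> 1" "sqrt k \<le> \<delta>" using \<delta> by (auto simp: k_def power_le_one)
  obtain D where D: "0 < D" "D \<le> 1" "(kb k + kb d + S) * sqrt D \<le> min \<tau> 1"
  proof -
    have "0 \<le> kb k + kb d + S" "0 < min \<tau> 1" using kd kb[OF k(1,2)] S \<tau> by auto
    from ex_sqrt_le[OF this] show ?thesis using that by blast
  qed
  have D1: "kb k * sqrt D \<le> \<tau>" "kb d * sqrt D \<le> \<tau>" "S * sqrt D \<le> 1" "kb d * sqrt D \<le> kb d"
  proof -
    have "0 \<le> kb k * sqrt D" "0 \<le> kb d * sqrt D" "0 \<le> S * sqrt D" using kb k kd S D by auto
    moreover have "kb k * sqrt D + kb d * sqrt D + S * sqrt D \<le> min \<tau> 1" using D(3) by (simp add: distrib_right)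
    ultimately show "kb k * sqrt D \<le> \<tau>" "kb d * sqrt D \<le> \<tau>" "S * sqrt D \<le> 1" by linarith+
    show "kb d * sqrt D \<le> kb d" using D kd by (simp add: mult_left_le)
  qed
  obtain R where R: "continuous_on UNIV R" "\<And>z. \<bar>R z\<bar> \<le> N"
    and Req: "\<And>z. R z = (1 - \<mu> / (\<mu> + D)) * w z + \<mu> / (\<mu> + D) * walk D b s R z"
    and Rmod: "\<And>h e z. (\<And>z. \<bar>w (z + h) - w z\<bar> \<le> e) \<Longrightarrow> \<bar>R (z + h) - R z\<bar> \<le> e"
  proof -
    have "0 \<le> \<mu> / (\<mu> + D)" "\<mu> / (\<mu> + D) < 1" using mu D by (auto simp: divide_less_eq)
    from walk_resolvent[OF this w, of D b s] show ?thesis using that by metis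
  qed
  have eq: "R z - \<mu> * ((walk D b s R z - R z) / D) = w z" for z
  proof -
    have "(\<mu> + D) * R z = D * w z + \<mu> * walk D b s R z"
    proof -
      have "1 - \<mu> / (\<mu> + D) = D / (\<mu> + D)" using mu D by (simp add: field_simps)
      with Req[of z] have "R z = (D * w z + \<mu> * walk D b s R z) / (\<mu> + D)" by (simp add: add_divide_distrib)
      then show ?thesis using mu D by simp
    qed
    then show ?thesis using D by (simp add: field_simps)
  qed
  define Z where "Z = avg d R"
  define V where "V = avg d w"
  have ZV: "Z P - V P = \<mu> * ((walk D b s Z P - Z P) / D)" for P
    using avg_resolvent[OF R(1) eq D(1) d(2), of P] unfolding Z_def V_def by linarith
  have below: "R (P0 + y) - w (P0 + y) \<le> 2 * e + \<mu> * c + \<mu> * \<tau> + K2 * \<mu>\<^sup>2" if "norm y \<le> sqrt d" for y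
  proof -
    have "ball (P0 + y) r \<subseteq> ball P0 (2 * r)"
    proof
      fix P assume "P \<in> ball (P0 + y) r"
      then have "norm (P - (P0 + y)) < r" by (simp add: dist_norm norm_minus_commute)
      moreover have "norm y \<le> r" using that d by linarith
      ultimately have "norm (P - (P0 + y) + y) < 2 * r" by (intro le_less_trans[OF norm_triangle_ineq]) auto
      then show "P \<in> ball P0 (2 * r)" by (simp add: dist_norm norm_minus_commute algebra_simps)
    qed
    then have v: "visc_super b s c w P" if "P \<in> ball (P0 + y) r" for P using visc that by auto
    have "\<bar>w (z + h) - w z\<bar> \<le> e" if "norm h \<le> sqrt k" for z h using \<delta>(2) that k by auto
    moreover from this have "\<bar>R (z + h) - R z\<bar> \<le> e" if "norm h \<le> sqrt k" for z h using Rmod that by blast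
    ultimately have "R (P0 + y) \<le> w (P0 + y) + 2 * e + \<mu> * c + \<mu> * (kb k * sqrt D) + K2 * \<mu>\<^sup>2"
      using resolvent_below[OF w R eq mu D(1,2) _ k(1,2) _ _ r v, of e] D1
      unfolding S_def kb_def K2_def by auto
    moreover have "\<mu> * (kb k * sqrt D) \<le> \<mu> * \<tau>" using D1 mu by (intro mult_left_mono) auto
    ultimately show ?thesis by linarith
  qed
  have cont: "continuous_on UNIV (\<lambda>y. R y - w y)" by (intro continuous_intros R w)
  have "Z P0 - V P0 \<le> 2 * e + \<mu> * c + \<mu> * \<tau> + K2 * \<mu>\<^sup>2"
    unfolding Z_def V_def avg_diff(1)[OF R(1) w(1) d(2), symmetric]
    by (rule avg_close[OF cont d(1,2)]) (rule below)
  also have "\<dots> = \<mu> * (c + 2 * \<tau> + K2 * \<mu>)" by (simp add: e_def algebra_simps power2_eq_square)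
  also have "\<dots> \<le> \<mu> * (c + 3 * \<tau>)" using mu mu1 by (intro mult_left_mono) auto
  \<comment> \<open>For the averages, \<open>Z - V\<close> is exactly \<open>\<mu>\<close> times the
    difference quotient, so \<open>\<mu>\<close> cancels.\<close>
  finally have G: "(walk D b s Z P0 - Z P0) / D \<le> c + 3 * \<tau>" unfolding ZV using mu by (simp only: mult_le_cancel_left_pos)
  have wg: "\<bar>walk D b s Z P - Z P - D * gen b s (avg1 d R P) (avg2 d R P)\<bar> \<le> kb d * (D * sqrt D)" for P
    using walk_generator[OF linear_avg1[OF R(1) d(2)] bilinear_avg2[OF R(1) d(2)]
        avg_jet_bounds(2)[OF R d(1,2)] avg_jet_bounds(3)[OF R d(1,2)] D(1,2), where z=P and b=b and s=s] D1(3)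
    unfolding kb_def Z_def S_def by simp
  have gR: "\<bar>(walk D b s Z P - Z P) / D - gen b s (avg1 d R P) (avg2 d R P)\<bar> \<le> kb d * sqrt D" for P
  proof -
    have "(walk D b s Z P - Z P) / D - gen b s (avg1 d R P) (avg2 d R P) = (walk D b s Z P - Z P - D * gen b s (avg1 d R P) (avg2 d R P)) / D"
      using D by (simp add: field_simps)
    then show ?thesis using wg[of P] D by (simp add: abs_divide divide_le_eq mult_ac)
  qed
  have gA: "\<bar>gen b s (avg1 d R P) (avg2 d R P)\<bar> \<le> A" for P
  proof -
    have "\<bar>\<Sum>i\<in>UNIV. avg2 d R P (s i) (s i)\<bar> \<le> (\<Sum>i\<in>UNIV. kbound TYPE('e) d * N * (norm (s i))\<^sup>2)"
      by (intro order.trans[OF sum_abs] sum_mono) (use avg_jet_bounds(2)[OF R d(1,2)] in \<open>auto simp: power2_eq_square\<close>)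
    then show ?thesis using avg_jet_bounds(1)[OF R d(1,2), of P b]
      unfolding gen_def A_def by (simp add: sum_distrib_left[symmetric] distrib_left)
  qed
  define F where "F y = R y - w y" for y
  have F: "continuous_on UNIV F" "\<And>y. \<bar>F y\<bar> \<le> 2 * N" 
  proof -
    show "continuous_on UNIV F" unfolding F_def by (rule cont)
    show "\<bar>F y\<bar> \<le> 2 * N" for y unfolding F_def using R(2)[of y] w(2)[of y] by linarith
  qed
  have FZ: "avg d F P = Z P - V P" for P unfolding F_def Z_def V_def by (rule avg_diff(1)[OF R(1) w(1) d(2)])
  have Fb: "\<bar>avg d F P\<bar> \<le> \<mu> * (A + kb d)" for P
  proof -
    have "\<bar>(walk D b s Z P - Z P) / D\<bar> \<le> A + kb d" using gR[of P] gA[of P] D1(4) by linarith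
    from mult_left_mono[OF this, of \<mu>] show ?thesis unfolding FZ ZV abs_mult using mu by simp
  qed
  \<comment> \<open>Interpolation: \<open>avg d F\<close> is of size \<open>\<mu>\<close>, while its
    Taylor remainder is bounded independently of \<open>\<mu>\<close>. A difference quotient with
    the fixed step \<open>D'\<close> therefore makes its generator small.\<close>
  have "\<bar>walk D' b s (avg d F) P0 - avg d F P0 - D' * gen b s (avg1 d F P0) (avg2 d F P0)\<bar> \<le> (2 * kb d) * (D' * sqrt D')"
    using walk_generator[OF linear_avg1[OF F(1) d(2)] bilinear_avg2[OF F(1) d(2)]
        avg_jet_bounds(2)[OF F d(1,2)] avg_jet_bounds(3)[OF F d(1,2)] D'(1,2), where z=P0 and b=b and s=s] D'1(2)
    unfolding kb_def S_def by (simp add: mult_ac)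
  moreover have "\<bar>walk D' b s (avg d F) P0\<bar> \<le> \<mu> * (A + kb d)" by (rule walk_abs_le[OF Fb])
  ultimately have "\<bar>D' * gen b s (avg1 d F P0) (avg2 d F P0)\<bar> \<le> (2 * kb d * sqrt D') * D' + 2 * (\<mu> * (A + kb d))"
  proof -
    have "(2 * kb d) * (D' * sqrt D') = (2 * kb d * sqrt D') * D'" by simp
    moreover assume "\<bar>walk D' b s (avg d F) P0 - avg d F P0 - D' * gen b s (avg1 d F P0) (avg2 d F P0)\<bar> \<le> (2 * kb d) * (D' * sqrt D')"
      "\<bar>walk D' b s (avg d F) P0\<bar> \<le> \<mu> * (A + kb d)"
    ultimately show ?thesis using Fb[of P0] by linarith
  qed
  also have "\<dots> = D' * (2 * kb d * sqrt D' + 2 * (A + kb d) / D' * \<mu>)" using D' by (simp add: field_simps)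
  also have "\<dots> \<le> D' * (2 * \<tau>)" using D' D'1 mu1 by (intro mult_left_mono) auto
  finally have gF: "\<bar>gen b s (avg1 d F P0) (avg2 d F P0)\<bar> \<le> 2 * \<tau>" using D' by (simp add: abs_mult)
  have "gen b s (avg1 d F P0) (avg2 d F P0) = gen b s (avg1 d R P0) (avg2 d R P0) - gen b s (avg1 d w P0) (avg2 d w P0)"
    unfolding F_def gen_diff[symmetric] by (simp add: avg_diff[OF R(1) w(1) d(2)] gen_def)
  then have "gen b s (avg1 d w P0) (avg2 d w P0) \<le> c + 6 * \<tau>"
    using gF gR[of P0] G D1(2) by linarith
  then show "gen b s (avg1 d w P0) (avg2 d w P0) \<le> c + t" by (simp add: \<tau>_def)
qed

section \<open>Parabolic jets of infimal convolutions\<close>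

lemma eventually_at_shift:
  fixes a :: "'a::real_normed_vector"
  assumes "\<forall>\<^sub>F z in nhds 0. P z"
  shows "\<forall>\<^sub>F z in at a. P (z - a)"
proof -
  have "((\<lambda>z. z - a) \<longlongrightarrow> a - a) (at a)" by (intro tendsto_intros)
  then have "filterlim (\<lambda>z. z - a) (nhds 0) (at a)" by simp
  with assms show ?thesis by (rule eventually_compose_filterlim)
qed

text \<open>The remainder demanded by the definition can be taken to be the positive part of the
  defect.\<close>

lemma parabolic_superjetI:
  assumes X: "transpose X = X"
    and ev: "\<And>\<eta>. 0 < \<eta> \<Longrightarrow> \<forall>\<^sub>F (s, k) in nhds 0.
      u (t + s) (x + k) \<le> u t x + p * s + q \<bullet> k + 1/2 * ((X *v k) \<bullet> k) + \<eta> * (\<bar>s\<bar> + (norm k)\<^sup>2)"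
  shows "(p, q, X) \<in> parabolic_superjet u t x"
proof -
  define r where "r = (\<lambda>(s, y). max 0 (u s y - (u t x + p * (s - t) + q \<bullet> (y - x) + 1/2 * ((X *v (y - x)) \<bullet> (y - x)))))"
  have "r \<in> o[at (t, x)](\<lambda>(s, y). \<bar>s - t\<bar> + (norm (y - x))\<^sup>2)"
  proof (rule landau_o.smallI)
    fix c :: real assume "0 < c"
    from eventually_at_shift[OF ev[OF this], of "(t, x)"]
    show "\<forall>\<^sub>F z in at (t, x). norm (r z) \<le> c * norm (case z of (s, y) \<Rightarrow> \<bar>s - t\<bar> + (norm (y - x))\<^sup>2)"
      by eventually_elim (use \<open>0 < c\<close> in \<open>auto simp: r_def abs_of_nonneg\<close>)
  qed
  moreover have "\<forall>\<^sub>F (s, y) in at (t, x).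
      u s y \<le> u t x + p * (s - t) + q \<bullet> (y - x) + 1/2 * ((X *v (y - x)) \<bullet> (y - x)) + r (s, y)"
    by (rule always_eventually) (auto simp: r_def)
  ultimately show ?thesis unfolding parabolic_superjet_def using X by auto
qed

lemma parabolic_subjetI:
  assumes X: "transpose X = X"
    and ev: "\<And>\<eta>. 0 < \<eta> \<Longrightarrow> \<forall>\<^sub>F (s, k) in nhds 0.
      u (t + s) (x + k) \<ge> u t x + p * s + q \<bullet> k + 1/2 * ((X *v k) \<bullet> k) - \<eta> * (\<bar>s\<bar> + (norm k)\<^sup>2)"
  shows "(p, q, X) \<in> parabolic_subjet u t x"
proof -
  define r where "r = (\<lambda>(s, y). min 0 (u s y - (u t x + p * (s - t) + q \<bullet> (y - x) + 1/2 * ((X *v (y - x)) \<bullet> (y - x)))))"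
  have "r \<in> o[at (t, x)](\<lambda>(s, y). \<bar>s - t\<bar> + (norm (y - x))\<^sup>2)"
  proof (rule landau_o.smallI)
    fix c :: real assume "0 < c"
    from eventually_at_shift[OF ev[OF this], of "(t, x)"]
    show "\<forall>\<^sub>F z in at (t, x). norm (r z) \<le> c * norm (case z of (s, y) \<Rightarrow> \<bar>s - t\<bar> + (norm (y - x))\<^sup>2)"
      by eventually_elim (use \<open>0 < c\<close> in \<open>auto simp: r_def abs_of_nonneg min_def\<close>)
  qed
  moreover have "\<forall>\<^sub>F (s, y) in at (t, x).
      u s y \<ge> u t x + p * (s - t) + q \<bullet> (y - x) + 1/2 * ((X *v (y - x)) \<bullet> (y - x)) + r (s, y)"
    by (rule always_eventually) (auto simp: r_def)
  ultimately show ?thesis unfolding parabolic_subjet_def using X by auto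
qed

text \<open>Along \<open>\<tau> *\<^sub>R k\<close> the orders in \<open>\<tau>\<close> separate: at
  first order the sign change of \<open>k\<close> forces the linear part to vanish, and second order
  then gives the sign of \<open>Q\<close>.\<close>

lemma jet_nonpos:
  fixes a :: "'a::euclidean_space \<Rightarrow> real"
  assumes a: "linear a" and Q: "bilinear Q"
    and ev: "\<And>\<eta>. 0 < \<eta> \<Longrightarrow> \<forall>\<^sub>F k in nhds 0. a k + 1/2 * Q k k \<le> \<eta> * (norm k)\<^sup>2"
  shows "a k = 0" "Q k k \<le> 0"
proof -
  have *: "\<exists>\<delta>>0. \<forall>\<tau>. 0 < \<tau> \<and> \<tau> < \<delta> \<longrightarrow> a k + 1/2 * \<tau> * Q k k \<le> \<eta> * \<tau> * (norm k)\<^sup>2" if "0 < \<eta>" for \<eta> k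
  proof -
    from ev[OF that] obtain e where e: "0 < e" "\<And>k. norm k < e \<Longrightarrow> a k + 1/2 * Q k k \<le> \<eta> * (norm k)\<^sup>2"
      unfolding eventually_nhds_metric by auto
    show ?thesis
    proof (intro exI conjI allI impI)
      show "0 < e / (norm k + 1)" using e by (simp add: add_nonneg_pos)
      fix \<tau> assume \<tau>: "0 < \<tau> \<and> \<tau> < e / (norm k + 1)"
      then have "\<tau> * (norm k + 1) < e" by (simp add: less_divide_eq add_nonneg_pos)
      then have "norm (\<tau> *\<^sub>R k) < e" using \<tau> by (simp add: distrib_left)
      from e(2)[OF this] have "\<tau> * a k + 1/2 * (\<tau> * (\<tau> * Q k k)) \<le> \<eta> * (\<tau> * norm k)\<^sup>2"
        using \<tau> by (simp add: linear_scale[OF a] bilinear_lmul[OF Q] bilinear_rmul[OF Q])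
      then have "\<tau> * (a k + 1/2 * \<tau> * Q k k) \<le> \<tau> * (\<eta> * \<tau> * (norm k)\<^sup>2)"
        by (simp add: power_mult_distrib power2_eq_square algebra_simps)
      then show "a k + 1/2 * \<tau> * Q k k \<le> \<eta> * \<tau> * (norm k)\<^sup>2" using \<tau> by (simp only: mult_le_cancel_left_pos)
    qed
  qed
  have le: "a k \<le> 0" for k
  proof (rule ccontr)
    assume "\<not> a k \<le> 0"
    then have pos: "0 < a k" by simp
    from *[of 1 k] obtain \<delta> where \<delta>: "0 < \<delta>" "\<And>\<tau>. 0 < \<tau> \<Longrightarrow> \<tau> < \<delta> \<Longrightarrow> a k + 1/2 * \<tau> * Q k k \<le> 1 * \<tau> * (norm k)\<^sup>2"
      by auto
    define M where "M = \<bar>Q k k\<bar> + (norm k)\<^sup>2 + 1"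
    have M: "0 < M" unfolding M_def by (smt (verit) zero_le_power2)
    define \<tau> where "\<tau> = min (\<delta> / 2) (a k / (2 * M))"
    have \<tau>: "0 < \<tau>" "\<tau> < \<delta>" "\<tau> \<le> a k / (2 * M)" using \<delta>(1) pos M by (auto simp: \<tau>_def)
    have "\<tau> * M \<le> a k / 2" using \<tau>(3) M by (simp add: field_simps)
    moreover have "a k \<le> \<tau> * ((norm k)\<^sup>2 - 1/2 * Q k k)" using \<delta>(2)[OF \<tau>(1,2)] by (simp add: algebra_simps)
    moreover have "\<tau> * ((norm k)\<^sup>2 - 1/2 * Q k k) \<le> \<tau> * M" using \<tau>(1) unfolding M_def by (intro mult_left_mono) auto
    ultimately show False using pos by linarith
  qed
  show 0: "a k = 0" for k using le[of k] le[of "- k"] linear_neg[OF a, of k] by simp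
  show "Q k k \<le> 0"
  proof (rule field_le_epsilon)
    fix e :: real assume e: "0 < e"
    define n where "n = (norm k)\<^sup>2 + 1"
    have n: "0 < n" by (simp add: n_def add_nonneg_pos)
    define \<eta> where "\<eta> = e / (2 * n)"
    have \<eta>: "0 < \<eta>" using e n by (simp add: \<eta>_def)
    from *[OF this, of k] obtain \<delta> where \<delta>: "0 < \<delta>" "\<And>\<tau>. 0 < \<tau> \<Longrightarrow> \<tau> < \<delta> \<Longrightarrow> a k + 1/2 * \<tau> * Q k k \<le> \<eta> * \<tau> * (norm k)\<^sup>2" by auto
    have "\<delta> / 2 * (1/2 * Q k k) \<le> \<delta> / 2 * (\<eta> * (norm k)\<^sup>2)" using \<delta>(2)[of "\<delta> / 2"] \<delta>(1) 0[of k] by (simp add: mult_ac)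
    then have "1/2 * Q k k \<le> \<eta> * (norm k)\<^sup>2" using \<delta>(1) by (simp only: mult_le_cancel_left_pos half_gt_zero)
    also have "\<dots> \<le> \<eta> * n" using \<eta> by (simp add: n_def)
    also have "\<dots> = e / 2" unfolding \<eta>_def using n by simp
    finally show "Q k k \<le> 0 + e" by simp
  qed
qed

lemma inner_transpose_mult: "(transpose A *v x) \<bullet> y = x \<bullet> (A *v (y::real^'n))"
  by (metis dot_lmul_matrix transpose_transpose vector_transpose_matrix inner_commute)

definition jet_grad :: "(real \<times> (real^'n) \<Rightarrow> real) \<Rightarrow> real^'n" where
  "jet_grad l = (\<chi> i. l (0, axis i 1))"

definition jet_hess :: "(real \<times> (real^'n) \<Rightarrow> real \<times> (real^'n) \<Rightarrow> real) \<Rightarrow> real^'n^'n" where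
  "jet_hess B = (\<chi> i j. B (0, axis i 1) (0, axis j 1))"

lemma jet_grad:
  assumes "linear l"
  shows "l (s, k) = l (1, 0) * s + jet_grad l \<bullet> k"
proof -
  have "l (s, k) = l (s *\<^sub>R (1, 0) + (\<Sum>i\<in>UNIV. k $ i *\<^sub>R (0, axis i 1)))"
    by (simp add: sum_prod basis_expansion[of k, unfolded scalar_mult_eq_scaleR])
  also have "\<dots> = l (1, 0) * s + jet_grad l \<bullet> k"
    unfolding linear_add[OF assms] linear_sum[OF assms] linear_scale[OF assms]
    by (simp add: jet_grad_def inner_vec_def mult_ac)
  finally show ?thesis .
qed

lemma jet_hess:
  assumes B: "bilinear B"
  shows "(jet_hess B *v k') \<bullet> k = B (0, k) (0, k')"
proof -
  have e: "(0, k) = (\<Sum>i\<in>UNIV. k $ i *\<^sub>R (0::real, axis i 1))" for k :: "real^'a"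
    by (simp add: sum_prod basis_expansion[of k, unfolded scalar_mult_eq_scaleR])
  have l1: "linear (\<lambda>x. B x y)" and l2: "linear (B y)" for y using B unfolding bilinear_def by blast+
  have 1: "B (0, k) h = (\<Sum>i\<in>UNIV. k $ i * B (0, axis i 1) h)" for h
    unfolding e[of k] linear_sum[OF l1] linear_scale[OF l1] by simp
  have 2: "B h (0, k') = (\<Sum>j\<in>UNIV. k' $ j * B h (0, axis j 1))" for h
    unfolding e[of k'] linear_sum[OF l2] linear_scale[OF l2] by simp
  have "B (0, k) (0, k') = (\<Sum>i\<in>UNIV. \<Sum>j\<in>UNIV. k $ i * (k' $ j * B (0, axis i 1) (0, axis j 1)))"
    unfolding 1[of "(0, k')"] unfolding 2 by (simp add: sum_distrib_left)
  also have "\<dots> = (jet_hess B *v k') \<bullet> k"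
    unfolding inner_vec_def matrix_vector_mult_def jet_hess_def
    by (simp add: sum_distrib_left sum_distrib_right mult_ac)
  finally show ?thesis by simp
qed

lemma transpose_jet_hess: "(\<And>h k. B h k = B k h) \<Longrightarrow> transpose (jet_hess B) = jet_hess B"
  by (simp add: transpose_def jet_hess_def vec_eq_iff)

text \<open>Both products contain \<open>\<bar>s\<bar>\<close> times a vanishing factor: the entries
  of a space-time Hessian that involve time are invisible in a parabolic jet.\<close>

lemma parabolic_quadratic_error:
  fixes c \<eta> :: real
  assumes "0 \<le> c" "0 < \<eta>"
  shows "\<exists>\<delta>>0. \<forall>s k. \<bar>s\<bar> < \<delta> \<longrightarrow> 0 \<le> k \<longrightarrow> k < \<delta> \<longrightarrow> c * (s\<^sup>2 + \<bar>s\<bar> * k) \<le> \<eta> * \<bar>s\<bar>"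
proof (intro exI conjI allI impI)
  show "0 < \<eta> / (2 * c + 1)" using assms by auto
  fix s k :: real assume *: "\<bar>s\<bar> < \<eta> / (2 * c + 1)" "0 \<le> k" "k < \<eta> / (2 * c + 1)"
  have "c * (\<bar>s\<bar> + k) \<le> c * (2 * (\<eta> / (2 * c + 1)))" using * assms by (intro mult_left_mono) auto
  also have "\<dots> \<le> \<eta>" using assms by (simp add: field_simps)
  finally have "c * (\<bar>s\<bar> + k) * \<bar>s\<bar> \<le> \<eta> * \<bar>s\<bar>" by (rule mult_right_mono) auto
  then show "c * (s\<^sup>2 + \<bar>s\<bar> * k) \<le> \<eta> * \<bar>s\<bar>" by (simp add: power2_eq_square algebra_simps)
qed

lemma norm_add_sq: "(norm (a + b))\<^sup>2 = (norm a)\<^sup>2 + 2 * (a \<bullet> b) + (norm b)\<^sup>2"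
  for a b :: "'a::real_inner"
  by (simp add: power2_norm_eq_inner inner_add_left inner_add_right inner_commute)

text \<open>
  With \<open>X\<close> the spatial Hessian of the jet lowered by \<open>\<kappa>\<close>, the matrix \<open>N\<close> in the proof is the inverse of
  \<open>mat 1 - \<epsilon> *\<^sub>R X\<close>: moving \<open>x\<close> by \<open>N *v k\<close> when \<open>y\<close> moves by \<open>k\<close> maximises the quadratic form
  \<open>(X *v \<xi>) \<bullet> \<xi> - (norm (\<xi> - k))\<^sup>2 / \<epsilon>\<close> over \<open>\<xi>\<close>.
\<close>

lemma infconv_jet:
  fixes v :: "real \<Rightarrow> real^'n \<Rightarrow> real" and w :: "real \<times> (real^'n) \<Rightarrow> real"
  assumes \<epsilon>: "0 < \<epsilon>" and \<kappa>: "0 < \<kappa>"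
    and w0: "w (t, x) = v t y + (norm (x - y))\<^sup>2 / (2 * \<epsilon>) + \<gamma> * (norm (y - y1))\<^sup>2"
    and w1: "\<forall>\<^sub>F (h, k') in nhds 0.
      w ((t, x) + h) \<le> v (t + fst h) (y + k') + (norm (x + snd h - (y + k')))\<^sup>2 / (2 * \<epsilon>) + \<gamma> * (norm (y + k' - y1))\<^sup>2"
    and l: "linear l" and B: "bilinear B" "\<And>h k. B h k = B k h"
    and jet: "\<And>\<eta>. 0 < \<eta> \<Longrightarrow> \<forall>\<^sub>F h in nhds 0. w (t, x) + l h + 1/2 * B h h - \<eta> * (norm h)\<^sup>2 \<le> w ((t, x) + h)"
  shows "jet_grad l = (1 / \<epsilon>) *\<^sub>R (x - y)"
    "\<exists>Y. (l (1, 0), jet_grad l - (2 * \<gamma>) *\<^sub>R (y - y1), Y) \<in> parabolic_subjet v t y \<and>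
      (\<forall>\<xi> \<zeta>. B (0, \<xi>) (0, \<xi>) - \<kappa> * (norm \<xi>)\<^sup>2 \<le> (norm (\<xi> - \<zeta>))\<^sup>2 / \<epsilon> + (Y *v \<zeta>) \<bullet> \<zeta> + 2 * \<gamma> * (norm \<zeta>)\<^sup>2)"
proof -
  let ?E = "\<lambda>k::real^'n. (0::real, k)"
  have lE: "linear ?E" by (rule linearI) auto
  define a where "a k = l (?E k) - (1 / \<epsilon>) * ((x - y) \<bullet> k)" for k
  define Q where "Q k k' = B (?E k) (?E k') - (1 / \<epsilon>) * (k \<bullet> k')" for k k'
  have la: "linear a" unfolding a_def
    by (intro linear_compose_sub linear_compose[OF lE l, unfolded o_def]
        linear_compose_scale_right[where 'b=real, unfolded real_scaleR_def])
       (auto intro!: linearI simp: inner_simps right_diff_distrib)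
  have l1: "linear (\<lambda>x. B x y)" and l2: "linear (B y)" for y using B unfolding bilinear_def by blast+
  have lQ: "bilinear Q" unfolding Q_def bilinear_def
    by (intro conjI allI linear_compose_sub linear_compose[OF lE l1, unfolded o_def] linear_compose[OF lE l2, unfolded o_def]
        linear_compose_scale_right[where 'b=real, unfolded real_scaleR_def])
       (auto intro!: linearI simp: inner_simps)
  \<comment> \<open>First variation: \<open>y\<close> stays fixed and only \<open>x\<close> moves,
    so \<open>w\<close> is touched from above by a paraboloid in \<open>x\<close>.\<close>
  have ev: "\<forall>\<^sub>F k in nhds 0. a k + 1/2 * Q k k \<le> \<eta> * (norm k)\<^sup>2" if \<eta>: "0 < \<eta>" for \<eta>
  proof -
    have "filterlim (\<lambda>k. (?E k, 0::real^'n)) (nhds 0) (nhds 0)"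
      using tendsto_Pair[OF tendsto_Pair[OF tendsto_const filterlim_ident] tendsto_const, of "0::real" "0::real^'n" "0::real^'n"]
      by (simp add: zero_prod_def)
    from eventually_compose_filterlim[OF w1 this]
    have 1: "\<forall>\<^sub>F k in nhds 0. w ((t, x) + ?E k) \<le> v t y + (norm (x + k - y))\<^sup>2 / (2 * \<epsilon>) + \<gamma> * (norm (y - y1))\<^sup>2"
      by (simp add: case_prod_unfold)
    have "filterlim ?E (nhds 0) (nhds 0)"
      using tendsto_Pair[OF tendsto_const filterlim_ident, of "0::real" "0::real^'n"] by (simp add: zero_prod_def)
    from eventually_compose_filterlim[OF jet[OF \<eta>] this] 1
    show ?thesis
    proof eventually_elim
      case (elim k)
      have "(norm (x + k - y))\<^sup>2 = (norm (x - y))\<^sup>2 + 2 * ((x - y) \<bullet> k) + (norm k)\<^sup>2"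
        using norm_add_sq[of "(x - y)" "k"] by (simp add: algebra_simps)
      then have "(norm (x + k - y))\<^sup>2 / (2 * \<epsilon>) = (norm (x - y))\<^sup>2 / (2 * \<epsilon>) + (1 / \<epsilon>) * ((x - y) \<bullet> k) + 1/2 * ((1 / \<epsilon>) * (k \<bullet> k))"
        using \<epsilon> by (simp add: field_simps dot_square_norm)
      then show ?case using elim w0 unfolding a_def Q_def by (simp add: algebra_simps)
    qed
  qed
  have q: "l (?E k) = (1 / \<epsilon>) * ((x - y) \<bullet> k)" and BX: "B (?E k) (?E k) \<le> (norm k)\<^sup>2 / \<epsilon>" for k
    using jet_nonpos[OF la lQ ev, of k] by (simp_all add: a_def Q_def dot_square_norm)
  show grad: "jet_grad l = (1 / \<epsilon>) *\<^sub>R (x - y)"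
  proof (rule vector_eq_rdot[THEN iffD1], rule allI)
    fix k
    show "jet_grad l \<bullet> k = (1 / \<epsilon>) *\<^sub>R (x - y) \<bullet> k" using jet_grad[OF l, of 0 k] q[of k] by simp
  qed
  \<comment> \<open>Lowering by \<open>\<kappa>\<close> makes \<open>X < 1 / \<epsilon>\<close>
    strict, so that \<open>mat 1 - \<epsilon> *\<^sub>R X\<close> is invertible even where the bound
    \<open>BX\<close> is attained.\<close>
  define X where "X = jet_hess B - \<kappa> *\<^sub>R mat 1"
  have Xk: "X *v k = jet_hess B *v k - \<kappa> *\<^sub>R k" for k
    unfolding X_def by (simp add: matrix_vector_mult_diff_rdistrib scaleR_matrix_vector_assoc[symmetric])
  have Xq: "(X *v k) \<bullet> k = B (?E k) (?E k) - \<kappa> * (norm k)\<^sup>2" for k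
    unfolding Xk by (simp add: inner_diff_left jet_hess[OF B(1)] dot_square_norm)
  have Xle: "(X *v k) \<bullet> k \<le> (norm k)\<^sup>2 / \<epsilon>" for k unfolding Xq using BX[of k] \<kappa> by (smt (verit) mult_nonneg_nonneg zero_le_power2)
  have Xt: "transpose X = X" unfolding X_def
    using transpose_jet_hess[of B, OF B(2)] by (simp add: transpose_def vec_eq_iff mat_def)
  have Xs: "(X *v k) \<bullet> k' = (X *v k') \<bullet> k" for k k'
    using inner_transpose_mult[of X k k'] unfolding Xt by (simp add: inner_commute)
  define S where "S = mat 1 - \<epsilon> *\<^sub>R X"
  have Sk: "S *v k = k - \<epsilon> *\<^sub>R (X *v k)" for k
    unfolding S_def by (simp add: matrix_vector_mult_diff_rdistrib scaleR_matrix_vector_assoc[symmetric])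
  have "k = 0" if "S *v k = 0" for k
  proof -
    have "0 = (S *v k) \<bullet> k" using that by simp
    also have "\<dots> = (norm k)\<^sup>2 - \<epsilon> * (B (?E k) (?E k) - \<kappa> * (norm k)\<^sup>2)"
      unfolding Sk inner_diff_left by (simp add: Xq dot_square_norm)
    finally have "\<epsilon> * \<kappa> * (norm k)\<^sup>2 = \<epsilon> * B (?E k) (?E k) - (norm k)\<^sup>2" by (simp add: algebra_simps)
    moreover have "\<epsilon> * B (?E k) (?E k) \<le> (norm k)\<^sup>2" using BX[of k] \<epsilon> by (simp add: field_simps)
    ultimately have "\<epsilon> * \<kappa> * (norm k)\<^sup>2 \<le> 0" by simp
    then show "k = 0" using \<epsilon> \<kappa> by (simp add: mult_le_0_iff)
  qed
  then obtain N where N: "N ** S = mat 1" using matrix_left_invertible_ker[of S] by blast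
  then have "S ** N = mat 1" using matrix_left_right_inverse by blast
  then have SN: "S *v (N *v k) = k" for k by (metis matrix_vector_mul_assoc matrix_vector_mul_lid)
  have NX: "N *v k - k = \<epsilon> *\<^sub>R (X *v (N *v k))" for k using SN[of k] unfolding Sk by (simp add: algebra_simps)
  \<comment> \<open>The maximal value of that quadratic form, as a form in \<open>k\<close>, minus
    the Hessian \<open>2 * \<gamma>\<close> of the localising term.\<close>
  define Y where "Y = transpose N ** (X ** N) - (1 / \<epsilon>) *\<^sub>R (transpose (N - mat 1) ** (N - mat 1)) - (2 * \<gamma>) *\<^sub>R mat 1"
  have Yk: "(Y *v k) \<bullet> k = (X *v (N *v k)) \<bullet> (N *v k) - (norm (N *v k - k))\<^sup>2 / \<epsilon> - 2 * \<gamma> * (norm k)\<^sup>2" for k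
  proof -
    have "(transpose (N - mat 1) ** (N - mat 1) *v k) \<bullet> k = (norm (N *v k - k))\<^sup>2"
      unfolding matrix_vector_mul_assoc[symmetric] inner_transpose_mult
      by (simp add: matrix_vector_mult_diff_rdistrib dot_square_norm)
    moreover have "(transpose N ** (X ** N) *v k) \<bullet> k = (X *v (N *v k)) \<bullet> (N *v k)"
      unfolding matrix_vector_mul_assoc[symmetric] inner_transpose_mult ..
    ultimately show ?thesis unfolding Y_def
      by (simp add: matrix_vector_mult_diff_rdistrib inner_diff_left scaleR_matrix_vector_assoc[symmetric] dot_square_norm)
  qed
  have tsc: "transpose (c *\<^sub>R A) = c *\<^sub>R transpose A" for c and A :: "real^'n^'n" by (simp add: transpose_def vec_eq_iff)
  have tdiff: "transpose (A - A') = transpose A - transpose A'" for A A' :: "real^'n^'n" by (simp add: transpose_def vec_eq_iff)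
  have Yt: "transpose Y = Y" unfolding Y_def
    by (simp only: tdiff tsc matrix_transpose_mul transpose_transpose transpose_mat Xt matrix_mul_assoc)
  have Yjet: "(l (1, 0), jet_grad l - (2 * \<gamma>) *\<^sub>R (y - y1), Y) \<in> parabolic_subjet v t y"
  proof (rule parabolic_subjetI[OF Yt])
    fix \<eta> :: real assume \<eta>: "0 < \<eta>"
    obtain KB where KB: "0 < KB" "\<And>h k. \<bar>B h k\<bar> \<le> KB * norm h * norm k"
      using bilinear_bounded_pos[OF B(1)] by auto
    obtain m where m: "0 < m" "\<And>k. norm (N *v k) \<le> m * norm k"
      using linear_bounded_pos[OF matrix_vector_mul_linear[of N]] by auto
    \<comment> \<open>\<open>x\<close> moves by \<open>N *v k\<close>, of norm at most
      \<open>m * norm k\<close>; this scaling turns the jet error there into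
      \<open>\<eta> * (norm k)^2\<close>.\<close>
    define \<eta>' where "\<eta>' = \<eta> / (m\<^sup>2 + 1)"
    have \<eta>': "0 < \<eta>'" using \<eta> by (simp add: \<eta>'_def add_nonneg_pos)
    have \<eta>'m: "\<eta>' * m\<^sup>2 \<le> \<eta>" 
    proof -
      have "\<eta>' * m\<^sup>2 \<le> \<eta>' * (m\<^sup>2 + 1)" using \<eta>' by (intro mult_left_mono) auto
      also have "\<dots> = \<eta>" unfolding \<eta>'_def by (simp add: add_nonneg_pos less_imp_neq[symmetric])
      finally show ?thesis .
    qed
    obtain \<delta> where \<delta>: "0 < \<delta>" "\<And>s k. \<bar>s\<bar> < \<delta> \<Longrightarrow> 0 \<le> k \<Longrightarrow> k < \<delta> \<Longrightarrow> (KB + KB * m + \<eta>') * (s\<^sup>2 + \<bar>s\<bar> * k) \<le> \<eta> * \<bar>s\<bar>"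
      using parabolic_quadratic_error[of "KB + KB * m + \<eta>'" \<eta>] KB m \<eta>' \<eta> by auto
    have c: "isCont (\<lambda>z. (fst z, N *v snd z)) (0::real \<times> (real^'n))"
      by (intro continuous_intros linear_continuous_at[OF matrix_vector_mul_bounded_linear, THEN isCont_o2[rotated]])
    have f1: "filterlim (\<lambda>z. (fst z, N *v snd z)) (nhds 0) (nhds (0::real \<times> (real^'n)))"
      using c[unfolded isCont_def, THEN tendsto_at_iff_tendsto_nhds[THEN iffD1]] by (simp add: zero_prod_def)
    have f2: "filterlim (\<lambda>z. ((fst z, N *v snd z), snd z)) (nhds 0) (nhds (0::real \<times> (real^'n)))"
      using tendsto_Pair[OF f1[unfolded zero_prod_def] tendsto_snd[OF filterlim_ident]] by (simp add: zero_prod_def)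
    have near: "\<forall>\<^sub>F z in nhds (0::real \<times> (real^'n)). \<bar>fst z\<bar> < \<delta> \<and> norm (snd z) < \<delta>"
      unfolding eventually_nhds_metric
    proof (intro exI[of _ \<delta>] conjI allI impI)
      fix z :: "real \<times> (real^'n)" assume "dist z 0 < \<delta>"
      then show "\<bar>fst z\<bar> < \<delta>" "norm (snd z) < \<delta>"
        using norm_fst_le[of "fst z" "snd z"] norm_snd_le[of "snd z" "fst z"] by auto
    qed (use \<delta> in auto)
    \<comment> \<open>Second variation: \<open>y\<close> moves by \<open>k\<close> and
      \<open>x\<close> by \<open>N *v k\<close>, simultaneously in the upper bound for
      \<open>w\<close> and in its jet.\<close>
    from eventually_compose_filterlim[OF w1 f2] eventually_compose_filterlim[OF jet[OF \<eta>'] f1] near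
    show "\<forall>\<^sub>F (s, k) in nhds 0. v t y + l (1, 0) * s + (jet_grad l - (2 * \<gamma>) *\<^sub>R (y - y1)) \<bullet> k
       + 1/2 * ((Y *v k) \<bullet> k) - \<eta> * (\<bar>s\<bar> + (norm k)\<^sup>2) \<le> v (t + s) (y + k)"
    proof eventually_elim
      case (elim z)
      obtain s k where z: "z = (s, k)" by (cases z)
      define M where "M = N *v k"
      note E = elim[unfolded z, simplified, folded M_def]
      have e1: "w (t + s, x + M) \<le> v (t + s) (y + k) + (norm (x + M - (y + k)))\<^sup>2 / (2 * \<epsilon>) + \<gamma> * (norm (y + k - y1))\<^sup>2"
        and e2: "w (t, x) + l (s, M) + 1/2 * B (s, M) (s, M) - \<eta>' * (norm (s, M))\<^sup>2 \<le> w (t + s, x + M)"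
        using E by auto
      have Mm: "norm M \<le> m * norm k" using m(2) by (simp add: M_def)
      have n1: "(norm (x + M - (y + k)))\<^sup>2 = (norm (x - y))\<^sup>2 + 2 * ((x - y) \<bullet> (M - k)) + (norm (M - k))\<^sup>2"
        using norm_add_sq[of "(x - y)" "(M - k)"] by (simp add: algebra_simps)
      have n2: "(norm (y + k - y1))\<^sup>2 = (norm (y - y1))\<^sup>2 + 2 * ((y - y1) \<bullet> k) + (norm k)\<^sup>2"
        using norm_add_sq[of "(y - y1)" "k"] by (simp add: algebra_simps)
      have n3: "(norm (x + M - (y + k)))\<^sup>2 / (2 * \<epsilon>) = (norm (x - y))\<^sup>2 / (2 * \<epsilon>) + jet_grad l \<bullet> M - jet_grad l \<bullet> k + 1/2 * ((norm (M - k))\<^sup>2 / \<epsilon>)"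

      proof -
        have "jet_grad l \<bullet> M - jet_grad l \<bullet> k = (1 / \<epsilon>) * ((x - y) \<bullet> (M - k))"
          unfolding grad inner_scaleR_left inner_diff_right right_diff_distrib ..
        moreover have "(a + 2 * c + m') / (2 * \<epsilon>) = a / (2 * \<epsilon>) + (1 / \<epsilon>) * c + 1/2 * (m' / \<epsilon>)" for a c m'
          using \<epsilon> by (simp add: field_simps)
        ultimately show ?thesis unfolding n1 by simp
      qed
      have b1: "B (s, M) (s, M) = B (s, 0) (s, 0) + 2 * B (s, 0) (0, M) + B (0, M) (0, M)"
      proof -
        have d: "(s, M) = (s, 0) + (0, M)" by simp
        show ?thesis unfolding d bilinear_ladd[OF B(1)] bilinear_radd[OF B(1)] using B(2)[of "(0, M)" "(s, 0)"] by simp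
      qed
      have b2: "\<bar>B (s, 0) (s, 0)\<bar> \<le> KB * s\<^sup>2" using KB(2)[of "(s, 0)" "(s, 0)"] by (simp add: power2_eq_square mult.assoc)
      have b3: "\<bar>B (s, 0) (0, M)\<bar> \<le> KB * m * (\<bar>s\<bar> * norm k)"
      proof -
        have "\<bar>B (s, 0) (0, M)\<bar> \<le> KB * \<bar>s\<bar> * norm M" using KB(2)[of "(s, 0)" "(0, M)"] by simp
        also have "\<dots> \<le> KB * \<bar>s\<bar> * (m * norm k)" using Mm KB by (intro mult_left_mono) auto
        finally show ?thesis by (simp add: mult_ac)
      qed
      have b4: "B (0, M) (0, M) \<ge> (X *v M) \<bullet> M" unfolding Xq using \<kappa> by simp
      have b5: "\<eta>' * (norm (s, M))\<^sup>2 \<le> \<eta>' * s\<^sup>2 + \<eta> * (norm k)\<^sup>2"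
      proof -
        have "(norm M)\<^sup>2 \<le> m\<^sup>2 * (norm k)\<^sup>2" using power_mono[OF Mm, of 2] by (simp add: power_mult_distrib)
        then have "\<eta>' * (norm M)\<^sup>2 \<le> (\<eta>' * m\<^sup>2) * (norm k)\<^sup>2" using \<eta>' by (simp add: mult.assoc)
        also have "\<dots> \<le> \<eta> * (norm k)\<^sup>2" using \<eta>'m by (rule mult_right_mono) auto
        finally show ?thesis by (simp add: norm_Pair distrib_left)
      qed
      have b6: "KB * s\<^sup>2 + KB * m * (\<bar>s\<bar> * norm k) + \<eta>' * s\<^sup>2 \<le> \<eta> * \<bar>s\<bar>"
      proof -
        have sk: "0 \<le> \<bar>s\<bar> * norm k" by simp
        have "0 \<le> KB * (\<bar>s\<bar> * norm k)" "0 \<le> \<eta>' * (\<bar>s\<bar> * norm k)" "0 \<le> KB * m * s\<^sup>2" using KB \<eta>' m sk by auto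
        moreover have "(KB + KB * m + \<eta>') * (s\<^sup>2 + \<bar>s\<bar> * norm k) \<le> \<eta> * \<bar>s\<bar>" using \<delta>(2)[of s "norm k"] E by auto
        ultimately show ?thesis by (simp add: algebra_simps)
      qed
      have lin: "l (s, M) = l (1, 0) * s + jet_grad l \<bullet> M" by (rule jet_grad[OF l])
      have "(jet_grad l - (2 * \<gamma>) *\<^sub>R (y - y1)) \<bullet> k = jet_grad l \<bullet> k - 2 * \<gamma> * ((y - y1) \<bullet> k)" by (simp add: inner_diff_left)
      moreover have "\<gamma> * (norm (y + k - y1))\<^sup>2 = \<gamma> * (norm (y - y1))\<^sup>2 + 2 * \<gamma> * ((y - y1) \<bullet> k) + \<gamma> * (norm k)\<^sup>2"
        unfolding n2 by (simp add: algebra_simps)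
      moreover have "1/2 * ((Y *v k) \<bullet> k) = 1/2 * ((X *v M) \<bullet> M) - 1/2 * ((norm (M - k))\<^sup>2 / \<epsilon>) - \<gamma> * (norm k)\<^sup>2"
        unfolding Yk M_def[symmetric] by (simp add: algebra_simps)
      moreover have "\<eta> * (\<bar>s\<bar> + (norm k)\<^sup>2) = \<eta> * \<bar>s\<bar> + \<eta> * (norm k)\<^sup>2" by (simp add: distrib_left)
      moreover have "0 \<le> KB * s\<^sup>2" "0 \<le> KB * m * (\<bar>s\<bar> * norm k)" using KB m by auto
      ultimately have "v t y + l (1, 0) * s + (jet_grad l - (2 * \<gamma>) *\<^sub>R (y - y1)) \<bullet> k
       + 1/2 * ((Y *v k) \<bullet> k) - \<eta> * (\<bar>s\<bar> + (norm k)\<^sup>2) \<le> v (t + s) (y + k)"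
        using e1 e2 w0 n3 b1 b2 b3 b4 b5 b6 lin by linarith
      then show ?case unfolding z by simp
    qed
  qed
  \<comment> \<open>Expansion around the maximiser \<open>M\<close> belonging to
    \<open>\<zeta>\<close>: the cross term cancels because
    \<open>M - \<zeta> = \<epsilon> *\<^sub>R (X *v M)\<close>, and on \<open>z\<close> the bound
    \<open>X \<le> 1 / \<epsilon>\<close> remains.\<close>
  moreover have "B (0, \<xi>) (0, \<xi>) - \<kappa> * (norm \<xi>)\<^sup>2 \<le> (norm (\<xi> - \<zeta>))\<^sup>2 / \<epsilon> + (Y *v \<zeta>) \<bullet> \<zeta> + 2 * \<gamma> * (norm \<zeta>)\<^sup>2" for \<xi> \<zeta>
  proof -
    define M where "M = N *v \<zeta>"
    define z where "z = \<xi> - M"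
    have \<xi>: "\<xi> = M + z" by (simp add: z_def)
    have "B (0, \<xi>) (0, \<xi>) - \<kappa> * (norm \<xi>)\<^sup>2 = (X *v \<xi>) \<bullet> \<xi>" using Xq by simp
    also have "\<dots> = (X *v M) \<bullet> M + 2 * ((X *v M) \<bullet> z) + (X *v z) \<bullet> z"
      unfolding \<xi> by (simp add: matrix_vector_right_distrib inner_add_left inner_add_right Xs[of z M])
    also have "\<dots> \<le> (X *v M) \<bullet> M + 2 * ((X *v M) \<bullet> z) + (norm z)\<^sup>2 / \<epsilon>" using Xle by simp
    also have "(norm z)\<^sup>2 / \<epsilon> = (norm (\<xi> - \<zeta>))\<^sup>2 / \<epsilon> - (norm (M - \<zeta>))\<^sup>2 / \<epsilon> - 2 * ((X *v M) \<bullet> z)"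
    proof -
      have "(norm (\<xi> - \<zeta>))\<^sup>2 = (norm (M - \<zeta>))\<^sup>2 + 2 * ((M - \<zeta>) \<bullet> z) + (norm z)\<^sup>2"
        using norm_add_sq[of "(M - \<zeta>)" "z"] unfolding \<xi> by (simp add: algebra_simps)
      moreover have "(M - \<zeta>) \<bullet> z = \<epsilon> * ((X *v M) \<bullet> z)" unfolding M_def NX by simp
      ultimately show ?thesis using \<epsilon> by (simp add: field_simps)
    qed
    finally show ?thesis unfolding Yk M_def[symmetric] by simp
  qed
  ultimately show "\<exists>Y. (l (1, 0), jet_grad l - (2 * \<gamma>) *\<^sub>R (y - y1), Y) \<in> parabolic_subjet v t y \<and>
      (\<forall>\<xi> \<zeta>. B (0, \<xi>) (0, \<xi>) - \<kappa> * (norm \<xi>)\<^sup>2 \<le> (norm (\<xi> - \<zeta>))\<^sup>2 / \<epsilon> + (Y *v \<zeta>) \<bullet> \<zeta> + 2 * \<gamma> * (norm \<zeta>)\<^sup>2)"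
    by blast
qed

section \<open>The Hamiltonian\<close>

text \<open>Turns the second-order term into a sum over the columns of \<open>A\<close>, which serve
  as the directions in \<open>gen\<close>; estimates can then be made column by column.\<close>

lemma trace_covariance:
  fixes A :: "real^'d^'n" and X :: "real^'n^'n"
  shows "trace ((A ** transpose A) ** X) = (\<Sum>j\<in>UNIV. (X *v column j A) \<bullet> column j A)"
proof -
  have "trace ((A ** transpose A) ** X) = (\<Sum>i\<in>UNIV. \<Sum>k\<in>UNIV. \<Sum>j\<in>UNIV. A $ i $ j * A $ k $ j * X $ k $ i)"
    by (simp add: trace_def matrix_matrix_mult_def transpose_def sum_distrib_right)
  also have "\<dots> = (\<Sum>i\<in>UNIV. \<Sum>j\<in>UNIV. \<Sum>k\<in>UNIV. A $ i $ j * A $ k $ j * X $ k $ i)"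
    by (intro sum.cong refl sum.swap)
  also have "\<dots> = (\<Sum>j\<in>UNIV. \<Sum>i\<in>UNIV. \<Sum>k\<in>UNIV. A $ i $ j * A $ k $ j * X $ k $ i)"
    by (rule sum.swap)
  also have "\<dots> = (\<Sum>j\<in>UNIV. \<Sum>k\<in>UNIV. \<Sum>i\<in>UNIV. A $ i $ j * A $ k $ j * X $ k $ i)"
    by (intro sum.cong refl sum.swap)
  also have "\<dots> = (\<Sum>j\<in>UNIV. (X *v column j A) \<bullet> column j A)"
    by (simp add: inner_vec_def matrix_vector_mult_def column_def sum_distrib_left mult_ac)
  finally show ?thesis .
qed

lemma norm_matrix_sq:
  fixes A :: "real^'d^'n"
  shows "(norm A)\<^sup>2 = (\<Sum>j\<in>UNIV. (norm (column j A))\<^sup>2)"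
proof -
  have "(norm A)\<^sup>2 = (\<Sum>i\<in>UNIV. \<Sum>j\<in>UNIV. A $ i $ j * A $ i $ j)"
    by (simp add: power2_norm_eq_inner inner_vec_def)
  also have "\<dots> = (\<Sum>j\<in>UNIV. \<Sum>i\<in>UNIV. A $ i $ j * A $ i $ j)" by (rule sum.swap)
  finally show ?thesis by (simp add: power2_norm_eq_inner inner_vec_def column_def)
qed

lemma norm_vector_matrix_mult_le:
  fixes A :: "real^'d^'n"
  shows "norm (q v* A) \<le> norm q * norm A"
proof (rule power2_le_imp_le)
  have "(norm (q v* A))\<^sup>2 = (\<Sum>j\<in>UNIV. (q \<bullet> column j A)\<^sup>2)"
    unfolding power2_norm_eq_inner inner_vec_def
    by (simp add: vector_matrix_mult_def column_def power2_eq_square mult_ac)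
  also have "\<dots> \<le> (\<Sum>j\<in>UNIV. (norm q)\<^sup>2 * (norm (column j A))\<^sup>2)"
    by (intro sum_mono) (metis Cauchy_Schwarz_ineq power2_norm_eq_inner)
  also have "\<dots> = (norm q * norm A)\<^sup>2" by (simp add: norm_matrix_sq sum_distrib_left[symmetric] power_mult_distrib)
  finally show "(norm (q v* A))\<^sup>2 \<le> (norm q * norm A)\<^sup>2" .
qed simp

lemma column_diff: "column i (A - A') = column i A - column i (A' :: real^'d^'n)"
  by (simp add: column_def vec_eq_iff)

section \<open>Joint continuity of the coefficients and uniformity in the control\<close>

lemma continuous_on_matrix_component [continuous_intros]:
  fixes f :: "'a::topological_space \<Rightarrow> real^'d^'n"
  assumes "continuous_on S f"
  shows "continuous_on S (\<lambda>z. f z $ i $ j)"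
  using assms unfolding continuous_on_def by (auto intro!: tendsto_vec_nth)

lemma continuous_on_trace_covariance [continuous_intros]:
  fixes A :: "'a::topological_space \<Rightarrow> real^'d^'n"
  assumes "continuous_on S A" "continuous_on S X"
  shows "continuous_on S (\<lambda>z. trace ((A z ** transpose (A z)) ** X z))"
proof -
  have "trace ((A z ** transpose (A z)) ** X z) = (\<Sum>i\<in>UNIV. \<Sum>k\<in>UNIV. \<Sum>j\<in>UNIV. A z $ i $ j * A z $ k $ j * X z $ k $ i)" for z
    by (simp add: trace_def matrix_matrix_mult_def transpose_def sum_distrib_right)
  then show ?thesis by (simp only:) (intro continuous_intros assms)
qed

lemma continuous_on_vector_matrix_mult [continuous_intros]:
  fixes A :: "'a::topological_space \<Rightarrow> real^'d^'n"
  assumes "continuous_on S A" "continuous_on S q"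
  shows "continuous_on S (\<lambda>z. q z v* A z)"
  unfolding vector_matrix_mult_def by (intro continuous_intros assms continuous_on_vec_lambda)

text \<open>Separate continuity in \<open>t\<close> is enough because the Lipschitz constant in the
  other variables does not depend on \<open>t\<close>.\<close>

lemma continuous_on_Lipschitz_param:
  fixes f :: "real \<Rightarrow> 'a::metric_space \<Rightarrow> 'b::metric_space"
  assumes c: "\<And>a. a \<in> A \<Longrightarrow> continuous_on I (\<lambda>t. f t a)"
    and l: "\<And>t a a'. t \<in> I \<Longrightarrow> a \<in> A \<Longrightarrow> a' \<in> A \<Longrightarrow> dist (f t a) (f t a') \<le> K * dist a a'"
  shows "continuous_on (I \<times> A) (\<lambda>z. f (fst z) (snd z))"
  unfolding continuous_on_iff
proof (intro ballI allI impI)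
  fix z and e :: real assume z: "z \<in> I \<times> A" and e: "0 < e"
  obtain t a where ta: "z = (t, a)" "t \<in> I" "a \<in> A" using z by auto
  obtain d where d: "0 < d" "\<And>s. s \<in> I \<Longrightarrow> dist s t < d \<Longrightarrow> dist (f s a) (f t a) < e / 2"
    using c[OF ta(3), unfolded continuous_on_iff, rule_format, OF ta(2), of "e / 2"] e by auto
  define k where "k = \<bar>K\<bar> + 1"
  have k: "0 < k" "K \<le> k" by (auto simp: k_def)
  show "\<exists>d>0. \<forall>z'\<in>I \<times> A. dist z' z < d \<longrightarrow> dist (f (fst z') (snd z')) (f (fst z) (snd z)) < e"
  proof (intro exI conjI ballI impI)
    show "0 < min d (e / (2 * k))" using d e k by auto
    fix z' assume z': "z' \<in> I \<times> A" "dist z' z < min d (e / (2 * k))"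
    obtain s a' where sa: "z' = (s, a')" "s \<in> I" "a' \<in> A" using z' by auto
    have d1: "dist s t < d" "dist a' a < e / (2 * k)"
      using z' dist_fst_le[of z' z] dist_snd_le[of z' z] unfolding sa ta by auto
    have "dist (f s a') (f s a) \<le> K * dist a' a" using l sa ta by auto
    also have "\<dots> \<le> k * dist a' a" using k by (intro mult_right_mono) auto
    also have "\<dots> < k * (e / (2 * k))" using d1 k by (intro mult_strict_left_mono) auto
    also have "\<dots> = e / 2" using k by simp
    finally show "dist (f (fst z') (snd z')) (f (fst z) (snd z)) < e"
      using d(2)[OF sa(2) d1(1)] dist_triangle[of "f s a'" "f t a" "f s a"] unfolding sa ta by simp
  qed
qed

text \<open>Controls violating the bound ever closer to \<open>s0\<close> would accumulate at some
  point of the compact \<open>U\<close>, where continuity is contradicted.\<close>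

lemma tube:
  fixes f :: "'a::metric_space \<Rightarrow> 'c::metric_space \<Rightarrow> real"
  assumes f: "continuous_on (S \<times> U) (\<lambda>z. f (fst z) (snd z))" and U: "compact U" and s0: "s0 \<in> S" and \<eta>: "0 < \<eta>"
  shows "\<exists>\<delta>>0. \<forall>s\<in>S. dist s s0 < \<delta> \<longrightarrow> (\<forall>c\<in>U. f s c < f s0 c + \<eta>)"
proof (rule ccontr)
  assume neg: "\<not> ?thesis"
  have ex: "\<exists>s c. s \<in> S \<and> dist s s0 < d \<and> c \<in> U \<and> f s0 c + \<eta> \<le> f s c" if "0 < d" for d
  proof (rule ccontr)
    assume "\<not> ?thesis"
    then have "\<forall>s\<in>S. dist s s0 < d \<longrightarrow> (\<forall>c\<in>U. f s c < f s0 c + \<eta>)" by force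
    with that neg show False by blast
  qed
  have "\<forall>n. \<exists>s c. s \<in> S \<and> dist s s0 < inverse (real (Suc n)) \<and> c \<in> U \<and> f s0 c + \<eta> \<le> f s c"
    by (intro allI ex) (simp only: inverse_positive_iff_positive of_nat_0_less_iff zero_less_Suc)
  from choice[OF this] obtain s where "\<forall>n. \<exists>c. s n \<in> S \<and> dist (s n) s0 < inverse (real (Suc n)) \<and> c \<in> U \<and> f s0 c + \<eta> \<le> f (s n) c" ..
  from choice[OF this] obtain c where c: "\<forall>n. s n \<in> S \<and> dist (s n) s0 < inverse (real (Suc n)) \<and> c n \<in> U \<and> f s0 (c n) + \<eta> \<le> f (s n) (c n)" ..
  have sc: "s n \<in> S" "dist (s n) s0 < inverse (real (Suc n))" "c n \<in> U" "f s0 (c n) + \<eta> \<le> f (s n) (c n)" for n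
    using c[rule_format, of n] by (simp_all del: of_nat_Suc)
  have s: "s \<longlonglongrightarrow> s0"
  proof (rule metric_LIMSEQ_I)
    fix e :: real assume "0 < e"
    then obtain N where N: "inverse (real (Suc N)) < e" using reals_Archimedean by blast
    have "dist (s n) s0 < e" if "N \<le> n" for n
    proof -
      have "inverse (real (Suc n)) \<le> inverse (real (Suc N))" using that by (intro le_imp_inverse_le) auto
      then show ?thesis using sc(2)[of n] N by linarith
    qed
    then show "\<exists>N. \<forall>n\<ge>N. dist (s n) s0 < e" by blast
  qed
  have "seq_compact U" using U by (simp only: compact_eq_seq_compact_metric)
  moreover have "\<forall>n. c n \<in> U" by (rule allI) (rule sc(3))
  ultimately obtain c0 r where r: "c0 \<in> U" "strict_mono r" "(c \<circ> r) \<longlonglongrightarrow> c0" by (rule seq_compactE)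
  have sr: "(s \<circ> r) \<longlonglongrightarrow> s0" using LIMSEQ_subseq_LIMSEQ[OF s r(2)] .
  have t1: "(\<lambda>n. f (s (r n)) (c (r n))) \<longlonglongrightarrow> f s0 c0"
    using continuous_on_tendsto_compose[OF f, of "\<lambda>n. (s (r n), c (r n))" "(s0, c0)" sequentially]
      tendsto_Pair[OF sr r(3)] sc s0 r(1) by (simp add: o_def)
  have t2: "(\<lambda>n. f s0 (c (r n)) + \<eta>) \<longlonglongrightarrow> f s0 c0 + \<eta>"
    using continuous_on_tendsto_compose[OF f, of "\<lambda>n. (s0, c (r n))" "(s0, c0)" sequentially]
      tendsto_Pair[OF tendsto_const[where k=s0] r(3)] sc s0 r(1) by (intro tendsto_add tendsto_const) (simp add: o_def)
  have "f s0 c0 + \<eta> \<le> f s0 c0" by (rule LIMSEQ_le[OF t2 t1]) (use sc(4) in auto)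
  then show False using \<eta> by simp
qed

text \<open>The expression under the supremum of \<open>obstacle_HJB\<close>, with the value of the
  solution as a free argument and one fixed control.\<close>

definition hamil ::
  "(real \<Rightarrow> real^'n \<Rightarrow> real^'k \<Rightarrow> real^'n) \<Rightarrow> (real \<Rightarrow> real^'n \<Rightarrow> real^'k \<Rightarrow> real^'d^'n) \<Rightarrow>
   (real \<Rightarrow> real^'n \<Rightarrow> real \<Rightarrow> real^'d \<Rightarrow> real^'k \<Rightarrow> real) \<Rightarrow>
   real \<Rightarrow> real^'n \<Rightarrow> real \<Rightarrow> real^'n \<Rightarrow> real^'n^'n \<Rightarrow> real^'k \<Rightarrow> real" where
  "hamil b \<sigma> g t x y q X c =
     1/2 * trace ((\<sigma> t x c ** transpose (\<sigma> t x c)) ** X) + b t x c \<bullet> q + g t x y (q v* \<sigma> t x c) c"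

locale hjb =
  fixes T L :: real and U :: "(real^'k) set"
    and b :: "real \<Rightarrow> real^'n \<Rightarrow> real^'k \<Rightarrow> real^'n"
    and \<sigma> :: "real \<Rightarrow> real^'n \<Rightarrow> real^'k \<Rightarrow> real^'d^'n"
    and g :: "real \<Rightarrow> real^'n \<Rightarrow> real \<Rightarrow> real^'d \<Rightarrow> real^'k \<Rightarrow> real"
    and h :: "real \<Rightarrow> real^'n \<Rightarrow> real"
    and \<Phi> :: "real^'n \<Rightarrow> real"
  assumes T: "0 < T" and U: "compact U" "U \<noteq> {}" and L: "0 < L"
    and b_cont: "\<And>x v. v \<in> U \<Longrightarrow> continuous_on {0..T} (\<lambda>t. b t x v)"
    and \<sigma>_cont: "\<And>x v. v \<in> U \<Longrightarrow> continuous_on {0..T} (\<lambda>t. \<sigma> t x v)"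
    and g_cont: "\<And>x y z v. v \<in> U \<Longrightarrow> continuous_on {0..T} (\<lambda>t. g t x y z v)"
    and h_cont: "\<And>x. continuous_on {0..T} (\<lambda>t. h t x)"
    and b_\<sigma>_Lipschitz: "\<And>t x x' v v'. t \<in> {0..T} \<Longrightarrow> v \<in> U \<Longrightarrow> v' \<in> U \<Longrightarrow>
          norm (b t x v - b t x' v') + norm (\<sigma> t x v - \<sigma> t x' v')
            \<le> L * (norm (x - x') + norm (v - v'))"
    and g_\<Phi>_h_Lipschitz: "\<And>t x x' y y' z z' v v'. t \<in> {0..T} \<Longrightarrow> v \<in> U \<Longrightarrow> v' \<in> U \<Longrightarrow>
          \<bar>g t x y z v - g t x' y' z' v'\<bar> + \<bar>\<Phi> x - \<Phi> x'\<bar> + \<bar>h t x - h t x'\<bar>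
            \<le> L * (norm (x - x') + \<bar>y - y'\<bar> + norm (z - z') + norm (v - v'))"
begin

lemma b_Lip: "t \<in> {0..T} \<Longrightarrow> v \<in> U \<Longrightarrow> norm (b t x v - b t x' v) \<le> L * norm (x - x')"
  and \<sigma>_Lip: "t \<in> {0..T} \<Longrightarrow> v \<in> U \<Longrightarrow> norm (\<sigma> t x v - \<sigma> t x' v) \<le> L * norm (x - x')"
  using b_\<sigma>_Lipschitz[of t v v x x'] norm_ge_zero[of "b t x v - b t x' v"] norm_ge_zero[of "\<sigma> t x v - \<sigma> t x' v"]
  by (auto simp del: norm_ge_zero)

lemma g_Lip: "t \<in> {0..T} \<Longrightarrow> v \<in> U \<Longrightarrow>
    \<bar>g t x y z v - g t x' y' z' v\<bar> \<le> L * (norm (x - x') + \<bar>y - y'\<bar> + norm (z - z'))"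
  using g_\<Phi>_h_Lipschitz[of t v v x y z x' y' z'] abs_ge_zero[of "\<Phi> x - \<Phi> x'"] abs_ge_zero[of "h t x - h t x'"]
  by (auto simp del: abs_ge_zero)

lemma b_\<sigma>_joint:
  "continuous_on ({0..T} \<times> (UNIV \<times> U)) (\<lambda>z. b (fst z) (fst (snd z)) (snd (snd z)))"
  "continuous_on ({0..T} \<times> (UNIV \<times> U)) (\<lambda>z. \<sigma> (fst z) (fst (snd z)) (snd (snd z)))"
proof -
  have d: "norm (fst a - fst a') + norm (snd a - snd a') \<le> 2 * dist a a'" for a a' :: "(real^'n) \<times> (real^'k)"
    using dist_fst_le[of a a'] dist_snd_le[of a a'] by (simp add: dist_norm)
  have *: "norm (b t (fst a) (snd a) - b t (fst a') (snd a')) \<le> (2 * L) * dist a a'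
     \<and> norm (\<sigma> t (fst a) (snd a) - \<sigma> t (fst a') (snd a')) \<le> (2 * L) * dist a a'"
    if "t \<in> {0..T}" "a \<in> UNIV \<times> U" "a' \<in> UNIV \<times> U" for t a a'
  proof -
    have "snd a \<in> U" "snd a' \<in> U" using that by auto
    note lip = b_\<sigma>_Lipschitz[OF that(1) this, of "fst a" "fst a'"]
    have "L * (norm (fst a - fst a') + norm (snd a - snd a')) \<le> L * (2 * dist a a')"
      using d[of a a'] L by (intro mult_left_mono) auto
    then have "L * (norm (fst a - fst a') + norm (snd a - snd a')) \<le> (2 * L) * dist a a'" by (simp only: mult_ac)
    with lip show ?thesis
      using norm_ge_zero[of "b t (fst a) (snd a) - b t (fst a') (snd a')"]
        norm_ge_zero[of "\<sigma> t (fst a) (snd a) - \<sigma> t (fst a') (snd a')"] by linarith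
  qed
  show "continuous_on ({0..T} \<times> (UNIV \<times> U)) (\<lambda>z. b (fst z) (fst (snd z)) (snd (snd z)))"
    by (rule continuous_on_Lipschitz_param[where f="\<lambda>t a. b t (fst a) (snd a)" and K="2 * L"])
       (use * b_cont in \<open>auto simp: dist_norm[of "b _ _ _"]\<close>)
  show "continuous_on ({0..T} \<times> (UNIV \<times> U)) (\<lambda>z. \<sigma> (fst z) (fst (snd z)) (snd (snd z)))"
    by (rule continuous_on_Lipschitz_param[where f="\<lambda>t a. \<sigma> t (fst a) (snd a)" and K="2 * L"])
       (use * \<sigma>_cont in \<open>auto simp: dist_norm[of "\<sigma> _ _ _"]\<close>)
qed

lemma g_joint:
  "continuous_on ({0..T} \<times> (UNIV \<times> UNIV \<times> UNIV \<times> U))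
     (\<lambda>z. g (fst z) (fst (snd z)) (fst (snd (snd z))) (fst (snd (snd (snd z)))) (snd (snd (snd (snd z)))))"
proof -
  have d: "norm (fst a - fst a') + \<bar>fst (snd a) - fst (snd a')\<bar> + norm (fst (snd (snd a)) - fst (snd (snd a'))) + norm (snd (snd (snd a)) - snd (snd (snd a'))) \<le> 4 * dist a a'"
    for a a' :: "(real^'n) \<times> real \<times> (real^'d) \<times> (real^'k)"
    using dist_fst_le[of a a'] dist_snd_le[of a a'] dist_fst_le[of "snd a" "snd a'"] dist_snd_le[of "snd a" "snd a'"]
      dist_fst_le[of "snd (snd a)" "snd (snd a')"] dist_snd_le[of "snd (snd a)" "snd (snd a')"]
    by (simp add: dist_norm)
  show ?thesis
  proof (rule continuous_on_Lipschitz_param[where f="\<lambda>t a. g t (fst a) (fst (snd a)) (fst (snd (snd a))) (snd (snd (snd a)))" and K="4 * L"])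
    show "continuous_on {0..T} (\<lambda>t. g t (fst a) (fst (snd a)) (fst (snd (snd a))) (snd (snd (snd a))))"
      if "a \<in> UNIV \<times> UNIV \<times> UNIV \<times> U" for a using g_cont that by auto
    fix t and a a' :: "(real^'n) \<times> real \<times> (real^'d) \<times> (real^'k)"
    assume *: "t \<in> {0..T}" "a \<in> UNIV \<times> UNIV \<times> UNIV \<times> U" "a' \<in> UNIV \<times> UNIV \<times> UNIV \<times> U"
    have "snd (snd (snd a)) \<in> U" "snd (snd (snd a')) \<in> U" using * by auto
    note lip = g_\<Phi>_h_Lipschitz[OF *(1) this, of "fst a" "fst (snd a)" "fst (snd (snd a))" "fst a'" "fst (snd a')" "fst (snd (snd a'))"]
    have "L * (norm (fst a - fst a') + \<bar>fst (snd a) - fst (snd a')\<bar> + norm (fst (snd (snd a)) - fst (snd (snd a'))) + norm (snd (snd (snd a)) - snd (snd (snd a')))) \<le> L * (4 * dist a a')"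
      using d[of a a'] L by (intro mult_left_mono) auto
    then have "L * (norm (fst a - fst a') + \<bar>fst (snd a) - fst (snd a')\<bar> + norm (fst (snd (snd a)) - fst (snd (snd a'))) + norm (snd (snd (snd a)) - snd (snd (snd a')))) \<le> 4 * L * dist a a'"
      by (simp only: mult_ac)
    with lip
    show "dist (g t (fst a) (fst (snd a)) (fst (snd (snd a))) (snd (snd (snd a)))) (g t (fst a') (fst (snd a')) (fst (snd (snd a'))) (snd (snd (snd a')))) \<le> 4 * L * dist a a'"
      using abs_ge_zero[of "\<Phi> (fst a) - \<Phi> (fst a')"] abs_ge_zero[of "h t (fst a) - h t (fst a')"]
      unfolding dist_real_def by linarith
  qed
qed

lemma h_joint: "continuous_on ({0..T} \<times> UNIV) (\<lambda>z. h (fst z) (snd z))"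
proof (rule continuous_on_Lipschitz_param[where K=L])
  obtain v where "v \<in> U" using U by auto
  then show "dist (h t a) (h t a') \<le> L * dist a a'" if "t \<in> {0..T}" for t a a'
    using g_\<Phi>_h_Lipschitz[OF that, of v v a 0 0 a' 0 0] abs_ge_zero[of "\<Phi> a - \<Phi> a'"] abs_ge_zero[of "g t a 0 0 v - g t a' 0 0 v"]
    by (simp add: dist_norm dist_real_def)
qed (use h_cont in auto)

lemma b_continuous [continuous_intros]:
  assumes "continuous_on S t" "continuous_on S x" "continuous_on S c" "\<And>z. z \<in> S \<Longrightarrow> t z \<in> {0..T}" "\<And>z. z \<in> S \<Longrightarrow> c z \<in> U"
  shows "continuous_on S (\<lambda>z. b (t z) (x z) (c z))"
proof -
  have 1: "continuous_on S (\<lambda>z. (t z, x z, c z))" by (intro continuous_on_Pair assms)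
  have 2: "(\<lambda>z. (t z, x z, c z)) ` S \<subseteq> {0..T} \<times> (UNIV \<times> U)" using assms by auto
  show ?thesis using continuous_on_compose2[OF b_\<sigma>_joint(1) 1 2] by simp
qed

lemma \<sigma>_continuous [continuous_intros]:
  assumes "continuous_on S t" "continuous_on S x" "continuous_on S c" "\<And>z. z \<in> S \<Longrightarrow> t z \<in> {0..T}" "\<And>z. z \<in> S \<Longrightarrow> c z \<in> U"
  shows "continuous_on S (\<lambda>z. \<sigma> (t z) (x z) (c z))"
proof -
  have 1: "continuous_on S (\<lambda>z. (t z, x z, c z))" by (intro continuous_on_Pair assms)
  have 2: "(\<lambda>z. (t z, x z, c z)) ` S \<subseteq> {0..T} \<times> (UNIV \<times> U)" using assms by auto
  show ?thesis using continuous_on_compose2[OF b_\<sigma>_joint(2) 1 2] by simp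
qed

lemma g_continuous [continuous_intros]:
  assumes "continuous_on S t" "continuous_on S x" "continuous_on S y" "continuous_on S q" "continuous_on S c"
    "\<And>z. z \<in> S \<Longrightarrow> t z \<in> {0..T}" "\<And>z. z \<in> S \<Longrightarrow> c z \<in> U"
  shows "continuous_on S (\<lambda>z. g (t z) (x z) (y z) (q z) (c z))"
proof -
  have 1: "continuous_on S (\<lambda>z. (t z, x z, y z, q z, c z))" by (intro continuous_on_Pair assms)
  have 2: "(\<lambda>z. (t z, x z, y z, q z, c z)) ` S \<subseteq> {0..T} \<times> (UNIV \<times> UNIV \<times> UNIV \<times> U)" using assms by auto
  show ?thesis using continuous_on_compose2[OF g_joint 1 2] by simp
qed

lemma hamil_continuous:
  assumes "continuous_on S t" "continuous_on S x" "continuous_on S y" "continuous_on S q" "continuous_on S X" "continuous_on S c"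
    "\<And>z. z \<in> S \<Longrightarrow> t z \<in> {0..T}" "\<And>z. z \<in> S \<Longrightarrow> c z \<in> U"
  shows "continuous_on S (\<lambda>z. hamil b \<sigma> g (t z) (x z) (y z) (q z) (X z) (c z))"
  unfolding hamil_def by (intro continuous_intros assms) (use assms in auto)

lemma hamil_bdd: "t \<in> {0..T} \<Longrightarrow> bdd_above (hamil b \<sigma> g t x y q X ` U)"
  by (intro bounded_imp_bdd_above compact_imp_bounded compact_continuous_image U hamil_continuous continuous_on_const continuous_on_id) auto

text \<open>Compactness of \<open>U\<close> bounds the set under the supremum, which therefore
  dominates the value at each control.\<close>

lemma supersolution_ineq:
  assumes "viscosity_supersolution T b \<sigma> g h \<Phi> U v" "0 < t" "t < T" "(p, q, X) \<in> parabolic_subjet v t x" "c \<in> U"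
  shows "p + hamil b \<sigma> g t x (v t x) q X c \<le> 0" "h t x \<le> v t x"
proof -
  have *: "0 \<le> min (v t x - h t x) (- p - (SUP c\<in>U. hamil b \<sigma> g t x (v t x) q X c))"
  proof -
    have "\<forall>(p, q, X)\<in>parabolic_subjet v t x. 0 \<le> obstacle_HJB b \<sigma> g h U v t x p q X"
      using assms(1-3) unfolding viscosity_supersolution_def by simp
    from bspec[OF this assms(4)] show ?thesis unfolding obstacle_HJB_def hamil_def by simp
  qed
  then show "h t x \<le> v t x" by simp
  have "hamil b \<sigma> g t x (v t x) q X c \<le> (SUP c\<in>U. hamil b \<sigma> g t x (v t x) q X c)"
    by (rule cSUP_upper[OF assms(5) hamil_bdd]) (use assms in auto)
  then show "p + hamil b \<sigma> g t x (v t x) q X c \<le> 0" using * by simp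
qed

text \<open>Strictly above the obstacle the nonpositive entry of the minimum must be the second one,
  and its supremum is nearly attained by some control.\<close>

lemma subsolution_ineq:
  assumes "viscosity_subsolution T b \<sigma> g h \<Phi> U u" "0 < t" "t < T" "(p, q, X) \<in> parabolic_superjet u t x" "h t x < u t x" "0 < \<eta>"
  obtains c where "c \<in> U" "- \<eta> \<le> p + hamil b \<sigma> g t x (u t x) q X c"
proof -
  have *: "min (u t x - h t x) (- p - (SUP c\<in>U. hamil b \<sigma> g t x (u t x) q X c)) \<le> 0"
  proof -
    have "\<forall>(p, q, X)\<in>parabolic_superjet u t x. obstacle_HJB b \<sigma> g h U u t x p q X \<le> 0"
      using assms(1-3) unfolding viscosity_subsolution_def by simp
    from bspec[OF this assms(4)] show ?thesis unfolding obstacle_HJB_def hamil_def by simp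
  qed
  have "\<exists>c\<in>U. - \<eta> \<le> p + hamil b \<sigma> g t x (u t x) q X c"
  proof (rule ccontr)
    assume "\<not> ?thesis"
    then have "(SUP c\<in>U. hamil b \<sigma> g t x (u t x) q X c) \<le> - p - \<eta>" by (intro cSUP_least U(2)) (auto simp: not_le)
    then show False using * assms by (simp add: min_def split: if_splits)
  qed
  then show ?thesis using that by blast
qed

end

section \<open>Freezing the coefficients\<close>

lemma elliptic_parabolic_error:
  fixes B :: "real \<times> (real^'n) \<Rightarrow> real \<times> (real^'n) \<Rightarrow> real"
  assumes B: "bilinear B" "\<And>h k. B h k = B k h" and \<eta>: "0 < \<eta>"
  shows "\<forall>\<^sub>F h in nhds 0. \<bar>1/2 * B h h - 1/2 * ((jet_hess B *v snd h) \<bullet> snd h)\<bar> \<le> \<eta> * \<bar>fst h\<bar>"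
proof -
  obtain KB where KB: "0 < KB" "\<And>h k. \<bar>B h k\<bar> \<le> KB * norm h * norm k"
    using bilinear_bounded_pos[OF B(1)] by auto
  have "0 \<le> KB" using KB by simp
  from parabolic_quadratic_error[OF this \<eta>] obtain \<delta> where \<delta>: "0 < \<delta>"
    "\<And>s k. \<bar>s\<bar> < \<delta> \<Longrightarrow> 0 \<le> k \<Longrightarrow> k < \<delta> \<Longrightarrow> KB * (s\<^sup>2 + \<bar>s\<bar> * k) \<le> \<eta> * \<bar>s\<bar>" by blast
  show ?thesis
  proof (rule eventually_nhds_0_norm)
    show "0 < \<delta> / 2" using \<delta> by simp
    fix h :: "real \<times> (real^'n)" assume h: "norm h \<le> \<delta> / 2"
    obtain s k where sk: "h = (s, k)" by (cases h)
    have n: "\<bar>s\<bar> < \<delta>" "norm k < \<delta>" using h norm_fst_le[of s k] norm_snd_le[of k s] \<delta>(1) unfolding sk by auto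
    have d: "(s, k) = (s, 0) + (0, k)" by simp
    have b: "B (s, k) (s, k) = B (s, 0) (s, 0) + 2 * B (s, 0) (0, k) + B (0, k) (0, k)"
      unfolding d bilinear_ladd[OF B(1)] bilinear_radd[OF B(1)] using B(2)[of "(0, k)" "(s, 0)"] by simp
    have b2: "\<bar>B (s, 0) (s, 0)\<bar> \<le> KB * s\<^sup>2" using KB(2)[of "(s, 0)" "(s, 0)"] by (simp add: power2_eq_square mult.assoc)
    have b3: "\<bar>B (s, 0) (0, k)\<bar> \<le> KB * (\<bar>s\<bar> * norm k)" using KB(2)[of "(s, 0)" "(0, k)"] by (simp add: mult.assoc)
    have "KB * s\<^sup>2 + KB * (\<bar>s\<bar> * norm k) \<le> \<eta> * \<bar>s\<bar>" using \<delta>(2)[OF n(1) _ n(2)] by (simp add: distrib_left)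
    moreover have "0 \<le> KB * s\<^sup>2" using KB by simp
    ultimately show "\<bar>1/2 * B h h - 1/2 * ((jet_hess B *v snd h) \<bullet> snd h)\<bar> \<le> \<eta> * \<bar>fst h\<bar>"
    proof -
      assume "KB * s\<^sup>2 + KB * (\<bar>s\<bar> * norm k) \<le> \<eta> * \<bar>s\<bar>" "0 \<le> KB * s\<^sup>2"
      moreover have "\<bar>1/2 * (b1 + 2 * b2 + b3) - 1/2 * b3\<bar> \<le> c1 + c2" if "\<bar>b1\<bar> \<le> c1" "\<bar>b2\<bar> \<le> c2" "0 \<le> c1" for b1 b2 b3 c1 c2 :: real
        using that by (simp add: abs_le_iff field_simps)
      ultimately show ?thesis unfolding sk jet_hess[OF B(1)] b fst_conv snd_conv using b2 b3 order.trans by blast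
    qed
  qed
qed

lemma eventually_norm_sq_parabolic:
  "\<forall>\<^sub>F h in nhds (0 :: real \<times> 'a::real_normed_vector). (norm h)\<^sup>2 \<le> \<bar>fst h\<bar> + (norm (snd h))\<^sup>2"
proof (rule eventually_nhds_0_norm)
  fix h :: "real \<times> 'a" assume h: "norm h \<le> 1"
  have "\<bar>fst h\<bar> \<le> 1" using h norm_fst_le[of "fst h" "snd h"] by simp
  then have "\<bar>fst h\<bar> * \<bar>fst h\<bar> \<le> \<bar>fst h\<bar> * 1" by (intro mult_left_mono) auto
  then have "(fst h)\<^sup>2 \<le> \<bar>fst h\<bar>" by (simp add: power2_eq_square)
  moreover have "(norm h)\<^sup>2 = (fst h)\<^sup>2 + (norm (snd h))\<^sup>2" using norm_Pair[of "fst h" "snd h"] by simp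
  ultimately show "(norm h)\<^sup>2 \<le> \<bar>fst h\<bar> + (norm (snd h))\<^sup>2" by simp
qed simp

text \<open>An isotropic jet in space-time is stronger than a parabolic one: near 0 its error
  \<open>(norm h)^2\<close> is at most \<open>\<bar>s\<bar> + (norm k)^2\<close>, and the time
  entries of \<open>B\<close> are negligible.\<close>

lemma subjet_of_elliptic:
  fixes u :: "real \<Rightarrow> real^'n \<Rightarrow> real"
  assumes l: "linear l" and B: "bilinear B" "\<And>h k. B h k = B k h"
    and ev: "\<And>\<eta>. 0 < \<eta> \<Longrightarrow> \<forall>\<^sub>F h in nhds 0. u t x + l h + 1/2 * B h h - \<eta> * (norm h)\<^sup>2 \<le> u (t + fst h) (x + snd h)"
  shows "(l (1, 0), jet_grad l, jet_hess B) \<in> parabolic_subjet u t x"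
proof (rule parabolic_subjetI[OF transpose_jet_hess[of B, OF B(2)]])
  fix \<eta> :: real assume \<eta>: "0 < \<eta>"
  then have \<eta>2: "0 < \<eta> / 2" by simp
  from ev[OF \<eta>2] elliptic_parabolic_error[OF B \<eta>2] eventually_norm_sq_parabolic
  show "\<forall>\<^sub>F (s, k) in nhds 0. u t x + l (1, 0) * s + jet_grad l \<bullet> k + 1/2 * ((jet_hess B *v k) \<bullet> k)
     - \<eta> * (\<bar>s\<bar> + (norm k)\<^sup>2) \<le> u (t + s) (x + k)"
  proof eventually_elim
    case (elim z)
    obtain s k where z: "z = (s, k)" by (cases z)
    have "\<eta> / 2 * (norm z)\<^sup>2 \<le> \<eta> / 2 * (\<bar>s\<bar> + (norm k)\<^sup>2)" using elim \<eta> unfolding z by (intro mult_left_mono) auto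
    moreover have "\<eta> / 2 * \<bar>s\<bar> \<le> \<eta> / 2 * (\<bar>s\<bar> + (norm k)\<^sup>2)" using \<eta> by (intro mult_left_mono) auto
    moreover have "\<eta> * (\<bar>s\<bar> + (norm k)\<^sup>2) = \<eta> / 2 * (\<bar>s\<bar> + (norm k)\<^sup>2) + \<eta> / 2 * (\<bar>s\<bar> + (norm k)\<^sup>2)" by simp
    ultimately have "u t x + l (1, 0) * s + jet_grad l \<bullet> k + 1/2 * ((jet_hess B *v k) \<bullet> k)
     - \<eta> * (\<bar>s\<bar> + (norm k)\<^sup>2) \<le> u (t + s) (x + k)"
      using elim jet_grad[OF l, of s k] unfolding z fst_conv snd_conv by linarith
    then show ?case unfolding z by simp
  qed
qed

text \<open>The test function for \<open>u\<close> has two parts: a mollification plus a quadratic,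
  with a full space-time jet \<open>(l, B)\<close>, and a penalty with a parabolic jet
  \<open>(p, q, X)\<close>.\<close>

lemma superjet_of_sum:
  fixes u :: "real \<Rightarrow> real^'n \<Rightarrow> real"
  assumes l: "linear l" and B: "bilinear B" "\<And>h k. B h k = B k h" and X: "transpose X = X"
    and ev: "\<And>\<eta>. 0 < \<eta> \<Longrightarrow> \<forall>\<^sub>F h in nhds 0. u (t + fst h) (x + snd h) \<le> u t x + (l h + 1/2 * B h h)
      + (p * fst h + q \<bullet> snd h + 1/2 * ((X *v snd h) \<bullet> snd h)) + \<eta> * (\<bar>fst h\<bar> + (norm (snd h))\<^sup>2)"
  shows "(l (1, 0) + p, jet_grad l + q, jet_hess B + X) \<in> parabolic_superjet u t x"
proof (rule parabolic_superjetI)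
  show "transpose (jet_hess B + X) = jet_hess B + X"
    using transpose_jet_hess[of B, OF B(2)] X by (simp add: transpose_def vec_eq_iff)
  fix \<eta> :: real assume \<eta>: "0 < \<eta>"
  then have \<eta>2: "0 < \<eta> / 2" by simp
  from ev[OF \<eta>2] elliptic_parabolic_error[OF B \<eta>2]
  show "\<forall>\<^sub>F (s, k) in nhds 0. u (t + s) (x + k) \<le> u t x + (l (1, 0) + p) * s + (jet_grad l + q) \<bullet> k
     + 1/2 * (((jet_hess B + X) *v k) \<bullet> k) + \<eta> * (\<bar>s\<bar> + (norm k)\<^sup>2)"
  proof eventually_elim
    case (elim z)
    obtain s k where z: "z = (s, k)" by (cases z)
    have "\<eta> / 2 * \<bar>s\<bar> \<le> \<eta> / 2 * (\<bar>s\<bar> + (norm k)\<^sup>2)" using \<eta> by (intro mult_left_mono) auto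
    moreover have "\<eta> * (\<bar>s\<bar> + (norm k)\<^sup>2) = \<eta> / 2 * (\<bar>s\<bar> + (norm k)\<^sup>2) + \<eta> / 2 * (\<bar>s\<bar> + (norm k)\<^sup>2)" by simp
    moreover have "((jet_hess B + X) *v k) \<bullet> k = (jet_hess B *v k) \<bullet> k + (X *v k) \<bullet> k"
      by (simp add: matrix_vector_mult_add_rdistrib inner_add_left)
    moreover have "(l (1, 0) + p) * s = l (1, 0) * s + p * s" "(jet_grad l + q) \<bullet> k = jet_grad l \<bullet> k + q \<bullet> k"
      by (simp_all add: distrib_right inner_add_left)
    ultimately have "u (t + s) (x + k) \<le> u t x + (l (1, 0) + p) * s + (jet_grad l + q) \<bullet> k
     + 1/2 * (((jet_hess B + X) *v k) \<bullet> k) + \<eta> * (\<bar>s\<bar> + (norm k)\<^sup>2)"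
      using elim jet_grad[OF l, of s k] unfolding z fst_conv snd_conv by linarith
    then show ?case unfolding z by simp
  qed
qed

text \<open>Composition with \<open>closest_point K\<close> extends the infimal convolution to the
  whole space without changing it on \<open>K\<close>. As the projection onto a convex set is
  nonexpansive, the extension is bounded and uniformly continuous, which \<open>avg_super\<close>
  requires globally.\<close>

lemma infconv_properties:
  fixes F :: "'a::euclidean_space \<Rightarrow> 'b::metric_space \<Rightarrow> real"
  assumes F: "continuous_on (K \<times> Y) (\<lambda>z. F (fst z) (snd z))"
    and K: "compact K" "convex K" "K \<noteq> {}" and Y: "compact Y" "Y \<noteq> {}"
  defines "w \<equiv> \<lambda>P. INF y\<in>Y. F (closest_point K P) y"
  shows "\<exists>y\<in>Y. w P = F (closest_point K P) y" "y \<in> Y \<Longrightarrow> w P \<le> F (closest_point K P) y"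
    "\<exists>N. \<forall>P. \<bar>w P\<bar> \<le> N"
    "0 < e \<Longrightarrow> \<exists>\<delta>>0. \<forall>z h. norm h \<le> \<delta> \<longrightarrow> \<bar>w (z + h) - w z\<bar> \<le> e"
    "continuous_on UNIV w"
proof -
  define \<pi> where "\<pi> = closest_point K"
  have \<pi>K: "\<pi> P \<in> K" for P unfolding \<pi>_def by (intro closest_point_in_set compact_imp_closed K)
  have att: "\<exists>y\<in>Y. w P = F (\<pi> P) y \<and> (\<forall>y'\<in>Y. w P \<le> F (\<pi> P) y')" for P
  proof -
    have "continuous_on Y (\<lambda>y. F (\<pi> P) y)"
    proof -
      have 1: "continuous_on Y (\<lambda>y. (\<pi> P, y))" by (intro continuous_on_Pair continuous_on_const continuous_on_id)
      have 2: "(\<lambda>y. (\<pi> P, y)) ` Y \<subseteq> K \<times> Y" using \<pi>K by auto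
      show ?thesis using continuous_on_compose2[OF F 1 2] by simp
    qed
    from continuous_attains_inf[OF Y this] obtain y where y: "y \<in> Y" "\<forall>y'\<in>Y. F (\<pi> P) y \<le> F (\<pi> P) y'" by blast
    have "w P = F (\<pi> P) y" unfolding w_def \<pi>_def[symmetric] by (rule cInf_eq_minimum) (use y in auto)
    then show ?thesis using y by auto
  qed
  show 1: "\<exists>y\<in>Y. w P = F (closest_point K P) y" for P using att[of P] unfolding \<pi>_def by blast
  show 2: "y \<in> Y \<Longrightarrow> w P \<le> F (closest_point K P) y" for P y using att[of P] unfolding \<pi>_def by blast
  have KY: "compact (K \<times> Y)" by (intro compact_Times K Y)
  show "\<exists>N. \<forall>P. \<bar>w P\<bar> \<le> N"
  proof -
    have "bounded ((\<lambda>z. F (fst z) (snd z)) ` (K \<times> Y))"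
      by (intro compact_imp_bounded compact_continuous_image F KY)
    then obtain N where N0: "\<forall>r\<in>(\<lambda>z. F (fst z) (snd z)) ` (K \<times> Y). norm r \<le> N" unfolding bounded_iff by blast
    have N: "\<bar>F (fst z) (snd z)\<bar> \<le> N" if "z \<in> K \<times> Y" for z using bspec[OF N0 imageI[OF that]] by simp
    have "\<bar>w P\<bar> \<le> N" for P
    proof -
      obtain y where "y \<in> Y" "w P = F (\<pi> P) y" using att[of P] by blast
      then show ?thesis using N[of "(\<pi> P, y)"] \<pi>K[of P] by simp
    qed
    then show ?thesis by blast
  qed
  show 4: "\<exists>\<delta>>0. \<forall>z h. norm h \<le> \<delta> \<longrightarrow> \<bar>w (z + h) - w z\<bar> \<le> e" if e: "0 < e" for e
  proof -
    have "uniformly_continuous_on (K \<times> Y) (\<lambda>z. F (fst z) (snd z))" by (rule compact_uniformly_continuous[OF F KY])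
    from this[unfolded uniformly_continuous_on_def, rule_format, OF e]
    obtain d where d: "0 < d" "\<And>z z'. z \<in> K \<times> Y \<Longrightarrow> z' \<in> K \<times> Y \<Longrightarrow> dist z' z < d \<Longrightarrow> dist (F (fst z') (snd z')) (F (fst z) (snd z)) < e"
      by blast
    have le: "w P \<le> w P' + e" if "dist P P' < d" for P P'
    proof -
      obtain y where y: "y \<in> Y" "w P' = F (\<pi> P') y" using att[of P'] by blast
      have "dist (\<pi> P) (\<pi> P') \<le> dist P P'" unfolding \<pi>_def using K by (intro closest_point_lipschitz compact_imp_closed)
      then have "dist (\<pi> P, y) (\<pi> P', y) < d" using that by (simp add: dist_Pair_Pair)
      from d(2)[OF _ _ this] have "dist (F (\<pi> P) y) (F (\<pi> P') y) < e" using \<pi>K y by auto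
      then show ?thesis using 2[OF y(1), of P] y unfolding \<pi>_def by (simp add: dist_real_def)
    qed
    have "\<bar>w (z + h) - w z\<bar> \<le> e" if "norm h \<le> d / 2" for z h
    proof -
      have "dist (z + h) z < d" "dist z (z + h) < d" using that d(1) by (auto simp: dist_norm)
      then show ?thesis using le[of "z + h" z] le[of z "z + h"] by linarith
    qed
    then show ?thesis using d(1) by (intro exI[of _ "d / 2"]) auto
  qed
  show "continuous_on UNIV w"
    unfolding continuous_on_iff
  proof (intro ballI allI impI)
    fix z :: 'a and e :: real assume "0 < e"
    then have "0 < e / 2" by simp
    from 4[OF this] obtain \<delta> where \<delta>: "0 < \<delta>" "\<And>z h. norm h \<le> \<delta> \<Longrightarrow> \<bar>w (z + h) - w z\<bar> \<le> e / 2" by blast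
    have "dist (w z') (w z) < e" if "dist z' z < \<delta>" for z'
      using \<delta>(2)[of "z' - z" z] that \<open>0 < e\<close> by (auto simp: dist_norm)
    then show "\<exists>d>0. \<forall>z'\<in>UNIV. dist z' z < d \<longrightarrow> dist (w z') (w z) < e" using \<delta>(1) by blast
  qed
qed

text \<open>
  The defect in the supersolution inequality when a jet of the infimal convolution at \<open>(t, x)\<close> is tested with
  \<open>A\<close> and \<open>\<beta>\<close> in place of the diffusion and drift coefficients at the minimising point \<open>y\<close>.
\<close>

definition (in hjb) frozen_err ::
  "real \<Rightarrow> real \<Rightarrow> (real \<Rightarrow> real^'n \<Rightarrow> real) \<Rightarrow> real^'n \<Rightarrow> real \<Rightarrow> real^'n \<Rightarrow> real^'n \<Rightarrow> real^'d^'n \<Rightarrow> real^'n \<Rightarrow> real^'k \<Rightarrow> real" where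
  "frozen_err \<epsilon> \<gamma> v y1 t x y A \<beta> c =
     (norm (A - \<sigma> t y c))\<^sup>2 / (2 * \<epsilon>) + \<gamma> * (norm (\<sigma> t y c))\<^sup>2
     + ((1 / \<epsilon>) *\<^sub>R (x - y)) \<bullet> (\<beta> - b t y c) + 2 * \<gamma> * (b t y c \<bullet> (y - y1))
     - g t y (v t y) (((1 / \<epsilon>) *\<^sub>R (x - y) - (2 * \<gamma>) *\<^sub>R (y - y1)) v* \<sigma> t y c) c"

context hjb begin

text \<open>The equation speaks only about points with a nonempty subjet. Near a point with
  \<open>v < h\<close>, minimising \<open>v\<close> plus a steep paraboloid produces such a point at
  which \<open>v < h\<close> still holds.\<close>

lemma supersolution_ge_obstacle:
  assumes v: "viscosity_supersolution T b \<sigma> g h \<Phi> U v" and t: "0 < t" "t < T"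
  shows "h t x \<le> v t x"
proof (rule ccontr)
  assume "\<not> h t x \<le> v t x"
  then have neg: "v t x < h t x" by simp
  define P where "P = (t, x)"
  have vc: "continuous_on ({0..T} \<times> UNIV) (\<lambda>z. v (fst z) (snd z))"
    using v unfolding viscosity_supersolution_def by (simp add: case_prod_unfold)
  have op: "open ({0<..<T} \<times> (UNIV :: (real^'n) set))" by (intro open_Times) auto
  have sub: "{0<..<T} \<times> UNIV \<subseteq> {0..T} \<times> (UNIV :: (real^'n) set)" by auto
  have "continuous_on ({0<..<T} \<times> UNIV) (\<lambda>z. h (fst z) (snd z) - v (fst z) (snd z))"
    by (intro continuous_on_diff continuous_on_subset[OF vc sub] continuous_on_subset[OF h_joint sub])
  then have "open ({0<..<T} \<times> UNIV \<inter> (\<lambda>z. h (fst z) (snd z) - v (fst z) (snd z)) -` {0<..})"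
    using op by (intro continuous_open_preimage) auto
  moreover have "P \<in> {0<..<T} \<times> UNIV \<inter> (\<lambda>z. h (fst z) (snd z) - v (fst z) (snd z)) -` {0<..}"
    using neg t by (simp add: P_def)
  ultimately obtain \<delta> where \<delta>: "0 < \<delta>" "cball P \<delta> \<subseteq> {0<..<T} \<times> UNIV \<inter> (\<lambda>z. h (fst z) (snd z) - v (fst z) (snd z)) -` {0<..}"
    unfolding open_contains_cball by blast
  have \<delta>T: "cball P \<delta> \<subseteq> {0..T} \<times> UNIV" using \<delta>(2) sub by blast
  have fc: "continuous_on (cball P \<delta>) (\<lambda>z. v (fst z) (snd z))" by (rule continuous_on_subset[OF vc \<delta>T])
  have "bounded ((\<lambda>z. v (fst z) (snd z)) ` cball P \<delta>)" by (intro compact_imp_bounded compact_continuous_image fc compact_cball)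
  then obtain N where Nb: "\<forall>r\<in>(\<lambda>z. v (fst z) (snd z)) ` cball P \<delta>. norm r \<le> N" unfolding bounded_iff by blast
  have N: "\<bar>v (fst z) (snd z)\<bar> \<le> N" if "z \<in> cball P \<delta>" for z using bspec[OF Nb imageI[OF that]] by simp
  have N0: "0 \<le> N" using N[of P] \<delta>(1) by auto
  \<comment> \<open>\<open>A * \<delta>^2\<close> exceeds \<open>2 * N\<close>, hence the
    oscillation of \<open>v\<close> on the ball; this keeps the minimiser off the boundary.\<close>
  define A where "A = (2 * N + 1) / \<delta>\<^sup>2"
  have A: "0 < A" using N0 \<delta>(1) by (simp add: A_def)
  have "continuous_on (cball P \<delta>) (\<lambda>z. v (fst z) (snd z) + A * (norm (z - P))\<^sup>2)" by (intro continuous_intros fc)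
  moreover have "cball P \<delta> \<noteq> {}" using \<delta>(1) by simp
  ultimately obtain Q where Q: "Q \<in> cball P \<delta>"
    "\<And>z. z \<in> cball P \<delta> \<Longrightarrow> v (fst Q) (snd Q) + A * (norm (Q - P))\<^sup>2 \<le> v (fst z) (snd z) + A * (norm (z - P))\<^sup>2"
    using continuous_attains_inf[OF compact_cball] by blast
  have "v (fst Q) (snd Q) + A * (norm (Q - P))\<^sup>2 \<le> v (fst P) (snd P)" using Q(2)[of P] \<delta>(1) by simp
  then have "A * (norm (Q - P))\<^sup>2 < 2 * N + 1" using N[OF Q(1)] N[of P] \<delta>(1) by auto
  then have "(norm (Q - P))\<^sup>2 < \<delta>\<^sup>2" 
  proof -
    assume *: "A * (norm (Q - P))\<^sup>2 < 2 * N + 1"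
    have "2 * N + 1 = A * \<delta>\<^sup>2" using \<delta>(1) by (simp add: A_def)
    with * show ?thesis using A by (simp only: mult_less_cancel_left_pos)
  qed
  then have Qd: "norm (Q - P) < \<delta>" using \<delta>(1) power2_less_imp_less[of "norm (Q - P)" \<delta>] by simp
  define l where "l h = - (2 * A) * ((Q - P) \<bullet> h)" for h
  define B where "B h k = - (2 * A) * (h \<bullet> k)" for h k :: "real \<times> (real^'n)"
  have "(l (1, 0), jet_grad l, jet_hess B) \<in> parabolic_subjet v (fst Q) (snd Q)"
  proof (rule subjet_of_elliptic)
    show "linear l" by (rule linearI) (simp_all add: l_def inner_add_right algebra_simps)
    show "bilinear B" unfolding bilinear_def B_def by (auto intro!: linearI simp: inner_add_right inner_add_left algebra_simps)
    show "B h k = B k h" for h k by (simp add: B_def inner_commute)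
    fix \<eta> :: real assume \<eta>: "0 < \<eta>"
    show "\<forall>\<^sub>F h in nhds 0. v (fst Q) (snd Q) + l h + 1/2 * B h h - \<eta> * (norm h)\<^sup>2 \<le> v (fst Q + fst h) (snd Q + snd h)"
    proof (rule eventually_nhds_0_norm)
      show "0 < \<delta> - norm (Q - P)" using Qd by simp
      fix h :: "real \<times> (real^'n)" assume h: "norm h \<le> \<delta> - norm (Q - P)"
      have e: "Q + h - P = (Q - P) + h" by simp
      have "norm (Q + h - P) \<le> \<delta>" unfolding e using norm_triangle_ineq[of "Q - P" h] h by linarith
      then have "Q + h \<in> cball P \<delta>" by (simp add: dist_norm norm_minus_commute)
      from Q(2)[OF this] have "v (fst Q) (snd Q) + A * (norm (Q - P))\<^sup>2 \<le> v (fst Q + fst h) (snd Q + snd h) + A * (norm ((Q - P) + h))\<^sup>2"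
        unfolding e by simp
      moreover have "A * (norm ((Q - P) + h))\<^sup>2 = A * (norm (Q - P))\<^sup>2 + 2 * A * ((Q - P) \<bullet> h) + A * (h \<bullet> h)"
        unfolding norm_add_sq by (simp add: algebra_simps dot_square_norm)
      moreover have "0 \<le> \<eta> * (norm h)\<^sup>2" using \<eta> by simp
      ultimately show "v (fst Q) (snd Q) + l h + 1/2 * B h h - \<eta> * (norm h)\<^sup>2 \<le> v (fst Q + fst h) (snd Q + snd h)"
        unfolding l_def B_def by simp
    qed
  qed
  moreover have "Q \<in> {0<..<T} \<times> UNIV \<inter> (\<lambda>z. h (fst z) (snd z) - v (fst z) (snd z)) -` {0<..}" using Q(1) \<delta>(2) by blast
  then have "0 < fst Q" "fst Q < T" "v (fst Q) (snd Q) < h (fst Q) (snd Q)" by auto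
  moreover obtain c where "c \<in> U" using U(2) by blast
  ultimately show False using supersolution_ineq(2)[OF v, of "fst Q"] by (meson not_le)
qed

lemma
  assumes \<epsilon>: "0 < \<epsilon>"
    and w0: "w (t, x) = v t y + (norm (x - y))\<^sup>2 / (2 * \<epsilon>) + \<gamma> * (norm (y - y1))\<^sup>2"
    and w1: "\<forall>\<^sub>F (h, k') in nhds 0.
      w ((t, x) + h) \<le> v (t + fst h) (y + k') + (norm (x + snd h - (y + k')))\<^sup>2 / (2 * \<epsilon>) + \<gamma> * (norm (y + k' - y1))\<^sup>2"
  shows infconv_gradient: "((1 / \<epsilon>) *\<^sub>R (x - y)) \<bullet> k \<le> C \<Longrightarrow> visc_super (0, k) (\<lambda>i::'d. 0) C w (t, x)"
    and infconv_frozen: "viscosity_supersolution T b \<sigma> g h \<Phi> U v \<Longrightarrow> 0 < t \<Longrightarrow> t < T \<Longrightarrow> c \<in> U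
      \<Longrightarrow> frozen_err \<epsilon> \<gamma> v y1 t x y A \<beta> c \<le> C \<Longrightarrow> visc_super (1, \<beta>) (\<lambda>i. (0, column i A)) C w (t, x)"
proof -
  assume C: "((1 / \<epsilon>) *\<^sub>R (x - y)) \<bullet> k \<le> C"
  show "visc_super (0, k) (\<lambda>i::'d. 0) C w (t, x)" unfolding visc_super_def
  proof (intro allI impI)
    fix l B
    assume *: "linear l" "bilinear B" "\<forall>h k. B h k = B k h"
      "\<forall>\<eta>>0. \<forall>\<^sub>F h in nhds 0. w (t, x) + l h + 1/2 * B h h - \<eta> * (norm h)\<^sup>2 \<le> w ((t, x) + h)"
    have "jet_grad l = (1 / \<epsilon>) *\<^sub>R (x - y)"
      by (rule infconv_jet(1)[OF \<epsilon> zero_less_one w0 w1 *(1,2)]) (use * in auto)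
    then show "gen (0, k) (\<lambda>i::'d. 0) l B \<le> C"
      using C jet_grad[OF *(1), of 0 k] bilinear_lzero[OF *(2)] by (simp add: gen_def)
  qed
next
  assume v: "viscosity_supersolution T b \<sigma> g h \<Phi> U v" and t: "0 < t" "t < T" and c: "c \<in> U"
    and C: "frozen_err \<epsilon> \<gamma> v y1 t x y A \<beta> c \<le> C"
  show "visc_super (1, \<beta>) (\<lambda>i. (0, column i A)) C w (t, x)" unfolding visc_super_def
  proof (intro allI impI)
    fix l B
    assume *: "linear l" "bilinear B" "\<forall>h k. B h k = B k h"
      "\<forall>\<eta>>0. \<forall>\<^sub>F h in nhds 0. w (t, x) + l h + 1/2 * B h h - \<eta> * (norm h)\<^sup>2 \<le> w ((t, x) + h)"
    define S where "S = \<sigma> t y c"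
    define q where "q = (1 / \<epsilon>) *\<^sub>R (x - y)"
    have q: "jet_grad l = q" unfolding q_def
      by (rule infconv_jet(1)[OF \<epsilon> zero_less_one w0 w1 *(1,2)]) (use * in auto)
    \<comment> \<open>The loss caused by \<open>\<kappa>\<close> is proportional to
      \<open>(norm A)^2\<close> and disappears at the end as \<open>\<kappa>\<close> tends to
      0.\<close>
    have le: "gen (1, \<beta>) (\<lambda>i. (0, column i A)) l B \<le> C + \<kappa> * (norm A)\<^sup>2" if \<kappa>: "0 < \<kappa>" for \<kappa>
    proof -
      have "\<exists>Y. (l (1, 0), jet_grad l - (2 * \<gamma>) *\<^sub>R (y - y1), Y) \<in> parabolic_subjet v t y \<and>
        (\<forall>\<xi> \<zeta>. B (0, \<xi>) (0, \<xi>) - \<kappa> * (norm \<xi>)\<^sup>2 \<le> (norm (\<xi> - \<zeta>))\<^sup>2 / \<epsilon> + (Y *v \<zeta>) \<bullet> \<zeta> + 2 * \<gamma> * (norm \<zeta>)\<^sup>2)"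
        by (rule infconv_jet(2)[OF \<epsilon> \<kappa> w0 w1 *(1,2)]) (use * in auto)
      then obtain Y where Y: "(l (1, 0), q - (2 * \<gamma>) *\<^sub>R (y - y1), Y) \<in> parabolic_subjet v t y"
        "\<And>\<xi> \<zeta>. B (0, \<xi>) (0, \<xi>) - \<kappa> * (norm \<xi>)\<^sup>2 \<le> (norm (\<xi> - \<zeta>))\<^sup>2 / \<epsilon> + (Y *v \<zeta>) \<bullet> \<zeta> + 2 * \<gamma> * (norm \<zeta>)\<^sup>2"
        unfolding q by blast
      have "(\<Sum>i\<in>UNIV. B (0, column i A) (0, column i A)) - \<kappa> * (norm A)\<^sup>2
          = (\<Sum>i\<in>UNIV. B (0, column i A) (0, column i A) - \<kappa> * (norm (column i A))\<^sup>2)"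
        by (simp add: norm_matrix_sq sum_subtractf sum_distrib_left)
      also have "\<dots> \<le> (\<Sum>i\<in>UNIV. (norm (column i (A - S)))\<^sup>2 / \<epsilon> + (Y *v column i S) \<bullet> column i S + 2 * \<gamma> * (norm (column i S))\<^sup>2)"
        unfolding column_diff by (intro sum_mono Y(2))
      also have "\<dots> = (norm (A - S))\<^sup>2 / \<epsilon> + trace ((S ** transpose S) ** Y) + 2 * \<gamma> * (norm S)\<^sup>2"
        by (simp add: norm_matrix_sq trace_covariance sum.distrib sum_distrib_left sum_divide_distrib)
      finally have 1: "(\<Sum>i\<in>UNIV. B (0, column i A) (0, column i A)) - \<kappa> * (norm A)\<^sup>2
         \<le> (norm (A - S))\<^sup>2 / \<epsilon> + trace ((S ** transpose S) ** Y) + 2 * \<gamma> * (norm S)\<^sup>2" .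
      have 2: "l (1, 0) + (1/2 * trace ((S ** transpose S) ** Y) + b t y c \<bullet> (q - (2 * \<gamma>) *\<^sub>R (y - y1))
         + g t y (v t y) ((q - (2 * \<gamma>) *\<^sub>R (y - y1)) v* S) c) \<le> 0"
        using supersolution_ineq(1)[OF v t Y(1) c] unfolding hamil_def S_def .
      have 3: "gen (1, \<beta>) (\<lambda>i. (0, column i A)) l B = l (1, 0) + q \<bullet> \<beta> + 1/2 * (\<Sum>i\<in>UNIV. B (0, column i A) (0, column i A))"
        unfolding gen_def using jet_grad[OF *(1), of 1 \<beta>] q by simp
      have 4: "b t y c \<bullet> (q - (2 * \<gamma>) *\<^sub>R (y - y1)) = q \<bullet> b t y c - 2 * \<gamma> * (b t y c \<bullet> (y - y1))"
        by (simp add: inner_diff_right inner_commute)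
      have 5: "frozen_err \<epsilon> \<gamma> v y1 t x y A \<beta> c = 1/2 * ((norm (A - S))\<^sup>2 / \<epsilon>) + \<gamma> * (norm S)\<^sup>2
         + (q \<bullet> \<beta> - q \<bullet> b t y c) + 2 * \<gamma> * (b t y c \<bullet> (y - y1)) - g t y (v t y) ((q - (2 * \<gamma>) *\<^sub>R (y - y1)) v* S) c"
        unfolding frozen_err_def S_def[symmetric] q_def[symmetric] by (simp add: inner_diff_right)
      have "0 \<le> \<kappa> * (norm A)\<^sup>2" using \<kappa> by simp
      then show ?thesis using 1 2 C unfolding 3 4 5 by linarith
    qed
    show "gen (1, \<beta>) (\<lambda>i. (0, column i A)) l B \<le> C"
    proof (rule field_le_epsilon)
      fix e :: real assume e: "0 < e"
      define n where "n = (norm A)\<^sup>2 + 1"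
      have n: "0 < n" by (simp add: n_def add_nonneg_pos)
      have "e / n * (norm A)\<^sup>2 \<le> e / n * n" using e n by (intro mult_left_mono) (auto simp: n_def)
      then show "gen (1, \<beta>) (\<lambda>i. (0, column i A)) l B \<le> C + e" using le[of "e / n"] e n by simp
    qed
  qed
qed

end

section \<open>The inequality at a doubling point\<close>

lemma hamil_add:
  "hamil b \<sigma> g t x y q (X + X') c = hamil b \<sigma> g t x y q X' c + 1/2 * trace ((\<sigma> t x c ** transpose (\<sigma> t x c)) ** X)"
  unfolding hamil_def trace_covariance
  by (simp add: matrix_vector_mult_add_rdistrib inner_add_left sum.distrib)

lemma cubic_le_parabolic:
  fixes C \<eta> :: real
  assumes "0 \<le> C" "0 < \<eta>"
  shows "\<forall>\<^sub>F h in nhds (0 :: real \<times> 'a::real_normed_vector). C * norm h ^ 3 \<le> \<eta> * (\<bar>fst h\<bar> + (norm (snd h))\<^sup>2)"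
proof -
  have "\<forall>\<^sub>F h in nhds (0 :: real \<times> 'a). norm h \<le> \<eta> / (C + 1)"
    by (rule eventually_nhds_0_norm[of "\<eta> / (C + 1)"]) (use assms in auto)
  with eventually_norm_sq_parabolic show ?thesis
  proof eventually_elim
    case (elim h)
    have "(C + 1) * norm h \<le> \<eta>" using elim(2) assms by (simp add: le_divide_eq mult.commute)
    moreover have "(C + 1) * norm h = C * norm h + norm h" by (simp add: distrib_right)
    ultimately have "C * norm h \<le> \<eta>" using norm_ge_zero[of h] by linarith
    from mult_right_mono[OF this, of "(norm h)\<^sup>2"] have "C * norm h ^ 3 \<le> \<eta> * (norm h)\<^sup>2"
      by (simp add: power3_eq_cube power2_eq_square mult_ac)
    also have "\<dots> \<le> \<eta> * (\<bar>fst h\<bar> + (norm (snd h))\<^sup>2)" using elim(1) assms by (intro mult_left_mono) auto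
    finally show ?case .
  qed
qed

lemma bilinear_add_fun:
  "bilinear B \<Longrightarrow> bilinear B' \<Longrightarrow> bilinear (\<lambda>h k. B h k + B' h k)"
  unfolding bilinear_def by (auto intro!: linear_compose_add)

context hjb begin

text \<open>Both equations at the doubling point, subtracted for one common control. The drift along
  \<open>(x1 - y1) / \<epsilon>\<close> occurs in \<open>hamil\<close> and again in
  \<open>frozen_err\<close>; the subtracted inner product removes one copy.\<close>

lemma doubling_inequality:
  fixes u v \<psi> \<psi>t :: "real \<Rightarrow> real^'n \<Rightarrow> real" and \<psi>q :: "real \<Rightarrow> real^'n \<Rightarrow> real^'n" and \<psi>X :: "real \<Rightarrow> real^'n \<Rightarrow> real^'n^'n"
  assumes sub: "viscosity_subsolution T b \<sigma> g h \<Phi> U u" and super: "viscosity_supersolution T b \<sigma> g h \<Phi> U v"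
    and \<epsilon>: "0 < \<epsilon>" and \<gamma>: "0 < \<gamma>" and \<eta>: "0 < \<eta>"
    and K: "compact K" "convex K" "K \<subseteq> {0<..<T} \<times> UNIV" "(t1, x1) \<in> interior K"
    and Y: "compact Y" "y1 \<in> interior Y"
    and max: "\<And>t x y. (t, x) \<in> K \<Longrightarrow> y \<in> Y \<Longrightarrow> u t x - v t y - (norm (x - y))\<^sup>2 / (2 * \<epsilon>) - \<psi> t x
        \<le> u t1 x1 - v t1 y1 - (norm (x1 - y1))\<^sup>2 / (2 * \<epsilon>) - \<psi> t1 x1"
    and obst: "h t1 x1 < u t1 x1"
    and \<psi>c: "continuous_on K (\<lambda>z. \<psi> (fst z) (snd z))" "continuous_on K (\<lambda>z. \<psi>t (fst z) (snd z))"
      "continuous_on K (\<lambda>z. \<psi>q (fst z) (snd z))" "continuous_on K (\<lambda>z. \<psi>X (fst z) (snd z))"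
    and \<psi>s: "\<And>t x. transpose (\<psi>X t x) = \<psi>X t x"
    and \<psi>j: "\<And>t x \<eta>. (t, x) \<in> K \<Longrightarrow> 0 < \<eta> \<Longrightarrow> \<forall>\<^sub>F h in nhds 0. \<psi> (t + fst h) (x + snd h) \<le> \<psi> t x
        + (\<psi>t t x * fst h + \<psi>q t x \<bullet> snd h + 1/2 * ((\<psi>X t x *v snd h) \<bullet> snd h)) + \<eta> * (\<bar>fst h\<bar> + (norm (snd h))\<^sup>2)"
  shows "\<exists>c\<in>U. - \<eta> \<le> \<psi>t t1 x1
     + hamil b \<sigma> g t1 x1 (u t1 x1) ((1 / \<epsilon>) *\<^sub>R (x1 - y1) + \<psi>q t1 x1) (\<psi>X t1 x1 + (2 * \<gamma>) *\<^sub>R mat 1) c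
     - ((1 / \<epsilon>) *\<^sub>R (x1 - y1)) \<bullet> b t1 x1 c
     + frozen_err \<epsilon> \<gamma> v y1 t1 x1 y1 (\<sigma> t1 x1 c) (b t1 x1 c) c"
proof (rule ccontr)
  assume neg: "\<not> ?thesis"
  define P1 where "P1 = (t1, x1)"
  define q0 where "q0 = (1 / \<epsilon>) *\<^sub>R (x1 - y1)"
  \<comment> \<open>The last term makes \<open>y1\<close> the strict minimiser at \<open>P1\<close>,
    so that minimisers for nearby \<open>P\<close> stay close to \<open>y1\<close>.\<close>
  define F where "F P y = v (fst P) y + (norm (snd P - y))\<^sup>2 / (2 * \<epsilon>) + \<gamma> * (norm (y - y1))\<^sup>2" for P :: "real \<times> (real^'n)" and y
  define w where "w P = (INF y\<in>Y. F (closest_point K P) y)" for P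
  \<comment> \<open>Here \<open>s = ((P, y), P')\<close>: the jet of \<open>w\<close> is taken at
    \<open>P\<close> with minimising point \<open>y\<close>, while the coefficients are frozen at
    \<open>P'\<close>.\<close>
  define f1 where "f1 s c = frozen_err \<epsilon> \<gamma> v y1 (fst (fst (fst s))) (snd (fst (fst s))) (snd (fst s))
      (\<sigma> (fst (snd s)) (snd (snd s)) c) (b (fst (snd s)) (snd (snd s)) c) c"
    for s :: "((real \<times> (real^'n)) \<times> (real^'n)) \<times> (real \<times> (real^'n))" and c
  \<comment> \<open>Here \<open>s = (P, q)\<close>: what the subsolution inequality at
    \<open>P\<close> leaves once the generator of the mollification, whose spatial gradient is
    \<open>q\<close>, is split off. The terms with \<open>2 * \<gamma>\<close> are the jet of the
    penalty centred at \<open>P1\<close>.\<close>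
  define f2 where "f2 s c = (\<psi>t (fst (fst s)) (snd (fst s)) + 2 * \<gamma> * (fst (fst s) - t1))
     + hamil b \<sigma> g (fst (fst s)) (snd (fst s)) (u (fst (fst s)) (snd (fst s)))
        (snd s + (\<psi>q (fst (fst s)) (snd (fst s)) + (2 * \<gamma>) *\<^sub>R (snd (fst s) - x1)))
        (\<psi>X (fst (fst s)) (snd (fst s)) + (2 * \<gamma>) *\<^sub>R mat 1) c - snd s \<bullet> b (fst (fst s)) (snd (fst s)) c"
    for s :: "(real \<times> (real^'n)) \<times> (real^'n)" and c
  have neg1: "f2 (P1, q0) c + f1 ((P1, y1), P1) c < - \<eta>" if "c \<in> U" for c
    using neg that unfolding f1_def f2_def P1_def q0_def by (auto simp: not_le)
  have KT: "fst z \<in> {0..T}" "0 < fst z" "fst z < T" if "z \<in> K" for z using K(3) that by (auto simp: mem_Times_iff)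
  have K0: "K \<noteq> {}" and P1K: "P1 \<in> K" using K(4) interior_subset by (auto simp: P1_def)
  have Y0: "Y \<noteq> {}" and y1Y: "y1 \<in> Y" using Y(2) interior_subset by auto
  have uc0: "continuous_on ({0..T} \<times> UNIV) (\<lambda>z. u (fst z) (snd z))"
    using sub unfolding viscosity_subsolution_def by (simp add: case_prod_unfold)
  have vc0: "continuous_on ({0..T} \<times> UNIV) (\<lambda>z. v (fst z) (snd z))"
    using super unfolding viscosity_supersolution_def by (simp add: case_prod_unfold)
  have comp: "continuous_on S (\<lambda>z. f (t z) (x z))"
    if "continuous_on ({0..T} \<times> UNIV) (\<lambda>z. f (fst z) (snd z))"
      "continuous_on S t" "continuous_on S x" "\<And>z. z \<in> S \<Longrightarrow> t z \<in> {0..T}"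
    for f :: "real \<Rightarrow> real^'n \<Rightarrow> real" and S :: "'z::topological_space set" and t x
  proof -
    have 1: "continuous_on S (\<lambda>z. (t z, x z))" by (intro continuous_on_Pair that)
    have 2: "(\<lambda>z. (t z, x z)) ` S \<subseteq> {0..T} \<times> UNIV" using that(4) by auto
    show ?thesis using continuous_on_compose2[OF that(1) 1 2] by simp
  qed
  have uK: "continuous_on K (\<lambda>z. u (fst z) (snd z))"
    by (rule continuous_on_subset[OF uc0]) (use KT in \<open>auto simp: mem_Times_iff\<close>)
  have f1c: "continuous_on (((K \<times> Y) \<times> K) \<times> U) (\<lambda>z. f1 (fst z) (snd z))"
    unfolding f1_def frozen_err_def
    by (intro continuous_intros comp[OF vc0]) (use KT \<epsilon> in auto)
  have f2c: "continuous_on ((K \<times> UNIV) \<times> U) (\<lambda>z. f2 (fst z) (snd z))"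
  proof -
    have p: "continuous_on ((K \<times> (UNIV :: (real^'n) set)) \<times> U) (\<lambda>z. fst (fst z))" by (intro continuous_intros)
    have sub': "(\<lambda>z. fst (fst z)) ` ((K \<times> (UNIV :: (real^'n) set)) \<times> U) \<subseteq> K" by auto
    note c = continuous_on_compose2[OF _ p sub']
    show ?thesis unfolding f2_def
      by (intro continuous_intros hamil_continuous c[OF \<psi>c(2)] c[OF \<psi>c(3)] c[OF \<psi>c(4)] c[OF uK]) (use KT in auto)
  qed
  have Fc: "continuous_on (K \<times> Y) (\<lambda>z. F (fst z) (snd z))"
    unfolding F_def by (intro continuous_intros comp[OF vc0]) (use KT \<epsilon> in auto)
  note wp = infconv_properties[OF Fc K(1,2) K0 Y(1) Y0, folded w_def]
  have cpK: "closest_point K P = P" if "P \<in> K" for P by (rule closest_point_self[OF that])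
  have watt: "\<exists>y\<in>Y. w P = F P y" if "P \<in> K" for P using wp(1)[of P] cpK[OF that] by simp
  have wle: "w P \<le> F P y" if "P \<in> K" "y \<in> Y" for P y using wp(2)[OF that(2), of P] cpK[OF that(1)] by simp
  obtain N where wN: "\<And>P. \<bar>w P\<bar> \<le> N" using wp(3) by blast
  define \<Theta> where "\<Theta> = u t1 x1 - v t1 y1 - (norm (x1 - y1))\<^sup>2 / (2 * \<epsilon>) - \<psi> t1 x1"
  \<comment> \<open>The gap below the doubled maximum after minimisation over \<open>y\<close>:
    nonnegative on \<open>K\<close>, zero at \<open>P1\<close>, and an upper bound for
    \<open>\<gamma> * (norm (y - y1))^2\<close>.\<close>
  define D where "D P = w P - u (fst P) (snd P) + \<psi> (fst P) (snd P) + \<Theta>" for P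
  have Dy: "\<gamma> * (norm (y - y1))\<^sup>2 \<le> D P" if "P \<in> K" "y \<in> Y" "w P = F P y" for P y
    using max[of "fst P" "snd P" y] that unfolding D_def \<Theta>_def that(3) F_def by simp
  have D0: "0 \<le> D P" if P: "P \<in> K" for P
  proof -
    obtain y where "y \<in> Y" "w P = F P y" using watt[OF P] by blast
    moreover have "0 \<le> \<gamma> * (norm (y - y1))\<^sup>2" using \<gamma> by simp
    ultimately show ?thesis using Dy[OF P, of y] by linarith
  qed
  have w1: "w P1 \<le> v t1 y1 + (norm (x1 - y1))\<^sup>2 / (2 * \<epsilon>)" using wle[OF P1K y1Y] by (simp add: F_def P1_def)
  have D1: "D P1 \<le> 0" using w1 unfolding D_def \<Theta>_def by (simp add: P1_def)
  have Dc: "continuous_on K D" unfolding D_def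
    by (intro continuous_intros uK \<psi>c continuous_on_subset[OF wp(5)]) auto
  from tube[OF f1c U(1), of "((P1, y1), P1)" "\<eta> / 4"] P1K y1Y \<eta> obtain \<delta>1 where \<delta>1: "0 < \<delta>1"
    "\<And>s c. s \<in> (K \<times> Y) \<times> K \<Longrightarrow> dist s ((P1, y1), P1) < \<delta>1 \<Longrightarrow> c \<in> U \<Longrightarrow> f1 s c < f1 ((P1, y1), P1) c + \<eta> / 4" by auto
  from tube[OF f2c U(1), of "(P1, q0)" "\<eta> / 4"] P1K \<eta> obtain \<delta>2 where \<delta>2: "0 < \<delta>2"
    "\<And>s c. s \<in> K \<times> UNIV \<Longrightarrow> dist s (P1, q0) < \<delta>2 \<Longrightarrow> c \<in> U \<Longrightarrow> f2 s c < f2 (P1, q0) c + \<eta> / 4" by auto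
  obtain rY where rY: "0 < rY" "ball y1 rY \<subseteq> Y" using Y(2) by (meson mem_interior)
  obtain rK where rK: "0 < rK" "ball P1 rK \<subseteq> K" using K(4) unfolding P1_def by (meson mem_interior)
  \<comment> \<open>Thirds of \<open>\<delta>1\<close> go to \<open>P\<close>, \<open>y\<close> and
    \<open>P'\<close>; sixths of \<open>\<epsilon> * \<delta>2\<close> go to \<open>x\<close> and
    \<open>y\<close>, so that \<open>(x - y) / \<epsilon>\<close> moves by at most
    \<open>\<delta>2 / 3\<close>.\<close>
  define \<rho> where "\<rho> = Min {rY, \<delta>1 / 3, \<epsilon> * \<delta>2 / 6}"
  have \<rho>: "0 < \<rho>" "\<rho> \<le> rY" "\<rho> \<le> \<delta>1 / 3" "\<rho> \<le> \<epsilon> * \<delta>2 / 6" using rY \<delta>1 \<delta>2 \<epsilon> by (auto simp: \<rho>_def)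
  have "0 < \<gamma> * \<rho>\<^sup>2" using \<gamma> \<rho> by simp
  from Dc[unfolded continuous_on_iff, rule_format, OF P1K this] obtain rD where rD: "0 < rD"
    "\<And>P. P \<in> K \<Longrightarrow> dist P P1 < rD \<Longrightarrow> dist (D P) (D P1) < \<gamma> * \<rho>\<^sup>2" by blast
  have huc: "continuous_on K (\<lambda>z. u (fst z) (snd z) - h (fst z) (snd z))"
    by (intro continuous_intros uK continuous_on_subset[OF h_joint]) (use KT in \<open>auto simp: mem_Times_iff\<close>)
  have "0 < u t1 x1 - h t1 x1" using obst by simp
  from huc[unfolded continuous_on_iff, rule_format, OF P1K this] obtain ru where ru: "0 < ru"
    "\<And>P. P \<in> K \<Longrightarrow> dist P P1 < ru \<Longrightarrow> dist (u (fst P) (snd P) - h (fst P) (snd P)) (u (fst P1) (snd P1) - h (fst P1) (snd P1)) < u t1 x1 - h t1 x1"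
    by blast
  define r where "r = Min {rK, rD, ru, \<delta>1 / 3, \<delta>2 / 3, \<epsilon> * \<delta>2 / 6}"
  have r: "0 < r" "r \<le> rK" "r \<le> rD" "r \<le> ru" "r \<le> \<delta>1 / 3" "r \<le> \<delta>2 / 3" "r \<le> \<epsilon> * \<delta>2 / 6"
    using rK rD ru \<delta>1 \<delta>2 \<epsilon> by (auto simp: r_def)
  have BK: "P \<in> K" if "dist P P1 < r" for P using rK(2) r(2) that by (auto simp: dist_commute)
  have hu: "h (fst P) (snd P) < u (fst P) (snd P)" if "dist P P1 < r" for P
    using ru(2)[OF BK[OF that]] that r by (auto simp: dist_real_def P1_def)
  have miny: "norm (y - y1) < \<rho>" if "dist P P1 < r" "y \<in> Y" "w P = F P y" for P y
  proof -
    have "dist (D P) (D P1) < \<gamma> * \<rho>\<^sup>2" using rD(2)[OF BK[OF that(1)]] that r by auto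
    then have "D P < \<gamma> * \<rho>\<^sup>2" using D1 by (auto simp: dist_real_def)
    then have "\<gamma> * (norm (y - y1))\<^sup>2 < \<gamma> * \<rho>\<^sup>2" using Dy[OF BK[OF that(1)] that(2,3)] by linarith
    then have "(norm (y - y1))\<^sup>2 < \<rho>\<^sup>2" using \<gamma> by (simp only: mult_less_cancel_left_pos)
    then show ?thesis using \<rho> power2_less_imp_less[of "norm (y - y1)" \<rho>] by simp
  qed
  \<comment> \<open>Near the minimising point all points still belong to \<open>Y\<close>, so
    \<open>w\<close> at moved arguments stays below \<open>F\<close>: the touching condition of
    \<open>infconv_jet\<close>.\<close>
  have touch: "\<exists>y. y \<in> Y \<and> norm (y - y1) < \<rho> \<and>
      w (t, x) = v t y + (norm (x - y))\<^sup>2 / (2 * \<epsilon>) + \<gamma> * (norm (y - y1))\<^sup>2 \<and>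
      (\<forall>\<^sub>F (h, k') in nhds 0. w ((t, x) + h) \<le> v (t + fst h) (y + k') + (norm (x + snd h - (y + k')))\<^sup>2 / (2 * \<epsilon>) + \<gamma> * (norm (y + k' - y1))\<^sup>2)"
    if P: "dist (t, x) P1 < r" for t x
  proof -
    obtain y where y: "y \<in> Y" "w (t, x) = F (t, x) y" using watt[OF BK[OF P]] by blast
    have y\<rho>: "norm (y - y1) < \<rho>" using miny[OF P y] .
    have "\<forall>\<^sub>F (h, k') in nhds 0. w ((t, x) + h) \<le> F ((t, x) + h) (y + k')"
      unfolding eventually_nhds_metric
    proof (intro exI conjI allI impI)
      show "0 < min (r - dist (t, x) P1) (\<rho> - norm (y - y1))" using P y\<rho> by simp
      fix z :: "(real \<times> (real^'n)) \<times> (real^'n)" assume z: "dist z 0 < min (r - dist (t, x) P1) (\<rho> - norm (y - y1))"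
      obtain h k where hk: "z = (h, k)" by (cases z)
      have n: "norm h < r - dist (t, x) P1" "norm k < \<rho> - norm (y - y1)"
        using z norm_fst_le[of h k] norm_snd_le[of k h] unfolding hk by auto
      have "dist ((t, x) + h) P1 \<le> dist ((t, x) + h) (t, x) + dist (t, x) P1" by (rule dist_triangle)
      also have "dist ((t, x) + h) (t, x) = norm h" by (metis add_diff_cancel_left' dist_norm)
      finally have "dist ((t, x) + h) P1 < r" using n by linarith
      moreover have "y + k \<in> Y"
      proof -
        have "norm ((y - y1) + k) < \<rho>" using norm_triangle_ineq[of "y - y1" k] n by linarith
        moreover have "dist y1 (y + k) = norm ((y - y1) + k)" by (metis add_diff_eq diff_add_eq dist_commute dist_norm)
        ultimately have "y + k \<in> ball y1 rY" using \<rho> by simp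
        then show ?thesis using rY by blast
      qed
      ultimately show "case z of (h, k') \<Rightarrow> w ((t, x) + h) \<le> F ((t, x) + h) (y + k')"
        unfolding hk by (simp only: prod.case) (rule wle[OF BK])
    qed
    then show ?thesis using y y\<rho> unfolding F_def by (intro exI[of _ y]) simp
  qed
  have V1: "visc_super (1, b (fst P') (snd P') c) (\<lambda>i. (0, column i (\<sigma> (fst P') (snd P') c))) (f1 ((P1, y1), P1) c + \<eta> / 4) w P"
    if P: "dist P P1 < r" "dist P' P1 < r" and c: "c \<in> U" for P P' c
  proof -
    obtain t x where tx: "P = (t, x)" by (cases P)
    obtain y where y: "y \<in> Y" "norm (y - y1) < \<rho>"
      and w0: "w (t, x) = v t y + (norm (x - y))\<^sup>2 / (2 * \<epsilon>) + \<gamma> * (norm (y - y1))\<^sup>2"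
      and w1: "\<forall>\<^sub>F (h, k') in nhds 0. w ((t, x) + h) \<le> v (t + fst h) (y + k') + (norm (x + snd h - (y + k')))\<^sup>2 / (2 * \<epsilon>) + \<gamma> * (norm (y + k' - y1))\<^sup>2"
      using touch P(1) unfolding tx by blast
    have "dist ((P, y), P') ((P1, y1), P1) \<le> dist (P, y) (P1, y1) + dist P' P1"
      unfolding dist_Pair_Pair by (rule sqrt_sum_squares_le_sum) auto
    also have "dist (P, y) (P1, y1) \<le> dist P P1 + dist y y1"
      unfolding dist_Pair_Pair by (rule sqrt_sum_squares_le_sum) auto
    finally have "dist ((P, y), P') ((P1, y1), P1) < \<delta>1" using P y r \<rho> by (simp add: dist_norm)
    then have "f1 ((P, y), P') c < f1 ((P1, y1), P1) c + \<eta> / 4" using \<delta>1(2) BK[OF P(1)] BK[OF P(2)] y(1) c by auto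
    then have "frozen_err \<epsilon> \<gamma> v y1 t x y (\<sigma> (fst P') (snd P') c) (b (fst P') (snd P') c) c \<le> f1 ((P1, y1), P1) c + \<eta> / 4"
      by (simp add: f1_def tx)
    from infconv_frozen[OF \<epsilon> w0 w1 super _ _ c this] show ?thesis using KT(2,3)[OF BK[OF P(1)]] unfolding tx by simp
  qed
  \<comment> \<open>Over all directions \<open>k\<close>, these first-order inequalities together
    say that gradients lie within \<open>\<delta>2 / 3\<close> of \<open>q0\<close>.\<close>
  have V2: "visc_super (0, k) (\<lambda>i::'d. 0) (q0 \<bullet> k + \<delta>2 / 3 * norm k) w P" if P: "dist P P1 < r" for P k
  proof -
    obtain t x where tx: "P = (t, x)" by (cases P)
    obtain y where y: "y \<in> Y" "norm (y - y1) < \<rho>"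
      and w0: "w (t, x) = v t y + (norm (x - y))\<^sup>2 / (2 * \<epsilon>) + \<gamma> * (norm (y - y1))\<^sup>2"
      and w1: "\<forall>\<^sub>F (h, k') in nhds 0. w ((t, x) + h) \<le> v (t + fst h) (y + k') + (norm (x + snd h - (y + k')))\<^sup>2 / (2 * \<epsilon>) + \<gamma> * (norm (y + k' - y1))\<^sup>2"
      using touch P(1) unfolding tx by blast
    have "dist x x1 \<le> dist P P1" using dist_snd_le[of P P1] by (simp add: tx P1_def)
    then have "norm (x - x1) < \<epsilon> * \<delta>2 / 6" using P r by (simp add: dist_norm)
    then have "norm ((x - x1) - (y - y1)) \<le> \<epsilon> * \<delta>2 / 3" using norm_triangle_ineq4[of "x - x1" "y - y1"] y \<rho> by linarith
    then have "norm ((1 / \<epsilon>) *\<^sub>R ((x - x1) - (y - y1))) \<le> \<delta>2 / 3"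
      unfolding norm_scaleR using \<epsilon> by (simp add: field_simps del: norm_scaleR)
    then have "norm ((1 / \<epsilon>) *\<^sub>R ((x - x1) - (y - y1))) * norm k \<le> \<delta>2 / 3 * norm k" by (rule mult_right_mono) simp
    then have "((1 / \<epsilon>) *\<^sub>R ((x - x1) - (y - y1))) \<bullet> k \<le> \<delta>2 / 3 * norm k"
      using norm_cauchy_schwarz[of "(1 / \<epsilon>) *\<^sub>R ((x - x1) - (y - y1))" k] by linarith
    moreover have "(1 / \<epsilon>) *\<^sub>R (x - y) = q0 + (1 / \<epsilon>) *\<^sub>R ((x - x1) - (y - y1))"
      unfolding q0_def scaleR_add_right[symmetric] by (simp add: algebra_simps)
    ultimately have "((1 / \<epsilon>) *\<^sub>R (x - y)) \<bullet> k \<le> q0 \<bullet> k + \<delta>2 / 3 * norm k" by (simp add: inner_add_left)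
    from infconv_gradient[OF \<epsilon> w0 w1 this] show ?thesis unfolding tx .
  qed
  \<comment> \<open>\<open>2 * e\<close> is half of \<open>\<gamma> * (r / 4)^2\<close>, so the
    mollification moves the maximum by less than \<open>r / 4\<close>.\<close>
  define e where "e = \<gamma> * (r / 4)\<^sup>2 / 4"
  have e: "0 < e" using \<gamma> r by (simp add: e_def)
  from wp(4)[OF e] obtain dw where dw: "0 < dw" "\<And>z h. norm h \<le> dw \<Longrightarrow> \<bar>w (z + h) - w z\<bar> \<le> e" by blast
  define d where "d = (Min {1, dw, r / 4})\<^sup>2"
  have dm: "0 < Min {1, dw, r / 4}" using dw r by simp
  have sd: "sqrt d = Min {1, dw, r / 4}" unfolding d_def using dm by (simp add: less_imp_le)
  have d: "0 < d" "d \<le> 1" "sqrt d \<le> dw" "sqrt d \<le> r / 4"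
    using dm unfolding sd by (auto simp: d_def power_le_one)
  define V where "V = avg d w"
  have Vw: "\<bar>V z - w z\<bar> \<le> e" for z
  proof -
    have "\<bar>w (z + h) - w z\<bar> \<le> e" if "norm h \<le> sqrt d" for h using dw(2) that d by auto
    then have "w (z + h) \<le> w z + e" "w z - e \<le> w (z + h)" if "norm h \<le> sqrt d" for h
      using that unfolding abs_le_iff by (auto simp: algebra_simps)
    then have "V z \<le> w z + e" "w z - e \<le> V z" unfolding V_def
      by (auto intro!: avg_close[OF wp(5) d(1,2)] avg_close'[OF wp(5) d(1,2)])
    then show ?thesis by linarith
  qed
  have Vc: "continuous_on UNIV V" unfolding V_def by (rule continuous_avg[OF wp(5) wN d(1,2)])
  \<comment> \<open>With \<open>w\<close> in place of \<open>V\<close>, the last term would make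
    \<open>P1\<close> the strict maximiser; \<open>V\<close> is within \<open>e\<close> of
    \<open>w\<close>.\<close>
  define J where "J z = u (fst z) (snd z) - V z - \<psi> (fst z) (snd z) - \<gamma> * (norm (z - P1))\<^sup>2" for z
  have cB: "cball P1 (r / 2) \<subseteq> K" using BK r by (auto simp: dist_commute)
  have "continuous_on (cball P1 (r / 2)) J" unfolding J_def
    by (intro continuous_intros continuous_on_subset[OF uK cB] continuous_on_subset[OF \<psi>c(1) cB] continuous_on_subset[OF Vc]) auto
  moreover have "cball P1 (r / 2) \<noteq> {}" using r by simp
  ultimately obtain P2 where P2: "P2 \<in> cball P1 (r / 2)" "\<And>z. z \<in> cball P1 (r / 2) \<Longrightarrow> J z \<le> J P2"
    using continuous_attains_sup[OF compact_cball] by blast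
  have P2K: "P2 \<in> K" using P2 cB by blast
  have P2d: "norm (P2 - P1) < r / 4"
  proof -
    have "J P1 \<le> J P2" using P2(2)[of P1] r by simp
    moreover have "\<Theta> - e \<le> J P1" using w1 Vw[of P1] unfolding J_def \<Theta>_def by (simp add: P1_def)
    moreover have "J P2 \<le> \<Theta> + e - \<gamma> * (norm (P2 - P1))\<^sup>2" using D0[OF P2K] Vw[of P2] unfolding D_def J_def by linarith
    ultimately have "\<gamma> * (norm (P2 - P1))\<^sup>2 \<le> 2 * e" by linarith
    also have "\<dots> < \<gamma> * (r / 4)\<^sup>2" using \<gamma> r by (simp add: e_def)
    finally have "(norm (P2 - P1))\<^sup>2 < (r / 4)\<^sup>2" using \<gamma> by (simp only: mult_less_cancel_left_pos)
    then show ?thesis using r power2_less_imp_less[of "norm (P2 - P1)" "r / 4"] by simp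
  qed
  have P2r: "dist P2 P1 < r" using P2d r by (simp add: dist_norm)
  have ball: "dist P P1 < r" if "P \<in> ball P2 (2 * (r / 4))" for P
    using dist_triangle[of P P1 P2] that P2d r by (simp add: dist_norm norm_minus_commute)
  define a1 where "a1 = avg1 d w P2"
  define a2 where "a2 = avg2 d w P2"
  define G where "G = jet_grad a1"
  have a1: "linear a1" unfolding a1_def by (rule linear_avg1[OF wp(5) d(2)])
  have a2: "bilinear a2" unfolding a2_def by (rule bilinear_avg2[OF wp(5) d(2)])
  have a2s: "a2 h k = a2 k h" for h k unfolding a2_def by (rule avg2_sym)
  obtain t2 x2 where tx2: "P2 = (t2, x2)" by (cases P2)
  have t2: "0 < t2" "t2 < T" using KT[OF P2K] by (simp_all add: tx2)
  \<comment> \<open>The coefficients are frozen at \<open>P2\<close>, the very point where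
    \<open>u\<close> is tested, and the control is still arbitrary.\<close>
  have gen2: "gen (1, b t2 x2 c) (\<lambda>i. (0, column i (\<sigma> t2 x2 c))) a1 a2 \<le> f1 ((P1, y1), P1) c + \<eta> / 4" if c: "c \<in> U" for c
    unfolding a1_def a2_def
    by (rule avg_super[OF wp(5) wN wp(4) d(1,2,4)]) (use V1[OF ball P2r c] in \<open>simp_all add: tx2\<close>)
  have G: "norm (G - q0) \<le> \<delta>2 / 3"
  proof -
    \<comment> \<open>Testing in the direction of the error itself gives
      \<open>(norm k)^2 \<le> \<delta>2 / 3 * norm k\<close>.\<close>
    define k where "k = G - q0"
    have "gen (0, k) (\<lambda>i::'d. 0) a1 a2 \<le> q0 \<bullet> k + \<delta>2 / 3 * norm k"
      unfolding a1_def a2_def by (rule avg_super[OF wp(5) wN wp(4) d(1,2,4)]) (use V2[OF ball] in simp_all)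
    then have "G \<bullet> k \<le> q0 \<bullet> k + \<delta>2 / 3 * norm k"
      using jet_grad[OF a1, of 0 k] bilinear_lzero[OF a2] by (simp add: gen_def G_def)
    then have "norm k * norm k \<le> \<delta>2 / 3 * norm k"
      unfolding power2_eq_square[symmetric] power2_norm_eq_inner by (simp add: k_def inner_diff_left)
    then show ?thesis unfolding k_def[symmetric] using \<delta>2(1) by (cases "k = 0") auto
  qed
  define l where "l h = a1 h + 2 * \<gamma> * ((P2 - P1) \<bullet> h)" for h
  define B where "B h k = a2 h k + 2 * \<gamma> * (h \<bullet> k)" for h k :: "real \<times> (real^'n)"
  have jl: "l (1, 0) = a1 (1, 0) + 2 * \<gamma> * (t2 - t1)" by (simp add: l_def tx2 P1_def)
  have jg: "jet_grad l = G + (2 * \<gamma>) *\<^sub>R (x2 - x1)"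
    by (simp add: jet_grad_def l_def G_def tx2 P1_def vec_eq_iff inner_axis)
  have jh: "jet_hess B = jet_hess a2 + (2 * \<gamma>) *\<^sub>R mat 1"
    by (simp add: jet_hess_def B_def vec_eq_iff inner_axis_axis mat_def)
  have jet: "(l (1, 0) + \<psi>t t2 x2, jet_grad l + \<psi>q t2 x2, jet_hess B + \<psi>X t2 x2) \<in> parabolic_superjet u t2 x2"
  proof (rule superjet_of_sum[OF _ _ _ \<psi>s])
    show "linear l" unfolding l_def
      by (intro linear_compose_add a1; rule linearI) (simp_all add: inner_add_right distrib_left mult.left_commute)
    have "bilinear (inner :: real \<times> (real^'n) \<Rightarrow> _)"
      by (simp add: bilinear_conv_bounded_bilinear bounded_bilinear_inner)
    from bilinear_add_fun[OF a2 bilinear_cmult_fun[OF this]] show "bilinear B" unfolding B_def .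
    show "B h k = B k h" for h k by (simp add: B_def a2s[of h k] inner_commute)
    fix \<theta> :: real assume \<theta>: "0 < \<theta>"
    define C where "C = kbound TYPE(real \<times> (real^'n)) d * N"
    have C: "0 \<le> C" unfolding C_def kbound_def using kmass_pos[where 'e="real \<times> (real^'n)", OF d(1,2)] wN[of 0] by auto
    have \<theta>2: "0 < \<theta> / 2" using \<theta> by simp
    have near: "\<forall>\<^sub>F h in nhds (0 :: real \<times> (real^'n)). norm h \<le> min 1 (r / 4)"
      by (rule eventually_nhds_0_norm[of "min 1 (r / 4)"]) (use r in auto)
    have "(t2, x2) \<in> K" using P2K tx2 by simp
    from \<psi>j[OF this \<theta>2] cubic_le_parabolic[OF C \<theta>2] near
    show "\<forall>\<^sub>F h in nhds 0. u (t2 + fst h) (x2 + snd h) \<le> u t2 x2 + (l h + 1/2 * B h h)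
      + (\<psi>t t2 x2 * fst h + \<psi>q t2 x2 \<bullet> snd h + 1/2 * ((\<psi>X t2 x2 *v snd h) \<bullet> snd h)) + \<theta> * (\<bar>fst h\<bar> + (norm (snd h))\<^sup>2)"
    proof eventually_elim
      case (elim h)
      have e: "P2 + h - P1 = (P2 - P1) + h" by simp
      have "norm (P2 + h - P1) \<le> r / 2" unfolding e using norm_triangle_ineq[of "P2 - P1" h] P2d elim(3) by simp
      then have "P2 + h \<in> cball P1 (r / 2)" by (simp add: dist_norm norm_minus_commute)
      from P2(2)[OF this] have 1: "u (t2 + fst h) (x2 + snd h) - V (P2 + h) - \<psi> (t2 + fst h) (x2 + snd h) - \<gamma> * (norm ((P2 - P1) + h))\<^sup>2
        \<le> u t2 x2 - V P2 - \<psi> t2 x2 - \<gamma> * (norm (P2 - P1))\<^sup>2" unfolding J_def e by (simp add: tx2)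
      have 2: "\<gamma> * (norm ((P2 - P1) + h))\<^sup>2 = \<gamma> * (norm (P2 - P1))\<^sup>2 + 2 * \<gamma> * ((P2 - P1) \<bullet> h) + \<gamma> * (h \<bullet> h)"
        unfolding norm_add_sq by (simp add: algebra_simps dot_square_norm)
      have "norm h \<le> 1" using elim(3) by simp
      from avg_jet_bounds(3)[OF wp(5) wN d(1,2) this, of P2]
      have 3: "V (P2 + h) - V P2 - a1 h - 1/2 * a2 h h \<le> C * norm h ^ 3" unfolding V_def a1_def a2_def C_def by simp
      have 4: "l h + 1/2 * B h h = a1 h + 1/2 * a2 h h + 2 * \<gamma> * ((P2 - P1) \<bullet> h) + \<gamma> * (h \<bullet> h)"
        unfolding l_def B_def by (simp add: algebra_simps)
      have 5: "\<theta> * (\<bar>fst h\<bar> + (norm (snd h))\<^sup>2) = \<theta> / 2 * (\<bar>fst h\<bar> + (norm (snd h))\<^sup>2) + \<theta> / 2 * (\<bar>fst h\<bar> + (norm (snd h))\<^sup>2)" by simp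
      define n where "n = \<bar>fst h\<bar> + (norm (snd h))\<^sup>2"
      define m where "m = \<psi>t t2 x2 * fst h + \<psi>q t2 x2 \<bullet> snd h + 1/2 * ((\<psi>X t2 x2 *v snd h) \<bullet> snd h)"
      show ?case using elim(1,2) 1 2 3 unfolding 4 5 n_def[symmetric] m_def[symmetric] by linarith
    qed
  qed
  obtain c where c: "c \<in> U" "- (\<eta> / 4) \<le> l (1, 0) + \<psi>t t2 x2 + hamil b \<sigma> g t2 x2 (u t2 x2) (jet_grad l + \<psi>q t2 x2) (jet_hess B + \<psi>X t2 x2) c"
  proof -
    have "h t2 x2 < u t2 x2" using hu[OF P2r] by (simp add: tx2)
    moreover have "0 < \<eta> / 4" using \<eta> by simp
    ultimately show ?thesis by (rule subsolution_ineq[OF sub t2 jet]) (rule that)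
  qed
  have sums: "jet_hess B + \<psi>X t2 x2 = jet_hess a2 + (\<psi>X t2 x2 + (2 * \<gamma>) *\<^sub>R mat 1)"
    "jet_grad l + \<psi>q t2 x2 = G + (\<psi>q t2 x2 + (2 * \<gamma>) *\<^sub>R (x2 - x1))"
    unfolding jh jg by (simp_all add: algebra_simps)
  have "- (\<eta> / 4) \<le> a1 (1, 0) + 2 * \<gamma> * (t2 - t1) + \<psi>t t2 x2
     + hamil b \<sigma> g t2 x2 (u t2 x2) (G + (\<psi>q t2 x2 + (2 * \<gamma>) *\<^sub>R (x2 - x1))) (\<psi>X t2 x2 + (2 * \<gamma>) *\<^sub>R mat 1) c
     + 1/2 * trace ((\<sigma> t2 x2 c ** transpose (\<sigma> t2 x2 c)) ** jet_hess a2)"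
    using c(2) unfolding sums jl hamil_add[where X="jet_hess a2"] by linarith
  moreover have "gen (1, b t2 x2 c) (\<lambda>i. (0, column i (\<sigma> t2 x2 c))) a1 a2
      = a1 (1, 0) + G \<bullet> b t2 x2 c + 1/2 * trace ((\<sigma> t2 x2 c ** transpose (\<sigma> t2 x2 c)) ** jet_hess a2)"
    unfolding gen_def trace_covariance jet_hess[OF a2] using jet_grad[OF a1, of 1 "b t2 x2 c"] by (simp add: G_def)
  ultimately have "- (\<eta> / 4) \<le> gen (1, b t2 x2 c) (\<lambda>i. (0, column i (\<sigma> t2 x2 c))) a1 a2 + f2 (P2, G) c"
    unfolding f2_def by (simp add: tx2)
  moreover have "f2 (P2, G) c < f2 (P1, q0) c + \<eta> / 4"
  proof (rule \<delta>2(2))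
    have "dist (P2, G) (P1, q0) \<le> dist P2 P1 + dist G q0"
      unfolding dist_Pair_Pair by (rule sqrt_sum_squares_le_sum) auto
    then show "dist (P2, G) (P1, q0) < \<delta>2" using P2r r(6) G \<delta>2(1) by (simp add: dist_norm)
  qed (use P2K c in auto)
  \<comment> \<open>Three errors \<open>\<eta> / 4\<close>, from the choice of the control,
    \<open>gen2\<close> and \<open>f2\<close>, cannot make up for the deficit
    \<open>\<eta>\<close>.\<close>
  ultimately show False using gen2[OF c(1)] neg1[OF c(1)] \<eta> by linarith
qed

end

section \<open>Penalty functions\<close>

text \<open>Two-sided, unlike the superjet, so that jets of the summands can be added.\<close>

definition has_pjet :: "(real \<Rightarrow> real^'n \<Rightarrow> real) \<Rightarrow> real \<Rightarrow> real^'n \<Rightarrow> real \<Rightarrow> real^'n \<Rightarrow> real^'n^'n \<Rightarrow> bool" where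
  "has_pjet f t x p q X \<longleftrightarrow> (\<forall>\<eta>>0. \<forall>\<^sub>F h in nhds 0.
     \<bar>f (t + fst h) (x + snd h) - (f t x + (p * fst h + q \<bullet> snd h + 1/2 * ((X *v snd h) \<bullet> snd h)))\<bar>
       \<le> \<eta> * (\<bar>fst h\<bar> + (norm (snd h))\<^sup>2))"

lemma has_pjet_add:
  assumes "has_pjet f t x p q X" "has_pjet f' t x p' q' X'"
  shows "has_pjet (\<lambda>t x. f t x + f' t x) t x (p + p') (q + q') (X + X')"
  unfolding has_pjet_def
proof (intro allI impI)
  fix \<eta> :: real assume "0 < \<eta>"
  then have \<eta>2: "0 < \<eta> / 2" by simp
  from assms(1)[unfolded has_pjet_def, rule_format, OF \<eta>2] assms(2)[unfolded has_pjet_def, rule_format, OF \<eta>2]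
  show "\<forall>\<^sub>F h in nhds 0. \<bar>f (t + fst h) (x + snd h) + f' (t + fst h) (x + snd h)
     - (f t x + f' t x + ((p + p') * fst h + (q + q') \<bullet> snd h + 1/2 * (((X + X') *v snd h) \<bullet> snd h)))\<bar>
     \<le> \<eta> * (\<bar>fst h\<bar> + (norm (snd h))\<^sup>2)"
  proof eventually_elim
    case (elim h)
    define n where "n = \<bar>fst h\<bar> + (norm (snd h))\<^sup>2"
    have *: "(p + p') * fst h + (q + q') \<bullet> snd h + 1/2 * (((X + X') *v snd h) \<bullet> snd h)
      = (p * fst h + q \<bullet> snd h + 1/2 * ((X *v snd h) \<bullet> snd h)) + (p' * fst h + q' \<bullet> snd h + 1/2 * ((X' *v snd h) \<bullet> snd h))"
      by (simp add: matrix_vector_mult_add_rdistrib inner_add_left distrib_right)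
    have n: "\<eta> * n = \<eta> / 2 * n + \<eta> / 2 * n" by simp
    show ?case using elim unfolding n_def[symmetric] * n by linarith
  qed
qed

text \<open>One derivative in time and two in space suffice, because the mixed term
  \<open>a' * s * (k (x + z) - k x)\<close> is \<open>o(\<bar>s\<bar>)\<close> by continuity of
  \<open>k\<close>.\<close>

lemma has_pjet_product:
  fixes a :: "real \<Rightarrow> real" and k :: "real^'n \<Rightarrow> real"
  assumes a: "(a has_real_derivative a') (at t)"
    and k: "\<And>\<eta>. 0 < \<eta> \<Longrightarrow> \<forall>\<^sub>F z in nhds 0. \<bar>k (x + z) - (k x + q \<bullet> z + 1/2 * ((X *v z) \<bullet> z))\<bar> \<le> \<eta> * (norm z)\<^sup>2"
    and kc: "isCont k x"
  shows "has_pjet (\<lambda>t x. a t * k x) t x (a' * k x) (a t *\<^sub>R q) (a t *\<^sub>R X)"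
  unfolding has_pjet_def
proof (intro allI impI)
  fix \<eta> :: real assume \<eta>: "0 < \<eta>"
  define M where "M = \<bar>k x\<bar> + \<bar>a t\<bar> + \<bar>a'\<bar> + 1"
  have M: "0 < M" unfolding M_def by (simp add: add_nonneg_pos)
  define \<tau> where "\<tau> = min 1 (\<eta> / (3 * M))"
  have \<tau>: "0 < \<tau>" "\<tau> \<le> 1" "3 * M * \<tau> \<le> \<eta>" using \<eta> M by (auto simp: \<tau>_def min_def field_simps)
  have tf: "filterlim (fst :: real \<times> (real^'n) \<Rightarrow> real) (nhds 0) (nhds 0)"
    using tendsto_fst[OF filterlim_ident, of "0 :: real \<times> (real^'n)"] by simp
  have ts: "filterlim (snd :: real \<times> (real^'n) \<Rightarrow> real^'n) (nhds 0) (nhds 0)"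
    using tendsto_snd[OF filterlim_ident, of "0 :: real \<times> (real^'n)"] by simp
  have e1: "\<forall>\<^sub>F s in nhds 0. \<bar>a (t + s) - a t - a' * s\<bar> \<le> \<tau> * \<bar>s\<bar>"
  proof -
    have "((\<lambda>s. (a (t + s) - a t) / s) \<longlongrightarrow> a') (at 0)" using a by (simp add: DERIV_def)
    from tendstoD[OF this \<tau>(1)] have "\<forall>\<^sub>F s in at 0. \<bar>a (t + s) - a t - a' * s\<bar> \<le> \<tau> * \<bar>s\<bar>"
      unfolding eventually_at_filter
    proof eventually_elim
      case (elim s)
      show ?case
      proof (intro impI)
        assume s: "s \<noteq> 0"
        have "a (t + s) - a t - a' * s = ((a (t + s) - a t) / s - a') * s" using s by (simp add: field_simps)
        then have "\<bar>a (t + s) - a t - a' * s\<bar> = dist ((a (t + s) - a t) / s) a' * \<bar>s\<bar>" by (simp add: abs_mult dist_real_def)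
        then show "\<bar>a (t + s) - a t - a' * s\<bar> \<le> \<tau> * \<bar>s\<bar>" using elim s by (simp add: mult_right_mono)
      qed
    qed
    then show ?thesis unfolding eventually_at_filter by eventually_elim auto
  qed
  have e3: "\<forall>\<^sub>F z in nhds 0. \<bar>k (x + z) - k x\<bar> < \<tau>"
  proof -
    have "((\<lambda>z. k (x + z)) \<longlongrightarrow> k (x + 0)) (at 0)"
      using LIM_offset_zero[OF kc[unfolded isCont_def]] by simp
    then have "((\<lambda>z. k (x + z)) \<longlongrightarrow> k (x + 0)) (nhds 0)"
      using tendsto_at_iff_tendsto_nhds[of "\<lambda>z. k (x + z)" 0] by simp
    from tendstoD[OF this \<tau>(1)] show ?thesis by (simp add: dist_real_def)
  qed
  from eventually_compose_filterlim[OF e1 tf] eventually_compose_filterlim[OF k[OF \<tau>(1)] ts] eventually_compose_filterlim[OF e3 ts]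
  show "\<forall>\<^sub>F h in nhds 0. \<bar>a (t + fst h) * k (x + snd h) - (a t * k x + (a' * k x * fst h + a t *\<^sub>R q \<bullet> snd h + 1/2 * ((a t *\<^sub>R X *v snd h) \<bullet> snd h)))\<bar>
     \<le> \<eta> * (\<bar>fst h\<bar> + (norm (snd h))\<^sup>2)"
  proof eventually_elim
    case (elim h)
    define s where "s = fst h"
    define z where "z = snd h"
    define r1 where "r1 = a (t + s) - a t - a' * s"
    define kz where "kz = k (x + z)"
    define m where "m = q \<bullet> z + 1/2 * ((X *v z) \<bullet> z)"
    define r2 where "r2 = kz - (k x + m)"
    have r1: "\<bar>r1\<bar> \<le> \<tau> * \<bar>s\<bar>" and r2: "\<bar>r2\<bar> \<le> \<tau> * (norm z)\<^sup>2" and kz: "\<bar>kz - k x\<bar> < \<tau>"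
      using elim by (simp_all add: r1_def r2_def kz_def m_def s_def z_def add.assoc)
    have "a (t + s) = a t + a' * s + r1" by (simp add: r1_def)
    then have "a (t + s) * kz - (a t * k x + (a' * k x * s + a t * m)) = a' * s * (kz - k x) + r1 * kz + a t * r2"
      unfolding r2_def by (simp add: algebra_simps)
    also have "\<bar>\<dots>\<bar> \<le> \<bar>a' * s * (kz - k x)\<bar> + \<bar>r1 * kz\<bar> + \<bar>a t * r2\<bar>" by linarith
    also have "\<dots> \<le> M * \<tau> * \<bar>s\<bar> + M * \<tau> * \<bar>s\<bar> + M * \<tau> * (norm z)\<^sup>2"
    proof (intro add_mono)
      have "\<bar>a' * s * (kz - k x)\<bar> \<le> M * \<bar>s\<bar> * \<tau>" unfolding abs_mult
        using kz by (intro mult_mono) (auto simp: M_def)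
      then show "\<bar>a' * s * (kz - k x)\<bar> \<le> M * \<tau> * \<bar>s\<bar>" by (simp add: mult_ac)
      have "\<bar>kz\<bar> \<le> M" using kz \<tau>(2) unfolding M_def by linarith
      then have "\<bar>r1 * kz\<bar> \<le> (\<tau> * \<bar>s\<bar>) * M" unfolding abs_mult using r1 by (intro mult_mono) auto
      then show "\<bar>r1 * kz\<bar> \<le> M * \<tau> * \<bar>s\<bar>" by (simp add: mult_ac)
      have "\<bar>a t * r2\<bar> \<le> M * (\<tau> * (norm z)\<^sup>2)" unfolding abs_mult using r2 by (intro mult_mono) (auto simp: M_def)
      then show "\<bar>a t * r2\<bar> \<le> M * \<tau> * (norm z)\<^sup>2" by (simp add: mult_ac)
    qed
    also have "\<dots> \<le> 3 * M * \<tau> * (\<bar>s\<bar> + (norm z)\<^sup>2)"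
    proof -
      have "0 \<le> M * \<tau> * \<bar>s\<bar>" "0 \<le> M * \<tau> * (norm z)\<^sup>2" using M \<tau> by auto
      then show ?thesis by (simp add: distrib_left)
    qed
    also have "\<dots> \<le> \<eta> * (\<bar>s\<bar> + (norm z)\<^sup>2)" using \<tau>(3) by (intro mult_right_mono) auto
    finally show ?case unfolding s_def[symmetric] z_def[symmetric] kz_def[symmetric]
      by (simp add: m_def scaleR_matrix_vector_assoc[symmetric] distrib_left)
  qed
qed

text \<open>Multiplication by \<open>N + e\<close> enlarges the remainder by a factor at most
  \<open>N + 1\<close> and pushes the quadratic term into the cubic remainder
  \<open>c * e^3\<close>.\<close>

lemma power_second_order:
  fixes N :: real
  assumes N: "0 \<le> N"
  shows "\<exists>C\<ge>0. \<forall>e. \<bar>e\<bar> \<le> 1 \<longrightarrow> \<bar>(N + e) ^ (j + 2) - (N ^ (j + 2) + real (j + 2) * N ^ (j + 1) * e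
     + 1/2 * (real (j + 2) * real (j + 1)) * N ^ j * e\<^sup>2)\<bar> \<le> C * \<bar>e\<bar> ^ 3"
proof (induction j)
  case 0
  have "(N + e) ^ 2 = N ^ 2 + 2 * N * e + e\<^sup>2" for e by (simp add: power2_eq_square algebra_simps)
  then show ?case by (intro exI[of _ 0]) (simp add: eval_nat_numeral algebra_simps)
next
  case (Suc j)
  then obtain C where C: "0 \<le> C" and R: "\<And>e. \<bar>e\<bar> \<le> 1 \<Longrightarrow> \<bar>(N + e) ^ (j + 2) - (N ^ (j + 2) + real (j + 2) * N ^ (j + 1) * e
     + 1/2 * (real (j + 2) * real (j + 1)) * N ^ j * e\<^sup>2)\<bar> \<le> C * \<bar>e\<bar> ^ 3" by blast
  define c where "c = 1/2 * (real (j + 2) * real (j + 1)) * N ^ j"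
  have c: "0 \<le> c" using N by (simp add: c_def)
  show ?case
  proof (intro exI conjI allI impI)
    show "0 \<le> C * (N + 1) + c" using C N c by simp
    fix e :: real assume e: "\<bar>e\<bar> \<le> 1"
    define \<rho> where "\<rho> = (N + e) ^ (j + 2) - (N ^ (j + 2) + real (j + 2) * N ^ (j + 1) * e + c * e\<^sup>2)"
    have \<rho>: "\<bar>\<rho>\<bar> \<le> C * \<bar>e\<bar> ^ 3" using R[OF e] by (simp add: \<rho>_def c_def)
    have "(N + e) ^ (Suc j + 2) = (N + e) * (N ^ (j + 2) + real (j + 2) * N ^ (j + 1) * e + c * e\<^sup>2 + \<rho>)"
      by (simp add: \<rho>_def)
    then have "(N + e) ^ (Suc j + 2) - (N ^ (Suc j + 2) + real (Suc j + 2) * N ^ (Suc j + 1) * e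
       + 1/2 * (real (Suc j + 2) * real (Suc j + 1)) * N ^ Suc j * e\<^sup>2) = (N + e) * \<rho> + c * e ^ 3"
      by (simp add: c_def power2_eq_square power3_eq_cube field_simps)
    also have "\<bar>\<dots>\<bar> \<le> \<bar>(N + e) * \<rho>\<bar> + \<bar>c * e ^ 3\<bar>" by (rule abs_triangle_ineq)
    also have "\<dots> \<le> (N + 1) * (C * \<bar>e\<bar> ^ 3) + c * \<bar>e\<bar> ^ 3"
    proof (intro add_mono)
      show "\<bar>(N + e) * \<rho>\<bar> \<le> (N + 1) * (C * \<bar>e\<bar> ^ 3)" unfolding abs_mult using \<rho> e N by (intro mult_mono) auto
    qed (use c in \<open>simp add: abs_mult power_abs\<close>)
    finally show "\<bar>(N + e) ^ (Suc j + 2) - (N ^ (Suc j + 2) + real (Suc j + 2) * N ^ (Suc j + 1) * e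
       + 1/2 * (real (Suc j + 2) * real (Suc j + 1)) * N ^ Suc j * e\<^sup>2)\<bar> \<le> (C * (N + 1) + c) * \<bar>e\<bar> ^ 3"
      by (simp add: algebra_simps)
  qed
qed

text \<open>The exponent \<open>j + 2\<close> keeps the exponents in the gradient
  \<open>growth1\<close> and the Hessian \<open>growth2\<close> free of truncated subtraction, and
  makes the function dominate \<open>(1 + x \<bullet> x)^j\<close> at infinity.\<close>

definition growth :: "nat \<Rightarrow> real^'n \<Rightarrow> real" where
  "growth j x = (1 + x \<bullet> x) ^ (j + 2)"
definition growth1 :: "nat \<Rightarrow> real^'n \<Rightarrow> real^'n" where
  "growth1 j x = (2 * real (j + 2) * (1 + x \<bullet> x) ^ (j + 1)) *\<^sub>R x"
definition growth2 :: "nat \<Rightarrow> real^'n \<Rightarrow> real^'n^'n" where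
  "growth2 j x = (2 * real (j + 2) * (1 + x \<bullet> x) ^ (j + 1)) *\<^sub>R mat 1
     + (4 * (real (j + 2) * real (j + 1)) * (1 + x \<bullet> x) ^ j) *\<^sub>R (\<chi> i k. x $ i * x $ k)"

lemma growth2_quadratic:
  "(growth2 j x *v z) \<bullet> z = 2 * real (j + 2) * (1 + x \<bullet> x) ^ (j + 1) * (norm z)\<^sup>2
     + 4 * (real (j + 2) * real (j + 1)) * (1 + x \<bullet> x) ^ j * (x \<bullet> z)\<^sup>2"
proof -
  have "(\<chi> i k. x $ i * x $ k) *v z = (x \<bullet> z) *\<^sub>R x"
    by (simp add: matrix_vector_mult_def vec_eq_iff inner_vec_def sum_distrib_left sum_distrib_right mult_ac)
  then show ?thesis unfolding growth2_def
    by (simp add: matrix_vector_mult_add_rdistrib scaleR_matrix_vector_assoc[symmetric] inner_add_left dot_square_norm power2_eq_square)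
qed

lemma transpose_growth2: "transpose (growth2 j x) = growth2 j x"
  by (simp add: growth2_def transpose_def vec_eq_iff mat_def mult_ac)

text \<open>Chain rule by hand: \<open>e\<close> is the increment of
  \<open>1 + x \<bullet> x\<close>, and \<open>e^2\<close> is replaced by its leading part
  \<open>4 * (x \<bullet> z)^2\<close> at cubic cost.\<close>

lemma growth_jet:
  fixes x :: "real^'n"
  assumes \<eta>: "0 < \<eta>"
  shows "\<forall>\<^sub>F z in nhds 0. \<bar>growth j (x + z) - (growth j x + growth1 j x \<bullet> z + 1/2 * ((growth2 j x *v z) \<bullet> z))\<bar> \<le> \<eta> * (norm z)\<^sup>2"
proof -
  define N where "N = 1 + x \<bullet> x"
  have N: "0 \<le> N" by (simp add: N_def)
  from power_second_order[OF N, of j] obtain C where C: "0 \<le> C" and R: "\<And>e. \<bar>e\<bar> \<le> 1 \<Longrightarrow> \<bar>(N + e) ^ (j + 2) - (N ^ (j + 2) + real (j + 2) * N ^ (j + 1) * e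
     + 1/2 * (real (j + 2) * real (j + 1)) * N ^ j * e\<^sup>2)\<bar> \<le> C * \<bar>e\<bar> ^ 3" by blast
  define c where "c = 1/2 * (real (j + 2) * real (j + 1)) * N ^ j"
  have c: "0 \<le> c" using N by (simp add: c_def)
  define A where "A = 2 * norm x + 1"
  have A: "1 \<le> A" by (simp add: A_def)
  define D where "D = C * A ^ 3 + c * (4 * norm x + 1)"
  have D: "0 \<le> D" using C c A by (simp add: D_def)
  define \<delta> where "\<delta> = Min {1, 1 / A, \<eta> / (D + 1)}"
  have \<delta>: "0 < \<delta>" "\<delta> \<le> 1" "\<delta> \<le> 1 / A" "\<delta> \<le> \<eta> / (D + 1)" using A D \<eta> by (auto simp: \<delta>_def)
  show ?thesis
  proof (rule eventually_nhds_0_norm[OF \<delta>(1)])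
    fix z :: "real^'n" assume z: "norm z \<le> \<delta>"
    define e where "e = 2 * (x \<bullet> z) + z \<bullet> z"
    have z1: "norm z \<le> 1" using z \<delta> by linarith
    have xz: "\<bar>x \<bullet> z\<bar> \<le> norm x * norm z" by (rule Cauchy_Schwarz_ineq2)
    have zz: "z \<bullet> z \<le> norm z" using z1 by (simp add: dot_square_norm power2_eq_square mult_left_le)
    have eA: "\<bar>e\<bar> \<le> A * norm z" 
    proof -
      have "0 \<le> z \<bullet> z" by simp
      then have "\<bar>e\<bar> \<le> 2 * (norm x * norm z) + norm z" unfolding e_def using xz zz by linarith
      then show ?thesis by (simp add: A_def distrib_right)
    qed
    have "A * norm z \<le> A * (1 / A)" using z \<delta>(3) A by (intro mult_left_mono) auto
    then have e1: "\<bar>e\<bar> \<le> 1" using eA A by simp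
    have Ne: "1 + (x + z) \<bullet> (x + z) = N + e" unfolding N_def e_def by (simp add: inner_add_left inner_add_right inner_commute)
    have e2: "e\<^sup>2 = 4 * (x \<bullet> z)\<^sup>2 + (4 * (x \<bullet> z) * (z \<bullet> z) + (z \<bullet> z)\<^sup>2)" unfolding e_def by (simp add: power2_eq_square algebra_simps)
    have e3: "\<bar>4 * (x \<bullet> z) * (z \<bullet> z) + (z \<bullet> z)\<^sup>2\<bar> \<le> (4 * norm x + 1) * norm z ^ 3"
    proof -
      have "\<bar>(x \<bullet> z) * (z \<bullet> z)\<bar> \<le> norm x * norm z * (norm z)\<^sup>2"
        unfolding abs_mult using xz by (intro mult_mono) (auto simp: dot_square_norm)
      moreover have "(z \<bullet> z)\<^sup>2 \<le> norm z ^ 3"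
        using z1 by (simp add: dot_square_norm flip: power_mult) (rule power_decreasing, auto)
      moreover have "(4 * norm x + 1) * norm z ^ 3 = 4 * (norm x * norm z * (norm z)\<^sup>2) + norm z ^ 3"
        by (simp add: distrib_right power3_eq_cube power2_eq_square)
      moreover have "0 \<le> (z \<bullet> z)\<^sup>2" by simp
      ultimately show ?thesis by linarith
    qed
    have "growth j (x + z) - (growth j x + growth1 j x \<bullet> z + 1/2 * ((growth2 j x *v z) \<bullet> z))
      = ((N + e) ^ (j + 2) - (N ^ (j + 2) + real (j + 2) * N ^ (j + 1) * e + c * e\<^sup>2))
        + c * (4 * (x \<bullet> z) * (z \<bullet> z) + (z \<bullet> z)\<^sup>2)"
      unfolding growth2_quadratic growth_def growth1_def Ne N_def[symmetric] e2
      by (simp add: c_def e_def dot_square_norm algebra_simps)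
    also have "\<bar>\<dots>\<bar> \<le> C * \<bar>e\<bar> ^ 3 + \<bar>c * (4 * (x \<bullet> z) * (z \<bullet> z) + (z \<bullet> z)\<^sup>2)\<bar>"
      using R[OF e1] unfolding c_def by (intro order.trans[OF abs_triangle_ineq] add_mono) auto
    also have "\<dots> \<le> C * (A * norm z) ^ 3 + c * ((4 * norm x + 1) * norm z ^ 3)"
      unfolding abs_mult[of c] using e3 eA C c by (intro add_mono mult_mono power_mono) auto
    also have "\<dots> = D * norm z * (norm z)\<^sup>2" by (simp add: D_def power_mult_distrib power3_eq_cube power2_eq_square algebra_simps)
    also have "\<dots> \<le> \<eta> * (norm z)\<^sup>2"
    proof (rule mult_right_mono)
      have "(D + 1) * norm z \<le> (D + 1) * (\<eta> / (D + 1))" using z \<delta>(4) D by (intro mult_left_mono) auto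
      also have "\<dots> = \<eta>" using D by simp
      finally have "D * norm z + norm z \<le> \<eta>" by (simp add: distrib_right)
      then show "D * norm z \<le> \<eta>" using norm_ge_zero[of z] by linarith
    qed simp
    finally show "\<bar>growth j (x + z) - (growth j x + growth1 j x \<bullet> z + 1/2 * ((growth2 j x *v z) \<bullet> z))\<bar> \<le> \<eta> * (norm z)\<^sup>2" .
  qed
qed

text \<open>The common time is what allows coefficients that are merely continuous in
  \<open>t\<close>. A crude bound through \<open>M\<close> first brings \<open>x1\<close> and
  \<open>y1\<close> together; uniform continuity of \<open>v\<close> then improves it to
  \<open>(norm (x1 - y1))^2 / \<epsilon> \<le> \<gamma>\<close>, and the same estimate keeps the
  maximum near \<open>(t0, x0)\<close>, hence interior.\<close>

lemma doubling_max:
  fixes u v \<psi> :: "real \<Rightarrow> real^'n \<Rightarrow> real" and t0 r :: real and x0 :: "real^'n"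
  assumes r: "0 < r" and \<gamma>: "0 < \<gamma>"
  defines "K \<equiv> {t0 - r..t0 + r} \<times> cball x0 r"
  assumes uc: "continuous_on K (\<lambda>z. u (fst z) (snd z))" and vc: "continuous_on K (\<lambda>z. v (fst z) (snd z))"
    and \<psi>c: "continuous_on K (\<lambda>z. \<psi> (fst z) (snd z))"
    and le: "\<And>t x. (t, x) \<in> K \<Longrightarrow> u t x - v t x \<le> \<psi> t x" and eq: "u t0 x0 - v t0 x0 = \<psi> t0 x0"
    and nn: "\<And>t x. (t, x) \<in> K \<Longrightarrow> 0 \<le> \<psi> t x"
  obtains \<epsilon> t1 x1 y1 where "0 < \<epsilon>" "\<bar>t1 - t0\<bar> < r" "norm (x1 - x0) < r" "norm (y1 - x0) < r"
    "(norm (x1 - y1))\<^sup>2 / \<epsilon> \<le> \<gamma>" "norm (x1 - y1) \<le> \<gamma>" "\<bar>u t1 x1 - v t1 y1\<bar> \<le> \<psi> t1 x1 + \<gamma>"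
    "\<And>t x y. (t, x) \<in> K \<Longrightarrow> y \<in> cball x0 r \<Longrightarrow>
       u t x - v t y - (norm (x - y))\<^sup>2 / (2 * \<epsilon>) - (\<psi> t x + \<gamma> * ((t - t0)\<^sup>2 + (norm (x - x0))\<^sup>2))
       \<le> u t1 x1 - v t1 y1 - (norm (x1 - y1))\<^sup>2 / (2 * \<epsilon>) - (\<psi> t1 x1 + \<gamma> * ((t1 - t0)\<^sup>2 + (norm (x1 - x0))\<^sup>2))"
proof -
  have Kc: "compact K" unfolding K_def by (intro compact_Times compact_Icc compact_cball)
  have P0: "(t0, x0) \<in> K" using r by (simp add: K_def)
  have "bounded ((\<lambda>z. v (fst z) (snd z)) ` K)" by (intro compact_imp_bounded compact_continuous_image vc Kc)
  then obtain M where M: "\<forall>a\<in>(\<lambda>z. v (fst z) (snd z)) ` K. norm a \<le> M" unfolding bounded_iff by blast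
  have Mv: "\<bar>v t x\<bar> \<le> M" if "(t, x) \<in> K" for t x using bspec[OF M imageI[OF that]] by simp
  have M0: "0 \<le> M" using Mv[OF P0] by linarith
  \<comment> \<open>The first entry serves the bound on
    \<open>(norm (x1 - y1))^2 / \<epsilon>\<close>, the second keeps \<open>(t1, x1)\<close> within
    \<open>r / 2\<close> of the centre in time and in space.\<close>
  define e where "e = min (\<gamma> / 2) (\<gamma> * (r / 2)\<^sup>2 / 2)"
  have e: "0 < e" "e \<le> \<gamma> / 2" "e \<le> \<gamma> * (r / 2)\<^sup>2 / 2" using \<gamma> r by (auto simp: e_def)
  from compact_uniformly_continuous[OF vc Kc, unfolded uniformly_continuous_on_def, rule_format, OF e(1)]
  obtain d where d: "0 < d" "\<And>z z'. z \<in> K \<Longrightarrow> z' \<in> K \<Longrightarrow> dist z' z < d \<Longrightarrow> dist (v (fst z') (snd z')) (v (fst z) (snd z)) < e" by blast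
  define d' where "d' = Min {d, \<gamma>, r / 2}"
  have d': "0 < d'" "d' \<le> d" "d' \<le> \<gamma>" "d' \<le> r / 2" using d \<gamma> r by (auto simp: d'_def)
  define n where "n = 4 * M + 1"
  have n: "0 < n" "4 * M \<le> n" using M0 by (simp_all add: n_def)
  define \<epsilon> where "\<epsilon> = d'\<^sup>2 / (2 * n)"
  have \<epsilon>: "0 < \<epsilon>" using d' n by (simp add: \<epsilon>_def)
  have \<epsilon>d: "4 * M * \<epsilon> < d'\<^sup>2"
  proof -
    have "4 * M * \<epsilon> \<le> n * \<epsilon>" using \<epsilon> n by (intro mult_right_mono) auto
    also have "\<dots> = d'\<^sup>2 / 2" using n by (simp add: \<epsilon>_def)
    also have "\<dots> < d'\<^sup>2" using d' by simp
    finally show ?thesis .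
  qed
  define J where "J z = u (fst (fst z)) (snd (fst z)) - v (fst (fst z)) (snd z) - (norm (snd (fst z) - snd z))\<^sup>2 / (2 * \<epsilon>)
     - (\<psi> (fst (fst z)) (snd (fst z)) + \<gamma> * ((fst (fst z) - t0)\<^sup>2 + (norm (snd (fst z) - x0))\<^sup>2))" for z :: "(real \<times> (real^'n)) \<times> (real^'n)"
  have Jc: "continuous_on (K \<times> cball x0 r) J"
  proof -
    have p: "continuous_on (K \<times> cball x0 r) fst" and q: "continuous_on (K \<times> cball x0 r) (\<lambda>z. (fst (fst z), snd z))"
      by (intro continuous_intros)+
    have p': "fst ` (K \<times> cball x0 r) \<subseteq> K" and q': "(\<lambda>z. (fst (fst z), snd z)) ` (K \<times> cball x0 r) \<subseteq> K"
      by (auto simp: K_def)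
    show ?thesis unfolding J_def
      by (intro continuous_intros continuous_on_compose2[OF uc p p'] continuous_on_compose2[OF \<psi>c p p']
          continuous_on_compose2[OF vc q q', simplified]) (use \<epsilon> in auto)
  qed
  have "compact (K \<times> cball x0 r)" by (intro compact_Times Kc compact_cball)
  moreover have "K \<times> cball x0 r \<noteq> {}" using P0 r by auto
  ultimately have "\<exists>z1\<in>K \<times> cball x0 r. \<forall>z\<in>K \<times> cball x0 r. J z \<le> J z1"
    using Jc by (rule continuous_attains_sup)
  then obtain z1 where z1: "z1 \<in> K \<times> cball x0 r" "\<And>z. z \<in> K \<times> cball x0 r \<Longrightarrow> J z \<le> J z1" by blast
  obtain t1 x1 y1 where z1eq: "z1 = ((t1, x1), y1)" by (cases z1) auto
  have x1: "(t1, x1) \<in> K" and y1: "(t1, y1) \<in> K" using z1(1) unfolding z1eq K_def by auto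
  have J1: "J z1 = u t1 x1 - v t1 y1 - (norm (x1 - y1))\<^sup>2 / (2 * \<epsilon>) - (\<psi> t1 x1 + \<gamma> * ((t1 - t0)\<^sup>2 + (norm (x1 - x0))\<^sup>2))"
    by (simp add: J_def z1eq)
  have "J ((t0, x0), x0) \<le> J z1" using z1(2) P0 r by simp
  moreover have "J ((t0, x0), x0) = 0" using eq by (simp add: J_def)
  ultimately have J0: "0 \<le> J z1" by simp
  have nn1: "0 \<le> (norm (x1 - y1))\<^sup>2 / (2 * \<epsilon>)" "0 \<le> \<gamma> * ((t1 - t0)\<^sup>2 + (norm (x1 - x0))\<^sup>2)" using \<epsilon> \<gamma> by auto
  \<comment> \<open>The doubled maximum is at least its value 0 at \<open>((t0, x0), x0)\<close>,
    and \<open>u - v \<le> \<psi>\<close> on the diagonal; so both penalties are paid for by the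
    variation of \<open>v\<close> between \<open>x1\<close> and \<open>y1\<close>.\<close>
  have key: "(norm (x1 - y1))\<^sup>2 / (2 * \<epsilon>) + \<gamma> * ((t1 - t0)\<^sup>2 + (norm (x1 - x0))\<^sup>2) \<le> v t1 x1 - v t1 y1"
    using J0 le[OF x1] unfolding J1 by linarith
  then have "(norm (x1 - y1))\<^sup>2 / (2 * \<epsilon>) \<le> 2 * M" using nn1 Mv[OF x1] Mv[OF y1] by linarith
  then have "(norm (x1 - y1))\<^sup>2 \<le> 4 * M * \<epsilon>" using \<epsilon> by (simp add: field_simps)
  then have "(norm (x1 - y1))\<^sup>2 < d'\<^sup>2" using \<epsilon>d by linarith
  then have xy: "norm (x1 - y1) < d'" using d' power2_less_imp_less[of "norm (x1 - y1)" d'] by simp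
  have "dist (t1, y1) (t1, x1) < d" using xy d' by (simp add: dist_Pair_Pair dist_norm norm_minus_commute)
  from d(2)[OF x1 y1 this] have ve: "v t1 x1 - v t1 y1 < e" by (simp add: dist_real_def abs_less_iff)
  have "(norm (x1 - y1))\<^sup>2 / (2 * \<epsilon>) \<le> \<gamma> / 2" using key ve e nn1 by linarith
  then have 5: "(norm (x1 - y1))\<^sup>2 / \<epsilon> \<le> \<gamma>" using \<epsilon> by (simp add: field_simps)
  have "\<gamma> * ((t1 - t0)\<^sup>2 + (norm (x1 - x0))\<^sup>2) \<le> e" using key ve nn1 by linarith
  also have "\<dots> < \<gamma> * (r / 2)\<^sup>2" using e(3) \<gamma> r by (intro le_less_trans[OF e(3)]) simp
  finally have "(t1 - t0)\<^sup>2 + (norm (x1 - x0))\<^sup>2 < (r / 2)\<^sup>2" using \<gamma> by (simp only: mult_less_cancel_left_pos)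
  then have "\<bar>t1 - t0\<bar>\<^sup>2 < (r / 2)\<^sup>2" "(norm (x1 - x0))\<^sup>2 < (r / 2)\<^sup>2"
    using zero_le_power2[of "t1 - t0"] zero_le_power2[of "norm (x1 - x0)"] by (simp_all only: power2_abs)
  then have 2: "\<bar>t1 - t0\<bar> < r / 2" "norm (x1 - x0) < r / 2"
    using r power2_less_imp_less[of "\<bar>t1 - t0\<bar>" "r / 2"] power2_less_imp_less[of "norm (x1 - x0)" "r / 2"] by simp_all
  have 4: "norm (y1 - x0) < r"
    using norm_triangle_ineq4[of "x1 - x0" "x1 - y1"] xy d' 2 by simp
  have 7: "\<bar>u t1 x1 - v t1 y1\<bar> \<le> \<psi> t1 x1 + \<gamma>"
  proof -
    have "u t1 x1 - v t1 y1 \<le> \<psi> t1 x1 + e" using le[OF x1] ve by linarith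
    moreover have "0 \<le> u t1 x1 - v t1 y1" using J0 nn1 nn[OF x1] unfolding J1 by linarith
    ultimately show ?thesis using e \<gamma> by linarith
  qed
  show ?thesis
  proof (rule that[OF \<epsilon> _ _ 4 5 _ 7])
    show "\<bar>t1 - t0\<bar> < r" "norm (x1 - x0) < r" using 2 r by linarith+
    show "norm (x1 - y1) \<le> \<gamma>" using xy d' by linarith
    show "u t x - v t y - (norm (x - y))\<^sup>2 / (2 * \<epsilon>) - (\<psi> t x + \<gamma> * ((t - t0)\<^sup>2 + (norm (x - x0))\<^sup>2))
       \<le> u t1 x1 - v t1 y1 - (norm (x1 - y1))\<^sup>2 / (2 * \<epsilon>) - (\<psi> t1 x1 + \<gamma> * ((t1 - t0)\<^sup>2 + (norm (x1 - x0))\<^sup>2))"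
      if "(t, x) \<in> K" "y \<in> cball x0 r" for t x y
      using z1(2)[of "((t, x), y)"] that unfolding J1 by (simp add: J_def)
  qed
qed

lemma continuous_on_growth [continuous_intros]:
  assumes "continuous_on S f"
  shows "continuous_on S (\<lambda>z. growth j (f z))" "continuous_on S (\<lambda>z. growth1 j (f z))" "continuous_on S (\<lambda>z. growth2 j (f z))"
  unfolding growth_def growth1_def growth2_def
  by (intro continuous_intros continuous_on_vec_lambda continuous_on_component assms)+

lemma growth_ge_1: "1 \<le> growth j x"
  unfolding growth_def by (rule one_le_power) simp

lemma sq_dist_jet:
  fixes x :: "real^'n"
  assumes "0 < \<eta>"
  shows "\<forall>\<^sub>F z in nhds 0. \<bar>(norm (x + z - x0))\<^sup>2 - ((norm (x - x0))\<^sup>2 + (2 *\<^sub>R (x - x0)) \<bullet> z + 1/2 * ((2 *\<^sub>R mat 1 *v z) \<bullet> z))\<bar> \<le> \<eta> * (norm z)\<^sup>2"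
proof (rule always_eventually, rule allI)
  fix z
  have "(norm (x + z - x0))\<^sup>2 = (norm (x - x0))\<^sup>2 + 2 * ((x - x0) \<bullet> z) + (norm z)\<^sup>2"
    using norm_add_sq[of "x - x0" z] by (simp add: algebra_simps)
  moreover have "(2 *\<^sub>R mat 1 *v z) \<bullet> z = 2 * (norm z)\<^sup>2"
    by (simp add: scaleR_matrix_vector_assoc[symmetric] dot_square_norm)
  ultimately show "\<bar>(norm (x + z - x0))\<^sup>2 - ((norm (x - x0))\<^sup>2 + (2 *\<^sub>R (x - x0)) \<bullet> z + 1/2 * ((2 *\<^sub>R mat 1 *v z) \<bullet> z))\<bar> \<le> \<eta> * (norm z)\<^sup>2"
    using assms by simp
qed

lemma penalty_jet:
  fixes x x0 :: "real^'n"
  assumes t: "0 < t"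
  shows "has_pjet (\<lambda>t x. \<theta> * (exp (\<mu> * (T - t)) * (growth j x + 1 / t)) + \<gamma> * ((t - t0)\<^sup>2 + (norm (x - x0))\<^sup>2)) t x
     (- (\<mu> * \<theta> * exp (\<mu> * (T - t)) * growth j x) - \<theta> * exp (\<mu> * (T - t)) * (\<mu> / t + 1 / t\<^sup>2) + 2 * \<gamma> * (t - t0))
     ((\<theta> * exp (\<mu> * (T - t))) *\<^sub>R growth1 j x + (2 * \<gamma>) *\<^sub>R (x - x0))
     ((\<theta> * exp (\<mu> * (T - t))) *\<^sub>R growth2 j x + (2 * \<gamma>) *\<^sub>R mat 1)"
proof -
  have 1: "has_pjet (\<lambda>t x. (\<theta> * exp (\<mu> * (T - t))) * growth j x) t x ((\<theta> * (exp (\<mu> * (T - t)) * (- \<mu>))) * growth j x)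
     ((\<theta> * exp (\<mu> * (T - t))) *\<^sub>R growth1 j x) ((\<theta> * exp (\<mu> * (T - t))) *\<^sub>R growth2 j x)"
  proof (rule has_pjet_product[OF _ growth_jet])
    show "((\<lambda>t. \<theta> * exp (\<mu> * (T - t))) has_real_derivative \<theta> * (exp (\<mu> * (T - t)) * (- \<mu>))) (at t)"
      by (auto intro!: derivative_eq_intros)
    have "continuous_on UNIV (growth j :: real^'n \<Rightarrow> real)" by (intro continuous_on_growth continuous_on_id)
    then show "isCont (growth j) x" by (simp add: continuous_on_eq_continuous_at)
  qed
  \<comment> \<open>The summands that depend on time alone are treated as a product with the
    constant function 1.\<close>
  have 2: "has_pjet (\<lambda>t (x::real^'n). (\<theta> * exp (\<mu> * (T - t)) / t + \<gamma> * (t - t0)\<^sup>2) * 1) t x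
     ((- \<theta> * exp (\<mu> * (T - t)) * (\<mu> / t + 1 / t\<^sup>2) + 2 * \<gamma> * (t - t0)) * 1)
     ((\<theta> * exp (\<mu> * (T - t)) / t + \<gamma> * (t - t0)\<^sup>2) *\<^sub>R 0) ((\<theta> * exp (\<mu> * (T - t)) / t + \<gamma> * (t - t0)\<^sup>2) *\<^sub>R 0)"
  proof (rule has_pjet_product)
    show "((\<lambda>t. \<theta> * exp (\<mu> * (T - t)) / t + \<gamma> * (t - t0)\<^sup>2) has_real_derivative
       - \<theta> * exp (\<mu> * (T - t)) * (\<mu> / t + 1 / t\<^sup>2) + 2 * \<gamma> * (t - t0)) (at t)"
      using t by (auto intro!: derivative_eq_intros simp: field_simps power2_eq_square)
  qed auto
  have 3: "has_pjet (\<lambda>(t::real) x. \<gamma> * (norm (x - x0))\<^sup>2) t x (0 * (norm (x - x0))\<^sup>2) (\<gamma> *\<^sub>R (2 *\<^sub>R (x - x0))) (\<gamma> *\<^sub>R (2 *\<^sub>R mat 1))"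
    by (rule has_pjet_product[OF _ sq_dist_jet]) (auto intro!: continuous_intros)
  have f: "(\<lambda>t x. \<theta> * exp (\<mu> * (T - t)) * growth j x + (\<theta> * exp (\<mu> * (T - t)) / t + \<gamma> * (t - t0)\<^sup>2) * 1 + \<gamma> * (norm (x - x0))\<^sup>2)
     = (\<lambda>t x. \<theta> * (exp (\<mu> * (T - t)) * (growth j x + 1 / t)) + \<gamma> * ((t - t0)\<^sup>2 + (norm (x - x0))\<^sup>2))"
    by (simp add: algebra_simps fun_eq_iff)
  from has_pjet_add[OF has_pjet_add[OF 1 2] 3] show ?thesis unfolding f by (simp add: algebra_simps)
qed

lemma vector_matrix_diff_split:
  "(p + q) v* A - p v* A' = p v* (A - A') + q v* (A :: real^'d^'n)"
  by (simp add: vec_eq_iff vector_matrix_mult_def sum_subtractf[symmetric] sum.distrib[symmetric] algebra_simps)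

lemma trace_covariance_affine:
  "trace ((A ** transpose A) ** (a *\<^sub>R X + c *\<^sub>R mat 1)) = a * trace ((A ** transpose A) ** X) + c * (norm A)\<^sup>2"
  unfolding trace_covariance norm_matrix_sq
  by (simp add: matrix_vector_mult_add_rdistrib scaleR_matrix_vector_assoc[symmetric] inner_add_left sum.distrib sum_distrib_left dot_square_norm)

lemma polynomial_le_growth:
  "1 + norm (x :: real^'n) ^ a \<le> 2 * (1 + x \<bullet> x) ^ a"
proof -
  have "0 \<le> (norm x - 1)\<^sup>2" by simp
  then have "2 * norm x \<le> 1 + (norm x)\<^sup>2" by (simp add: power2_eq_square algebra_simps)
  then have "norm x \<le> 1 + x \<bullet> x" using norm_ge_zero[of x] by (simp add: dot_square_norm del: norm_ge_zero)
  then have "norm x ^ a \<le> (1 + x \<bullet> x) ^ a" by (intro power_mono) auto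
  moreover have "1 \<le> (1 + x \<bullet> x) ^ a" by (rule one_le_power) simp
  ultimately show ?thesis by linarith
qed

section \<open>Growth of the coefficients and the comparison principle\<close>

context hjb begin

text \<open>Compactness of \<open>{0..T} \<times> U\<close> bounds the coefficients at
  \<open>x = 0\<close>; the Lipschitz condition in \<open>x\<close> does the rest.\<close>

lemma coefficient_growth:
  "\<exists>C\<ge>0. \<forall>t\<in>{0..T}. \<forall>c\<in>U. \<forall>x. norm (\<sigma> t x c) \<le> C * (1 + norm x) \<and> norm (b t x c) \<le> C * (1 + norm x)"
proof -
  have c1: "continuous_on ({0..T} \<times> U) (\<lambda>z. \<sigma> (fst z) 0 (snd z))" and c2: "continuous_on ({0..T} \<times> U) (\<lambda>z. b (fst z) 0 (snd z))"
    by (intro continuous_intros; auto)+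
  have k: "compact ({0..T} \<times> U)" by (intro compact_Times compact_Icc U)
  obtain B1 where B1: "\<forall>a\<in>(\<lambda>z. \<sigma> (fst z) 0 (snd z)) ` ({0..T} \<times> U). norm a \<le> B1"
    using compact_imp_bounded[OF compact_continuous_image[OF c1 k]] unfolding bounded_iff by blast
  obtain B2 where B2: "\<forall>a\<in>(\<lambda>z. b (fst z) 0 (snd z)) ` ({0..T} \<times> U). norm a \<le> B2"
    using compact_imp_bounded[OF compact_continuous_image[OF c2 k]] unfolding bounded_iff by blast
  define C where "C = L + \<bar>B1\<bar> + \<bar>B2\<bar>"
  have C: "0 \<le> C" using L by (simp add: C_def)
  have le: "B + L * n \<le> C * (1 + n)" if "B \<le> \<bar>B1\<bar> + \<bar>B2\<bar>" "0 \<le> n" for B n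
  proof -
    have "0 \<le> \<bar>B1\<bar> * n" "0 \<le> \<bar>B2\<bar> * n" using that by auto
    moreover have "C * (1 + n) = L + \<bar>B1\<bar> + \<bar>B2\<bar> + L * n + \<bar>B1\<bar> * n + \<bar>B2\<bar> * n" by (simp add: C_def algebra_simps)
    ultimately show ?thesis using that L by linarith
  qed
  show ?thesis
  proof (intro exI[of _ C] conjI ballI allI C)
    fix t x c assume t: "t \<in> {0..T}" and c: "c \<in> U"
    have "norm (\<sigma> t 0 c) \<le> B1" "norm (b t 0 c) \<le> B2"
      using bspec[OF B1 imageI, of "(t, c)"] bspec[OF B2 imageI, of "(t, c)"] t c by auto
    then have n: "norm (\<sigma> t 0 c) \<le> \<bar>B1\<bar> + \<bar>B2\<bar>" "norm (b t 0 c) \<le> \<bar>B1\<bar> + \<bar>B2\<bar>" by linarith+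
    show "norm (\<sigma> t x c) \<le> C * (1 + norm x)"
      using le[OF n(1), of "norm x"] \<sigma>_Lip[OF t c, of x 0] norm_triangle_sub[of "\<sigma> t x c" "\<sigma> t 0 c"] by simp
    show "norm (b t x c) \<le> C * (1 + norm x)"
      using le[OF n(2), of "norm x"] b_Lip[OF t c, of x 0] norm_triangle_sub[of "b t x c" "b t 0 c"] by simp
  qed
qed

text \<open>Each derivative of \<open>growth\<close> costs one power of \<open>norm x\<close> at
  infinity, which the linear growth of \<open>\<sigma>\<close> and \<open>b\<close> restores. The
  third term is there to dominate the variation of \<open>g\<close> in its gradient
  argument.\<close>

lemma growth_generator_bound:
  "\<exists>\<Lambda>\<ge>0. \<forall>t\<in>{0..T}. \<forall>c\<in>U. \<forall>x.
    1/2 * trace ((\<sigma> t x c ** transpose (\<sigma> t x c)) ** growth2 j x) + b t x c \<bullet> growth1 j x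
      + L * (norm (growth1 j x) * norm (\<sigma> t x c)) \<le> \<Lambda> * growth j x"
proof -
  obtain C where C: "0 \<le> C" "\<And>t x c. t \<in> {0..T} \<Longrightarrow> c \<in> U \<Longrightarrow> norm (\<sigma> t x c) \<le> C * (1 + norm x)"
    "\<And>t x c. t \<in> {0..T} \<Longrightarrow> c \<in> U \<Longrightarrow> norm (b t x c) \<le> C * (1 + norm x)" 
    using coefficient_growth by blast
  define m where "m = real (j + 2)"
  define n where "n = real (j + 1)"
  have mn: "0 \<le> m" "0 \<le> n" by (simp_all add: m_def n_def)
  define \<Lambda> where "\<Lambda> = (m + 2 * (m * n)) * (2 * C\<^sup>2) + 4 * m * C + L * (4 * m * C)"
  have \<Lambda>: "0 \<le> \<Lambda>" using mn C(1) L by (simp add: \<Lambda>_def)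
  show ?thesis
  proof (intro exI[of _ \<Lambda>] conjI ballI allI \<Lambda>)
    fix t c and x :: "real^'n" assume t: "t \<in> {0..T}" and c: "c \<in> U"
    define N where "N = 1 + x \<bullet> x"
    define S where "S = \<sigma> t x c"
    have xN: "(norm x)\<^sup>2 \<le> N" by (simp add: N_def dot_square_norm)
    have N1: "1 \<le> N" by (simp add: N_def)
    have Np: "0 \<le> N ^ j" "0 \<le> N ^ (j + 1)" using N1 by auto
    have "0 \<le> (norm x - 1)\<^sup>2" by simp
    then have two: "2 * norm x \<le> 1 + (norm x)\<^sup>2" by (simp add: power2_eq_square algebra_simps)
    have sq: "(1 + norm x)\<^sup>2 \<le> 2 * N" using two by (simp add: N_def dot_square_norm power2_eq_square algebra_simps)
    have xx: "norm x * (1 + norm x) \<le> 2 * N"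
    proof -
      have "norm x * (1 + norm x) = norm x + (norm x)\<^sup>2" by (simp add: power2_eq_square distrib_left)
      moreover have "norm x + (norm x)\<^sup>2 \<le> 2 * (1 + (norm x)\<^sup>2)"
      proof -
        have "norm x + n \<le> 2 + 2 * n" if "2 * norm x \<le> 1 + n" "0 \<le> n" for n using that norm_ge_zero[of x] by linarith
        from this[OF two] show ?thesis by simp
      qed
      ultimately show ?thesis unfolding N_def dot_square_norm by (simp only:)
    qed
    have S2: "(norm S)\<^sup>2 \<le> 2 * C\<^sup>2 * N"
    proof -
      have "(norm S)\<^sup>2 \<le> (C * (1 + norm x))\<^sup>2" unfolding S_def by (rule power_mono[OF C(2)[OF t c]]) simp
      also have "\<dots> = C\<^sup>2 * (1 + norm x)\<^sup>2" by (simp add: power_mult_distrib)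
      also have "\<dots> \<le> C\<^sup>2 * (2 * N)" using sq by (rule mult_left_mono) simp
      finally show ?thesis by (simp add: mult_ac)
    qed
    have "trace ((S ** transpose S) ** growth2 j x) \<le> (\<Sum>i\<in>UNIV. (2 * m * N ^ (j + 1) + 4 * (m * n) * N ^ (j + 1)) * (norm (column i S))\<^sup>2)"
      unfolding trace_covariance
    proof (rule sum_mono)
      fix i
      let ?s = "column i S"
      have "(x \<bullet> ?s)\<^sup>2 \<le> (x \<bullet> x) * (?s \<bullet> ?s)" by (rule Cauchy_Schwarz_ineq)
      also have "\<dots> \<le> N * (norm ?s)\<^sup>2" using xN by (simp add: dot_square_norm mult_right_mono)
      finally have "4 * (m * n) * N ^ j * (x \<bullet> ?s)\<^sup>2 \<le> 4 * (m * n) * N ^ j * (N * (norm ?s)\<^sup>2)"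
        using mn Np by (intro mult_left_mono) auto
      then show "(growth2 j x *v ?s) \<bullet> ?s \<le> (2 * m * N ^ (j + 1) + 4 * (m * n) * N ^ (j + 1)) * (norm ?s)\<^sup>2"
        unfolding growth2_quadratic N_def[symmetric] m_def[symmetric] n_def[symmetric] by (simp add: algebra_simps)
    qed
    also have "\<dots> = 2 * (m + 2 * (m * n)) * N ^ (j + 1) * (norm S)\<^sup>2"
      unfolding norm_matrix_sq sum_distrib_left[symmetric] by (simp add: algebra_simps)
    also have "\<dots> \<le> 2 * (m + 2 * (m * n)) * N ^ (j + 1) * (2 * C\<^sup>2 * N)"
      using S2 mn Np by (intro mult_left_mono) auto
    finally have 1: "1/2 * trace ((S ** transpose S) ** growth2 j x) \<le> (m + 2 * (m * n)) * (2 * C\<^sup>2) * N ^ (j + 2)"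
      by (simp add: algebra_simps)
    have g1: "norm (growth1 j x) = 2 * m * N ^ (j + 1) * norm x"
      unfolding growth1_def N_def[symmetric] m_def[symmetric] using mn Np by simp
    have prod: "norm (growth1 j x) * s \<le> 4 * m * C * N ^ (j + 2)" if s: "s \<le> C * (1 + norm x)" for s
    proof -
      have "norm (growth1 j x) * s \<le> (2 * m * N ^ (j + 1) * norm x) * (C * (1 + norm x))"
        unfolding g1 using s mn Np by (intro mult_left_mono) auto
      also have "\<dots> = 2 * m * N ^ (j + 1) * C * (norm x * (1 + norm x))" by (simp only: mult_ac)
      also have "\<dots> \<le> 2 * m * N ^ (j + 1) * C * (2 * N)" using xx mn Np C(1) by (intro mult_left_mono) auto
      finally show ?thesis by (simp add: mult_ac)
    qed
    have 2: "b t x c \<bullet> growth1 j x \<le> 4 * m * C * N ^ (j + 2)"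
      using norm_cauchy_schwarz[of "b t x c" "growth1 j x"] prod[OF C(3)[OF t c]] by (simp only: mult.commute[of "norm (b t x c)"])
    have 3: "L * (norm (growth1 j x) * norm S) \<le> L * (4 * m * C * N ^ (j + 2))"
      using prod[OF C(2)[OF t c]] L unfolding S_def by (intro mult_left_mono) auto
    have "\<Lambda> * growth j x = (m + 2 * (m * n)) * (2 * C\<^sup>2) * N ^ (j + 2) + 4 * m * C * N ^ (j + 2) + L * (4 * m * C * N ^ (j + 2))"
      unfolding \<Lambda>_def growth_def N_def[symmetric] by (simp add: algebra_simps)
    then show "1/2 * trace ((\<sigma> t x c ** transpose (\<sigma> t x c)) ** growth2 j x) + b t x c \<bullet> growth1 j x
      + L * (norm (growth1 j x) * norm (\<sigma> t x c)) \<le> \<Lambda> * growth j x"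
      using 1 2 3 unfolding S_def by linarith
  qed
qed

text \<open>
  Maximising the quotient rather than the difference makes the maximum of \<open>u - v - \<theta> * \<Psi>\<close> equal to \<open>0\<close>, so that
  the dependence of \<open>g\<close> on \<open>u\<close> costs only \<open>L * \<theta> * \<Psi>\<close>.  The summand \<open>1 / t\<close> keeps the maximum away from \<open>t = 0\<close>.
\<close>

lemma ratio_maximum:
  assumes sub: "viscosity_subsolution T b \<sigma> g h \<Phi> U u" and super: "viscosity_supersolution T b \<sigma> g h \<Phi> U v"
    and gu: "\<And>t x. t \<in> {0..T} \<Longrightarrow> \<bar>u t x\<bar> \<le> Cu * (1 + norm x ^ mu)" and gv: "\<And>t x. t \<in> {0..T} \<Longrightarrow> \<bar>v t x\<bar> \<le> Cv * (1 + norm x ^ mv)"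
    and \<mu>: "0 \<le> \<mu>" and ts: "0 < ts" "ts \<le> T" and neg: "v ts xs < u ts xs"
  defines "\<Psi> \<equiv> \<lambda>t x. exp (\<mu> * (T - t)) * (growth (mu + mv) x + 1 / t)"
  obtains \<theta> t0 x0 where "0 < \<theta>" "0 < t0" "t0 < T" "u t0 x0 - v t0 x0 = \<theta> * \<Psi> t0 x0"
    "\<And>t x. 0 < t \<Longrightarrow> t \<le> T \<Longrightarrow> u t x - v t x \<le> \<theta> * \<Psi> t x"
proof -
  define a where "a = mu + mv"
  define C where "C = 2 * \<bar>Cu\<bar> + 2 * \<bar>Cv\<bar>"
  have C: "0 \<le> C" by (simp add: C_def)
  have bound: "u t x - v t x \<le> C * (1 + x \<bullet> x) ^ a" if t: "t \<in> {0..T}" for t x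
  proof -
    have *: "K * (1 + norm x ^ m) \<le> 2 * \<bar>K\<bar> * (1 + x \<bullet> x) ^ a" if "m \<le> a" for K m
    proof -
      have "K * (1 + norm x ^ m) \<le> \<bar>K\<bar> * (1 + norm x ^ m)" by (rule mult_right_mono) auto
      also have "\<dots> \<le> \<bar>K\<bar> * (2 * (1 + x \<bullet> x) ^ m)" by (intro mult_left_mono polynomial_le_growth) auto
      also have "\<dots> \<le> \<bar>K\<bar> * (2 * (1 + x \<bullet> x) ^ a)" using that by (intro mult_left_mono power_increasing) auto
      finally show ?thesis by simp
    qed
    have "\<bar>u t x\<bar> \<le> 2 * \<bar>Cu\<bar> * (1 + x \<bullet> x) ^ a" using gu[OF t, of x] *[of mu Cu] by (simp add: a_def)
    moreover have "\<bar>v t x\<bar> \<le> 2 * \<bar>Cv\<bar> * (1 + x \<bullet> x) ^ a" using gv[OF t, of x] *[of mv Cv] by (simp add: a_def)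
    ultimately show ?thesis by (simp add: C_def distrib_right)
  qed
  have E: "1 \<le> exp (\<mu> * (T - t))" if "t \<le> T" for t using \<mu> that by simp
  have \<Psi>_ge: "growth a x \<le> \<Psi> t x" "1 / t \<le> \<Psi> t x" "0 < \<Psi> t x" if t: "0 < t" "t \<le> T" for t x
  proof -
    have "1 * (growth a x + 1 / t) \<le> \<Psi> t x" unfolding \<Psi>_def a_def[symmetric]
      using E[OF t(2)] growth_ge_1[of a x] t by (intro mult_right_mono) auto
    then have "growth a x + 1 / t \<le> \<Psi> t x" by simp
    moreover have "0 < 1 / t" using t by simp
    ultimately show "growth a x \<le> \<Psi> t x" "1 / t \<le> \<Psi> t x" "0 < \<Psi> t x" using growth_ge_1[of a x] by linarith+
  qed
  define f where "f z = (u (fst z) (snd z) - v (fst z) (snd z)) / \<Psi> (fst z) (snd z)" for z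
  define fs where "fs = f (ts, xs)"
  have fs: "0 < fs" using neg \<Psi>_ge(3)[OF ts] by (simp add: fs_def f_def)
  \<comment> \<open>Beyond this radius a spare power of \<open>1 + x \<bullet> x\<close> in
    \<open>growth\<close> beats \<open>C / fs\<close>.\<close>
  define R where "R = sqrt (C / fs)"
  have R: "0 \<le> R" "R\<^sup>2 = C / fs" using C fs by (auto simp: R_def)
  define C' where "C' = C * (1 + R\<^sup>2) ^ a"
  have C': "0 \<le> C'" using C by (simp add: C'_def)
  \<comment> \<open>\<open>C'\<close> bounds \<open>u - v\<close> on the ball of radius
    \<open>R\<close>; before time \<open>\<tau>\<close> the summand \<open>1 / t\<close> alone
    exceeds \<open>C' / fs\<close>.\<close>
  define \<tau> where "\<tau> = min T (fs / (C' + 1))"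
  have \<tau>: "0 < \<tau>" "\<tau> \<le> T" "\<tau> \<le> fs / (C' + 1)" using T fs C' by (auto simp: \<tau>_def)
  define Kc where "Kc = {\<tau>..T} \<times> cball (0 :: real^'n) R"
  \<comment> \<open>Outside \<open>Kc\<close> the quotient is below its value at
    \<open>(ts, xs)\<close>, so the maximum over the compact \<open>Kc\<close> is global.\<close>
  have out: "u t x - v t x < fs * \<Psi> t x" if t: "0 < t" "t \<le> T" and n: "(t, x) \<notin> Kc" for t x
  proof (cases "norm x \<le> R")
    case False
    then have "R\<^sup>2 < (norm x)\<^sup>2" using R by (intro power_strict_mono) auto
    then have "fs * R\<^sup>2 < fs * (1 + x \<bullet> x)" using fs by (intro mult_strict_left_mono) (auto simp: dot_square_norm)
    then have CN: "C < fs * (1 + x \<bullet> x)" using R fs by simp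
    have p: "0 < (1 + x \<bullet> x) ^ a" by (intro zero_less_power add_pos_nonneg) auto
    have "u t x - v t x \<le> C * (1 + x \<bullet> x) ^ a" using bound t by auto
    also have "\<dots> < fs * (1 + x \<bullet> x) * (1 + x \<bullet> x) ^ a" using CN p by (rule mult_strict_right_mono)
    also have "\<dots> = fs * (1 + x \<bullet> x) ^ (a + 1)" by simp
    also have "\<dots> \<le> fs * growth a x" unfolding growth_def using fs by (intro mult_left_mono power_increasing) auto
    also have "\<dots> \<le> fs * \<Psi> t x" using \<Psi>_ge(1)[OF t] fs by (intro mult_left_mono) auto
    finally show ?thesis .
  next
    case True
    then have tt: "t < \<tau>" using n t by (auto simp: Kc_def)
    have "x \<bullet> x \<le> R\<^sup>2" using True by (simp add: dot_square_norm power_mono)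
    have "u t x - v t x \<le> C * (1 + x \<bullet> x) ^ a" using bound t by auto
    also have "\<dots> \<le> C'" unfolding C'_def using C \<open>x \<bullet> x \<le> R\<^sup>2\<close> by (intro mult_left_mono power_mono) (auto intro: add_nonneg_nonneg)
    also have "\<dots> < fs * (1 / t)"
    proof -
      have "t < fs / (C' + 1)" using tt \<tau> by linarith
      then have "(C' + 1) * t < fs" using C' by (simp add: less_divide_eq mult.commute)
      then have "C' + 1 < fs / t" using t by (simp add: less_divide_eq)
      then show ?thesis by simp
    qed
    also have "\<dots> \<le> fs * \<Psi> t x" using \<Psi>_ge(2)[OF t] fs by (intro mult_left_mono) auto
    finally show ?thesis .
  qed
  have eqf: "u t x - v t x = f (t, x) * \<Psi> t x" if "0 < t" "t \<le> T" for t x using \<Psi>_ge(3)[OF that, of x] by (simp add: f_def)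
  have star: "(ts, xs) \<in> Kc"
  proof (rule ccontr)
    assume "(ts, xs) \<notin> Kc"
    from out[OF ts this] show False using eqf[OF ts, of xs] by (simp add: fs_def)
  qed
  have Kc: "compact Kc" unfolding Kc_def by (intro compact_Times compact_Icc compact_cball)
  have sub': "Kc \<subseteq> {0..T} \<times> UNIV" using \<tau> by (auto simp: Kc_def)
  have uc: "continuous_on Kc (\<lambda>z. u (fst z) (snd z))" and vc: "continuous_on Kc (\<lambda>z. v (fst z) (snd z))"
    using sub super continuous_on_subset[OF _ sub'] unfolding viscosity_subsolution_def viscosity_supersolution_def
    by (auto simp: case_prod_unfold)
  have pos: "0 < fst z" "fst z \<le> T" if "z \<in> Kc" for z using that \<tau> by (auto simp: Kc_def)
  have \<Psi>c: "continuous_on Kc (\<lambda>z. \<Psi> (fst z) (snd z))" unfolding \<Psi>_def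
    by (intro continuous_intros) (use pos in force)
  have "\<Psi> (fst z) (snd z) \<noteq> 0" if "z \<in> Kc" for z using \<Psi>_ge(3)[OF pos[OF that], of "snd z"] by linarith
  then have "continuous_on Kc f" unfolding f_def by (intro continuous_intros uc vc \<Psi>c) auto
  moreover have "Kc \<noteq> {}" using star by blast
  ultimately have "\<exists>z0\<in>Kc. \<forall>z\<in>Kc. f z \<le> f z0" using Kc by (intro continuous_attains_sup)
  then obtain z0 where z0: "z0 \<in> Kc" "\<And>z. z \<in> Kc \<Longrightarrow> f z \<le> f z0" by blast
  obtain t0 x0 where tx: "z0 = (t0, x0)" by (cases z0)
  have t0: "0 < t0" "t0 \<le> T" using pos[OF z0(1)] by (simp_all add: tx)
  have \<theta>: "fs \<le> f z0" using z0(2)[OF star] by (simp add: fs_def)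
  have "t0 \<noteq> T"
  proof
    assume "t0 = T"
    moreover have "u T x0 \<le> v T x0" using sub super unfolding viscosity_subsolution_def viscosity_supersolution_def
      by (meson order.trans)
    moreover have "0 < f (t0, x0) * \<Psi> t0 x0" using \<theta> fs \<Psi>_ge(3)[OF t0, of x0] by (simp add: tx)
    ultimately show False using eqf[OF t0, of x0] by simp
  qed
  show ?thesis
  proof (rule that[of "f z0" t0 x0])
    show "0 < f z0" "0 < t0" "t0 < T" using \<theta> fs t0 \<open>t0 \<noteq> T\<close> by auto
    show "u t0 x0 - v t0 x0 = f z0 * \<Psi> t0 x0" using eqf[OF t0] by (simp add: tx)
    fix t x assume t: "0 < t" "t \<le> T"
    show "u t x - v t x \<le> f z0 * \<Psi> t x"
    proof (cases "(t, x) \<in> Kc")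
      case True
      then show ?thesis using eqf[OF t, of x] z0(2)[OF True] \<Psi>_ge(3)[OF t, of x] by (simp add: mult_right_mono)
    next
      case False
      from out[OF t False] have "u t x - v t x \<le> fs * \<Psi> t x" by simp
      also have "\<dots> \<le> f z0 * \<Psi> t x" using \<theta> \<Psi>_ge(3)[OF t, of x] by (intro mult_right_mono) auto
      finally show ?thesis .
    qed
  qed
qed


text \<open>Every error at the doubling point is either absorbed by the decay rate
  \<open>\<mu>\<close> of the penalty \<open>\<theta> * \<Psi>\<close>, or is
  \<open>\<gamma>\<close> times a constant free of \<open>\<epsilon>\<close>; hence
  \<open>\<gamma>\<close> can be fixed before \<open>\<epsilon>\<close> is produced.\<close>

lemma comparison:
  assumes sub: "viscosity_subsolution T b \<sigma> g h \<Phi> U u" and super: "viscosity_supersolution T b \<sigma> g h \<Phi> U v"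
    and pu: "polynomial_growth T u" and pv: "polynomial_growth T v" and ts: "0 < ts" "ts \<le> T"
  shows "u ts xs \<le> v ts xs"
proof (rule ccontr)
  assume "\<not> u ts xs \<le> v ts xs"
  then have neg: "v ts xs < u ts xs" by simp
  obtain Cu mu where gu: "\<And>t x. t \<in> {0..T} \<Longrightarrow> \<bar>u t x\<bar> \<le> Cu * (1 + norm x ^ mu)" using pu unfolding polynomial_growth_def by blast
  obtain Cv mv where gv: "\<And>t x. t \<in> {0..T} \<Longrightarrow> \<bar>v t x\<bar> \<le> Cv * (1 + norm x ^ mv)" using pv unfolding polynomial_growth_def by blast
  define j where "j = mu + mv"
  obtain \<Lambda> where \<Lambda>: "0 \<le> \<Lambda>" "\<And>t x c. t \<in> {0..T} \<Longrightarrow> c \<in> U \<Longrightarrow>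
    1/2 * trace ((\<sigma> t x c ** transpose (\<sigma> t x c)) ** growth2 j x) + b t x c \<bullet> growth1 j x
      + L * (norm (growth1 j x) * norm (\<sigma> t x c)) \<le> \<Lambda> * growth j x" using growth_generator_bound by blast
  \<comment> \<open>\<open>\<Lambda>\<close> absorbs the generator of \<open>growth\<close> and the
    gradient argument of \<open>g\<close>, \<open>L\<close> the dependence of \<open>g\<close> on
    the solution; the 1 leaves a negative term of size at least \<open>\<theta>\<close>.\<close>
  define \<mu> where "\<mu> = \<Lambda> + L + 1"
  have \<mu>: "0 \<le> \<mu>" using \<Lambda>(1) L by (simp add: \<mu>_def)
  define \<Psi> where "\<Psi> t x = exp (\<mu> * (T - t)) * (growth j x + 1 / t)" for t and x :: "real^'n"
  obtain \<theta> t0 x0 where \<theta>: "0 < \<theta>" and t0: "0 < t0" "t0 < T" and eq0: "u t0 x0 - v t0 x0 = \<theta> * \<Psi> t0 x0"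
    and le0: "\<And>t x. 0 < t \<Longrightarrow> t \<le> T \<Longrightarrow> u t x - v t x \<le> \<theta> * \<Psi> t x"
  proof (rule ratio_maximum[OF sub super gu gv \<mu> ts neg, folded j_def, folded \<Psi>_def])
    fix \<theta> t0 x0
    assume *: "0 < \<theta>" "0 < t0" "t0 < T" "u t0 x0 - v t0 x0 = \<theta> * \<Psi> t0 x0"
      "\<And>t x. 0 < t \<Longrightarrow> t \<le> T \<Longrightarrow> u t x - v t x \<le> \<theta> * \<Psi> t x"
    show thesis by (rule that[OF *(1-4)]) (rule *(5))
  qed
  have \<Psi>_pos: "0 < \<Psi> t x" if "0 < t" for t x
    unfolding \<Psi>_def using growth_ge_1[of j x] that by (intro mult_pos_pos add_pos_pos) auto
  have obst0: "h t0 x0 < u t0 x0"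
    using supersolution_ge_obstacle[OF super t0, of x0] eq0 mult_pos_pos[OF \<theta> \<Psi>_pos[OF t0(1), of x0]] by linarith
  have uc0: "continuous_on ({0..T} \<times> UNIV) (\<lambda>z. u (fst z) (snd z))"
    using sub unfolding viscosity_subsolution_def by (simp add: case_prod_unfold)
  have vc0: "continuous_on ({0..T} \<times> UNIV) (\<lambda>z. v (fst z) (snd z))"
    using super unfolding viscosity_supersolution_def by (simp add: case_prod_unfold)
  have huc: "continuous_on ({0..T} \<times> UNIV) (\<lambda>z. u (fst z) (snd z) - h (fst z) (snd z))"
    by (intro continuous_intros uc0 h_joint)
  have "(t0, x0) \<in> {0..T} \<times> UNIV" "0 < u t0 x0 - h t0 x0" using t0 obst0 by auto
  from huc[unfolded continuous_on_iff, rule_format, OF this] obtain \<delta> where \<delta>: "0 < \<delta>"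
    "\<And>z. z \<in> {0..T} \<times> UNIV \<Longrightarrow> dist z (t0, x0) < \<delta> \<Longrightarrow>
      dist (u (fst z) (snd z) - h (fst z) (snd z)) (u t0 x0 - h t0 x0) < u t0 x0 - h t0 x0" by auto
  \<comment> \<open>The cylinder stays inside \<open>(0, T)\<close>, within distance 1 of
    \<open>x0\<close> for the coefficient bounds, and inside the set where
    \<open>h < u\<close>.\<close>
  define r where "r = Min {1, t0 / 2, (T - t0) / 2, \<delta> / 3}"
  have r: "0 < r" "r \<le> 1" "r \<le> t0 / 2" "r \<le> (T - t0) / 2" "r \<le> \<delta> / 3"
  proof -
    show "0 < r" using t0 \<delta>(1) by (simp add: r_def)
    show "r \<le> 1" "r \<le> t0 / 2" "r \<le> (T - t0) / 2" "r \<le> \<delta> / 3" unfolding r_def by (rule Min_le; simp)+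
  qed
  define K where "K = {t0 - r..t0 + r} \<times> cball x0 r"
  have KT: "0 < t" "t < T" "t \<in> {0..T}" if "(t, x) \<in> K" for t and x :: "real^'n" using that r t0 by (auto simp: K_def)
  have KT': "0 < fst z" "fst z \<in> {0..T}" if "z \<in> K" for z using KT[of "fst z" "snd z"] that by auto
  have Ksub: "K \<subseteq> {0..T} \<times> UNIV" using KT by auto
  have hu: "h t x < u t x" if "(t, x) \<in> K" for t x
  proof -
    have "dist (t, x) (t0, x0) \<le> dist t t0 + dist x x0"
      unfolding dist_Pair_Pair by (rule sqrt_sum_squares_le_sum) auto
    also have "\<dots> \<le> r + r" using that by (intro add_mono) (auto simp: K_def dist_real_def dist_commute)
    also have "\<dots> < \<delta>" using r \<delta>(1) by linarith
    finally show ?thesis using \<delta>(2)[of "(t, x)"] that Ksub by (auto simp: dist_real_def)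
  qed
  obtain C where C: "0 \<le> C" "\<And>t x c. t \<in> {0..T} \<Longrightarrow> c \<in> U \<Longrightarrow> norm (\<sigma> t x c) \<le> C * (1 + norm x)"
    "\<And>t x c. t \<in> {0..T} \<Longrightarrow> c \<in> U \<Longrightarrow> norm (b t x c) \<le> C * (1 + norm x)" using coefficient_growth by blast
  define R where "R = C * (2 + norm x0)"
  have R: "0 \<le> R" using C(1) by (simp add: R_def)
  have \<sigma>R: "norm (\<sigma> t x c) \<le> R" and bR: "norm (b t x c) \<le> R" if "t \<in> {0..T}" "c \<in> U" "norm (x - x0) \<le> 1" for t x c
  proof -
    have "norm x \<le> 1 + norm x0" using norm_triangle_sub[of x x0] that(3) by linarith
    then have "C * (1 + norm x) \<le> R" unfolding R_def using C(1) by (intro mult_left_mono) auto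
    then show "norm (\<sigma> t x c) \<le> R" "norm (b t x c) \<le> R" using C(2,3)[OF that(1,2), of x] by linarith+
  qed
  \<comment> \<open>The summands are, in order, the \<open>\<gamma>\<close>-errors from the time
    derivative, the Hessian, the drift, the diffusion mismatch, the localisation in
    \<open>y\<close>, the drift mismatch, and four parts of the estimate for
    \<open>g\<close>.\<close>
  define C1 where "C1 = 2 + 2 * R\<^sup>2 + 2 * R + L\<^sup>2 / 2 + R\<^sup>2 + L + L + L + L\<^sup>2 + 2 * L * R"
  have C1: "0 \<le> C1" using R L by (simp add: C1_def)
  define \<gamma> where "\<gamma> = \<theta> / (2 * (C1 + 1))"
  have \<gamma>: "0 < \<gamma>" using \<theta> C1 by (simp add: \<gamma>_def)
  have \<gamma>C: "C1 * \<gamma> \<le> \<theta> / 2"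
  proof -
    have "C1 * \<gamma> \<le> (C1 + 1) * \<gamma>" using \<gamma> by simp
    also have "\<dots> = \<theta> / 2" unfolding \<gamma>_def using C1 by (simp add: field_simps)
    finally show ?thesis .
  qed
  have \<Psi>c: "continuous_on K (\<lambda>z. \<theta> * \<Psi> (fst z) (snd z))"
    unfolding \<Psi>_def by (intro continuous_intros) (use KT'(1) in force)
  obtain \<epsilon> t1 x1 y1 where \<epsilon>: "0 < \<epsilon>" and t1: "\<bar>t1 - t0\<bar> < r" and x1: "norm (x1 - x0) < r" and y1: "norm (y1 - x0) < r"
    and xy: "(norm (x1 - y1))\<^sup>2 / \<epsilon> \<le> \<gamma>" "norm (x1 - y1) \<le> \<gamma>" and uv: "\<bar>u t1 x1 - v t1 y1\<bar> \<le> \<theta> * \<Psi> t1 x1 + \<gamma>"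
    and max: "\<And>t x y. (t, x) \<in> K \<Longrightarrow> y \<in> cball x0 r \<Longrightarrow>
       u t x - v t y - (norm (x - y))\<^sup>2 / (2 * \<epsilon>) - (\<theta> * \<Psi> t x + \<gamma> * ((t - t0)\<^sup>2 + (norm (x - x0))\<^sup>2))
       \<le> u t1 x1 - v t1 y1 - (norm (x1 - y1))\<^sup>2 / (2 * \<epsilon>) - (\<theta> * \<Psi> t1 x1 + \<gamma> * ((t1 - t0)\<^sup>2 + (norm (x1 - x0))\<^sup>2))"
  proof (rule doubling_max[OF r(1) \<gamma>, of t0 x0 u v "\<lambda>t x. \<theta> * \<Psi> t x", folded K_def])
    show "continuous_on K (\<lambda>z. u (fst z) (snd z))" "continuous_on K (\<lambda>z. v (fst z) (snd z))"
      by (rule continuous_on_subset[OF uc0 Ksub] continuous_on_subset[OF vc0 Ksub])+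
    show "continuous_on K (\<lambda>z. \<theta> * \<Psi> (fst z) (snd z))" by (rule \<Psi>c)
    show "u t0 x0 - v t0 x0 = \<theta> * \<Psi> t0 x0" by (rule eq0)
    fix t x assume "(t, x) \<in> K"
    then show "u t x - v t x \<le> \<theta> * \<Psi> t x" "0 \<le> \<theta> * \<Psi> t x"
      using KT le0 \<Psi>_pos \<theta> by (auto simp: less_imp_le)
  qed (rule that)
  have P1: "(t1, x1) \<in> K" using t1 x1 by (auto simp: K_def dist_norm norm_minus_commute abs_less_iff)
  note T1 = KT[OF P1]
  define \<psi>t where "\<psi>t t x = - (\<mu> * \<theta> * exp (\<mu> * (T - t)) * growth j x) - \<theta> * exp (\<mu> * (T - t)) * (\<mu> / t + 1 / t\<^sup>2) + 2 * \<gamma> * (t - t0)"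
    for t and x :: "real^'n"
  define \<psi>q where "\<psi>q t x = (\<theta> * exp (\<mu> * (T - t))) *\<^sub>R growth1 j x + (2 * \<gamma>) *\<^sub>R (x - x0)" for t and x :: "real^'n"
  define \<psi>X where "\<psi>X t x = (\<theta> * exp (\<mu> * (T - t))) *\<^sub>R growth2 j x + (2 * \<gamma>) *\<^sub>R mat 1" for t and x :: "real^'n"
  define q0 where "q0 = (1 / \<epsilon>) *\<^sub>R (x1 - y1)"
  have "\<exists>c\<in>U. - (\<theta> / 4) \<le> \<psi>t t1 x1
     + hamil b \<sigma> g t1 x1 (u t1 x1) ((1 / \<epsilon>) *\<^sub>R (x1 - y1) + \<psi>q t1 x1) (\<psi>X t1 x1 + (2 * \<gamma>) *\<^sub>R mat 1) c
     - ((1 / \<epsilon>) *\<^sub>R (x1 - y1)) \<bullet> b t1 x1 c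
     + frozen_err \<epsilon> \<gamma> v y1 t1 x1 y1 (\<sigma> t1 x1 c) (b t1 x1 c) c"
  proof (rule doubling_inequality[OF sub super \<epsilon> \<gamma> _ _ _ _ _ _ _ max hu[OF P1]])
    show "0 < \<theta> / 4" using \<theta> by simp
    show "compact K" "convex K" unfolding K_def by (intro compact_Times compact_Icc compact_cball convex_Times convex_real_interval convex_cball)+
    show "K \<subseteq> {0<..<T} \<times> UNIV" using KT by auto
    have "{t0 - r<..<t0 + r} \<times> ball x0 r \<subseteq> interior K"
      by (rule interior_maximal) (auto simp: K_def intro!: open_Times)
    then show "(t1, x1) \<in> interior K" using t1 x1 by (auto simp: dist_norm norm_minus_commute abs_less_iff)
    show "compact (cball x0 r)" by (rule compact_cball)
    show "y1 \<in> interior (cball x0 r)" using y1 by (simp add: dist_norm norm_minus_commute)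
    show "continuous_on K (\<lambda>z. \<theta> * \<Psi> (fst z) (snd z) + \<gamma> * ((fst z - t0)\<^sup>2 + (norm (snd z - x0))\<^sup>2))"
      by (intro continuous_intros \<Psi>c)
    show "continuous_on K (\<lambda>z. \<psi>t (fst z) (snd z))" unfolding \<psi>t_def by (intro continuous_intros) (use KT'(1) in force)+
    show "continuous_on K (\<lambda>z. \<psi>q (fst z) (snd z))" unfolding \<psi>q_def by (intro continuous_intros)
    show "continuous_on K (\<lambda>z. \<psi>X (fst z) (snd z))" unfolding \<psi>X_def by (intro continuous_intros)
    show "transpose (\<psi>X t x) = \<psi>X t x" for t x unfolding \<psi>X_def
      using transpose_growth2[of j x] by (simp add: transpose_def vec_eq_iff mat_def)
    fix t x and \<eta> :: real assume tx: "(t, x) \<in> K" and \<eta>: "0 < \<eta>"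
    from penalty_jet[OF KT(1)[OF tx], where \<theta>=\<theta> and \<mu>=\<mu> and T=T and j=j and \<gamma>=\<gamma> and ?t0.0=t0 and x=x and ?x0.0=x0,
        unfolded has_pjet_def, rule_format, OF \<eta>]
    show "\<forall>\<^sub>F h in nhds 0. \<theta> * \<Psi> (t + fst h) (x + snd h) + \<gamma> * ((t + fst h - t0)\<^sup>2 + (norm (x + snd h - x0))\<^sup>2)
       \<le> \<theta> * \<Psi> t x + \<gamma> * ((t - t0)\<^sup>2 + (norm (x - x0))\<^sup>2)
        + (\<psi>t t x * fst h + \<psi>q t x \<bullet> snd h + 1/2 * ((\<psi>X t x *v snd h) \<bullet> snd h)) + \<eta> * (\<bar>fst h\<bar> + (norm (snd h))\<^sup>2)"
    proof eventually_elim
      case (elim h)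
      have *: "a \<le> m + n" if "\<bar>a - m\<bar> \<le> n" for a m n :: real using that by linarith
      from *[OF elim] show ?case unfolding \<Psi>_def \<psi>t_def \<psi>q_def \<psi>X_def .
    qed
  qed
  then obtain c where c: "c \<in> U" and ineq: "- (\<theta> / 4) \<le> \<psi>t t1 x1
     + hamil b \<sigma> g t1 x1 (u t1 x1) (q0 + \<psi>q t1 x1) (\<psi>X t1 x1 + (2 * \<gamma>) *\<^sub>R mat 1) c - q0 \<bullet> b t1 x1 c
     + frozen_err \<epsilon> \<gamma> v y1 t1 x1 y1 (\<sigma> t1 x1 c) (b t1 x1 c) c" unfolding q0_def by blast
  define A where "A = \<theta> * exp (\<mu> * (T - t1))"
  define S1 where "S1 = \<sigma> t1 x1 c"
  define S2 where "S2 = \<sigma> t1 y1 c"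
  define G where "G = growth j x1"
  define g1 where "g1 = growth1 j x1"
  have A: "\<theta> \<le> A" "0 \<le> A"
  proof -
    have "0 \<le> \<mu> * (T - t1)" using \<mu> T1 by simp
    then have "1 \<le> exp (\<mu> * (T - t1))" by simp
    then show "\<theta> \<le> A" unfolding A_def using \<theta> by simp
    then show "0 \<le> A" using \<theta> by simp
  qed
  have G: "1 \<le> G" unfolding G_def by (rule growth_ge_1)
  have near: "norm (x1 - x0) \<le> 1" "norm (y1 - x0) \<le> 1" "\<bar>t1 - t0\<bar> \<le> 1" using x1 y1 t1 r by auto
  have S1: "norm S1 \<le> R" "(norm S1)\<^sup>2 \<le> R\<^sup>2" and S2: "(norm S2)\<^sup>2 \<le> R\<^sup>2" and b1: "norm (b t1 x1 c) \<le> R"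
    unfolding S1_def S2_def using \<sigma>R[OF T1(3) c near(1)] \<sigma>R[OF T1(3) c near(2)] bR[OF T1(3) c near(1)] by (auto intro: power_mono)
  have q0n: "norm q0 * norm (x1 - y1) \<le> \<gamma>"
    using xy(1) \<epsilon> unfolding q0_def norm_scaleR by (simp add: power2_eq_square)
  have \<Psi>1: "\<theta> * \<Psi> t1 x1 = A * (G + 1 / t1)" by (simp add: \<Psi>_def A_def G_def)
  have p1: "\<psi>t t1 x1 \<le> - (\<mu> * (A * (G + 1 / t1))) + 2 * \<gamma>"
  proof -
    have "\<psi>t t1 x1 = - (\<mu> * (A * (G + 1 / t1))) - A * (1 / t1\<^sup>2) + 2 * \<gamma> * (t1 - t0)"
      unfolding \<psi>t_def A_def G_def by (simp add: algebra_simps)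
    moreover have "0 \<le> A * (1 / t1\<^sup>2)" using A by simp
    moreover have "2 * \<gamma> * (t1 - t0) \<le> 2 * \<gamma> * 1" using near \<gamma> by (intro mult_left_mono) auto
    ultimately show ?thesis by linarith
  qed
  have p2: "1/2 * trace ((S1 ** transpose S1) ** (\<psi>X t1 x1 + (2 * \<gamma>) *\<^sub>R mat 1))
      \<le> A * (1/2 * trace ((S1 ** transpose S1) ** growth2 j x1)) + \<gamma> * (2 * R\<^sup>2)"
  proof -
    have "\<psi>X t1 x1 + (2 * \<gamma>) *\<^sub>R mat 1 = A *\<^sub>R growth2 j x1 + (4 * \<gamma>) *\<^sub>R mat 1"
      unfolding \<psi>X_def A_def add.assoc scaleR_add_left[symmetric] by simp
    moreover have "\<gamma> * (norm S1)\<^sup>2 \<le> \<gamma> * R\<^sup>2" using S1 \<gamma> by (intro mult_left_mono) auto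
    ultimately show ?thesis by (simp add: trace_covariance_affine)
  qed
  have p3: "b t1 x1 c \<bullet> (q0 + \<psi>q t1 x1) - q0 \<bullet> b t1 x1 c \<le> A * (b t1 x1 c \<bullet> g1) + \<gamma> * (2 * R)"
  proof -
    have "b t1 x1 c \<bullet> (x1 - x0) \<le> norm (b t1 x1 c) * norm (x1 - x0)" by (rule norm_cauchy_schwarz)
    also have "\<dots> \<le> R * 1" using b1 near R by (intro mult_mono) auto
    finally have "2 * \<gamma> * (b t1 x1 c \<bullet> (x1 - x0)) \<le> 2 * \<gamma> * (R * 1)" using \<gamma> by (intro mult_left_mono) auto
    moreover have "b t1 x1 c \<bullet> (q0 + \<psi>q t1 x1) - q0 \<bullet> b t1 x1 c = A * (b t1 x1 c \<bullet> g1) + 2 * \<gamma> * (b t1 x1 c \<bullet> (x1 - x0))"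
      unfolding \<psi>q_def A_def g1_def by (simp add: inner_add_right inner_commute)
    ultimately show ?thesis by simp
  qed
  have dS: "norm (S1 - S2) \<le> L * norm (x1 - y1)" unfolding S1_def S2_def by (rule \<sigma>_Lip[OF T1(3) c])
  have p4: "(norm (S1 - S2))\<^sup>2 / (2 * \<epsilon>) \<le> \<gamma> * (L\<^sup>2 / 2)"
  proof -
    have "(norm (S1 - S2))\<^sup>2 \<le> L\<^sup>2 * (norm (x1 - y1))\<^sup>2" using power_mono[OF dS, of 2] by (simp add: power_mult_distrib)
    then have "(norm (S1 - S2))\<^sup>2 / (2 * \<epsilon>) \<le> L\<^sup>2 * (norm (x1 - y1))\<^sup>2 / (2 * \<epsilon>)" using \<epsilon> by (intro divide_right_mono) auto
    also have "\<dots> = L\<^sup>2 / 2 * ((norm (x1 - y1))\<^sup>2 / \<epsilon>)" by simp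
    also have "\<dots> \<le> L\<^sup>2 / 2 * \<gamma>" using xy(1) by (intro mult_left_mono) auto
    finally show ?thesis by (simp add: mult.commute)
  qed
  have p5: "\<gamma> * (norm S2)\<^sup>2 \<le> \<gamma> * R\<^sup>2" using S2 \<gamma> by (intro mult_left_mono) auto
  have p6: "q0 \<bullet> (b t1 x1 c - b t1 y1 c) \<le> \<gamma> * L"
  proof -
    have "q0 \<bullet> (b t1 x1 c - b t1 y1 c) \<le> norm q0 * norm (b t1 x1 c - b t1 y1 c)" by (rule norm_cauchy_schwarz)
    also have "\<dots> \<le> norm q0 * (L * norm (x1 - y1))" using b_Lip[OF T1(3) c] by (intro mult_left_mono) auto
    also have "\<dots> = L * (norm q0 * norm (x1 - y1))" by (simp only: mult_ac)
    also have "\<dots> \<le> L * \<gamma>" using q0n L by (intro mult_left_mono) auto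
    finally show ?thesis by (simp add: mult.commute)
  qed
  \<comment> \<open>The values \<open>u\<close> and \<open>v\<close> differ by at most
    \<open>\<theta> * \<Psi> + \<gamma>\<close>. The gradient arguments differ by
    \<open>q0 v* (S1 - S2)\<close>, small because
    \<open>norm q0 * norm (x1 - y1) \<le> \<gamma>\<close>, and by the penalty gradient.\<close>
  have p7: "g t1 x1 (u t1 x1) ((q0 + \<psi>q t1 x1) v* S1) c - g t1 y1 (v t1 y1) (q0 v* S2) c
      \<le> L * (A * (G + 1 / t1)) + A * (L * (norm g1 * norm S1)) + \<gamma> * (L + L + L\<^sup>2 + 2 * L * R)"
  proof -
    have n1: "norm q0 * norm (S1 - S2) \<le> L * \<gamma>"
    proof -
      have "norm q0 * norm (S1 - S2) \<le> norm q0 * (L * norm (x1 - y1))" using dS by (intro mult_left_mono) auto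
      also have "\<dots> = L * (norm q0 * norm (x1 - y1))" by (simp only: mult_ac)
      also have "\<dots> \<le> L * \<gamma>" using q0n L by (intro mult_left_mono) auto
      finally show ?thesis .
    qed
    have "norm (\<psi>q t1 x1) \<le> norm (A *\<^sub>R g1) + norm ((2 * \<gamma>) *\<^sub>R (x1 - x0))"
      unfolding \<psi>q_def A_def g1_def by (rule norm_triangle_ineq)
    also have "\<dots> \<le> A * norm g1 + 2 * \<gamma> * 1" unfolding norm_scaleR using A \<gamma> near by (intro add_mono mult_mono) auto
    finally have "norm (\<psi>q t1 x1) * norm S1 \<le> (A * norm g1 + 2 * \<gamma> * 1) * norm S1" by (rule mult_right_mono) simp
    also have "\<dots> = A * (norm g1 * norm S1) + 2 * \<gamma> * norm S1" by (simp add: distrib_right mult.assoc)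
    also have "2 * \<gamma> * norm S1 \<le> 2 * \<gamma> * R" using S1 \<gamma> by (intro mult_left_mono) auto
    finally have n2: "norm (\<psi>q t1 x1) * norm S1 \<le> A * (norm g1 * norm S1) + 2 * \<gamma> * R" by simp
    have "norm ((q0 + \<psi>q t1 x1) v* S1 - q0 v* S2) \<le> norm (q0 v* (S1 - S2)) + norm (\<psi>q t1 x1 v* S1)"
      unfolding vector_matrix_diff_split by (rule norm_triangle_ineq)
    also have "\<dots> \<le> norm q0 * norm (S1 - S2) + norm (\<psi>q t1 x1) * norm S1"
      by (intro add_mono norm_vector_matrix_mult_le)
    finally have n3: "norm ((q0 + \<psi>q t1 x1) v* S1 - q0 v* S2) \<le> L * \<gamma> + (A * (norm g1 * norm S1) + 2 * \<gamma> * R)"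
      using n1 n2 by linarith
    have "g t1 x1 (u t1 x1) ((q0 + \<psi>q t1 x1) v* S1) c - g t1 y1 (v t1 y1) (q0 v* S2) c
       \<le> L * (norm (x1 - y1) + \<bar>u t1 x1 - v t1 y1\<bar> + norm ((q0 + \<psi>q t1 x1) v* S1 - q0 v* S2))"
      using g_Lip[OF T1(3) c, of x1 "u t1 x1" "(q0 + \<psi>q t1 x1) v* S1" y1 "v t1 y1" "q0 v* S2"] by linarith
    also have "\<dots> \<le> L * (\<gamma> + (A * (G + 1 / t1) + \<gamma>) + (L * \<gamma> + (A * (norm g1 * norm S1) + 2 * \<gamma> * R)))"
      using xy(2) uv n3 L unfolding \<Psi>1 by (intro mult_left_mono add_mono) auto
    finally show ?thesis by (simp add: algebra_simps power2_eq_square)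
  qed
  \<comment> \<open>The localising gradient vanishes because the minimising point is
    \<open>y1\<close> itself.\<close>
  have fe: "frozen_err \<epsilon> \<gamma> v y1 t1 x1 y1 S1 (b t1 x1 c) c = (norm (S1 - S2))\<^sup>2 / (2 * \<epsilon>) + \<gamma> * (norm S2)\<^sup>2
      + q0 \<bullet> (b t1 x1 c - b t1 y1 c) - g t1 y1 (v t1 y1) (q0 v* S2) c"
    unfolding frozen_err_def S2_def q0_def by simp
  have p8: "A * (1/2 * trace ((S1 ** transpose S1) ** growth2 j x1)) + A * (b t1 x1 c \<bullet> g1) + A * (L * (norm g1 * norm S1)) \<le> A * (\<Lambda> * (G + 1 / t1))"
  proof -
    have "\<Lambda> * G \<le> \<Lambda> * (G + 1 / t1)" using \<Lambda>(1) T1 by (intro mult_left_mono) auto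
    then have "1/2 * trace ((S1 ** transpose S1) ** growth2 j x1) + b t1 x1 c \<bullet> g1 + L * (norm g1 * norm S1) \<le> \<Lambda> * (G + 1 / t1)"
      using \<Lambda>(2)[OF T1(3) c, of x1] unfolding S1_def g1_def G_def by linarith
    from mult_left_mono[OF this A(2)] show ?thesis by (simp only: distrib_left)
  qed
  have "- (\<theta> / 4) \<le> - (\<mu> * (A * (G + 1 / t1))) + A * (\<Lambda> * (G + 1 / t1)) + L * (A * (G + 1 / t1))
     + (2 * \<gamma> + \<gamma> * (2 * R\<^sup>2) + \<gamma> * (2 * R) + \<gamma> * (L\<^sup>2 / 2) + \<gamma> * R\<^sup>2 + \<gamma> * L + \<gamma> * (L + L + L\<^sup>2 + 2 * L * R))"
    using ineq p1 p2 p3 p4 p5 p6 p7 p8 unfolding hamil_def S1_def[symmetric] fe by linarith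
  also have "\<dots> = - (A * (G + 1 / t1)) + C1 * \<gamma>"
    unfolding \<mu>_def C1_def by (simp add: algebra_simps add_divide_distrib)
  \<comment> \<open>Since \<open>A \<ge> \<theta>\<close> and \<open>G \<ge> 1\<close>, the leftover
    is at least \<open>\<theta>\<close>, of which the \<open>\<gamma>\<close>-errors use up at most
    half; \<open>- \<theta> / 4\<close> lies strictly above the result.\<close>
  also have "\<dots> \<le> - \<theta> + \<theta> / 2"
  proof -
    have "\<theta> * 1 \<le> A * (G + 1 / t1)" using A \<theta> G T1 by (intro mult_mono) (auto intro: add_increasing2)
    then show ?thesis using \<gamma>C by linarith
  qed
  finally show False using \<theta> by simp
qed

text \<open>The singular term \<open>1 / t\<close> of the penalty excludes \<open>t = 0\<close> from
  \<open>comparison\<close>; continuity of \<open>v - u\<close> in time closes the gap.\<close>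

lemma comparison_closed:
  assumes sub: "viscosity_subsolution T b \<sigma> g h \<Phi> U u" and super: "viscosity_supersolution T b \<sigma> g h \<Phi> U v"
    and "polynomial_growth T u" "polynomial_growth T v" and t: "t \<in> {0..T}"
  shows "u t x \<le> v t x"
proof (cases "t = 0")
  case False
  then show ?thesis using comparison[OF assms(1-4)] t by auto
next
  case True
  have c: "continuous_on {0..T} (\<lambda>t. f t x)" if "continuous_on ({0..T} \<times> UNIV) (\<lambda>(t, x). f t x)" for f :: "real \<Rightarrow> real^'n \<Rightarrow> real"
  proof -
    have "(\<lambda>t. (t, x)) ` {0..T} \<subseteq> {0..T} \<times> UNIV" by auto
    moreover have "continuous_on {0..T} (\<lambda>t. (t, x))" by (intro continuous_on_Pair continuous_on_id continuous_on_const)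
    ultimately show ?thesis using continuous_on_compose2[OF that] by fastforce
  qed
  have "continuous_on {0..T} (\<lambda>t. v t x - u t x)"
    using sub super unfolding viscosity_subsolution_def viscosity_supersolution_def by (intro continuous_on_diff c) auto
  then have "closed ({0..T} \<inter> (\<lambda>t. v t x - u t x) -` {0..})"
    by (intro continuous_closed_preimage) auto
  moreover have "{0<..<T} \<subseteq> {0..T} \<inter> (\<lambda>t. v t x - u t x) -` {0..}"
    using comparison[OF assms(1-4)] by auto
  ultimately have sub': "closure {0<..<T} \<subseteq> {0..T} \<inter> (\<lambda>t. v t x - u t x) -` {0..}" by (rule closure_minimal[rotated])
  have "0 \<in> closure {0<..<T}" using T by simp
  from subsetD[OF sub' this] show ?thesis using True by simp
qed

end

theorem theorem4p10:
  fixes T L :: real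
    and U :: "(real^'k) set"
    and b :: "real \<Rightarrow> real^'n \<Rightarrow> real^'k \<Rightarrow> real^'n"
    and \<sigma> :: "real \<Rightarrow> real^'n \<Rightarrow> real^'k \<Rightarrow> real^'d^'n"
    and g :: "real \<Rightarrow> real^'n \<Rightarrow> real \<Rightarrow> real^'d \<Rightarrow> real^'k \<Rightarrow> real"
    and h :: "real \<Rightarrow> real^'n \<Rightarrow> real"
    and \<Phi> :: "real^'n \<Rightarrow> real"
    and u\<^sub>1 u\<^sub>2 :: "real \<Rightarrow> real^'n \<Rightarrow> real"
  assumes "T > 0" and "compact U" and "U \<noteq> {}" and "L > 0"
    and b_cont: "\<And>x v. v \<in> U \<Longrightarrow> continuous_on {0..T} (\<lambda>t. b t x v)"
    and \<sigma>_cont: "\<And>x v. v \<in> U \<Longrightarrow> continuous_on {0..T} (\<lambda>t. \<sigma> t x v)"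
    and g_cont: "\<And>x y z v. v \<in> U \<Longrightarrow> continuous_on {0..T} (\<lambda>t. g t x y z v)"
    and h_cont: "\<And>x. continuous_on {0..T} (\<lambda>t. h t x)"
    and b_\<sigma>_Lipschitz: "\<And>t x x' v v'. t \<in> {0..T} \<Longrightarrow> v \<in> U \<Longrightarrow> v' \<in> U \<Longrightarrow>
          norm (b t x v - b t x' v') + norm (\<sigma> t x v - \<sigma> t x' v')
            \<le> L * (norm (x - x') + norm (v - v'))"
    and g_\<Phi>_h_Lipschitz: "\<And>t x x' y y' z z' v v'. t \<in> {0..T} \<Longrightarrow> v \<in> U \<Longrightarrow> v' \<in> U \<Longrightarrow>
          \<bar>g t x y z v - g t x' y' z' v'\<bar> + \<bar>\<Phi> x - \<Phi> x'\<bar> + \<bar>h t x - h t x'\<bar>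
            \<le> L * (norm (x - x') + \<bar>y - y'\<bar> + norm (z - z') + norm (v - v'))"
    and "viscosity_solution T b \<sigma> g h \<Phi> U u\<^sub>1" and "polynomial_growth T u\<^sub>1"
    and "viscosity_solution T b \<sigma> g h \<Phi> U u\<^sub>2" and "polynomial_growth T u\<^sub>2"
  shows "\<forall>t\<in>{0..T}. \<forall>x. u\<^sub>1 t x = u\<^sub>2 t x"
proof (intro ballI allI)
  interpret hjb T L U b \<sigma> g h \<Phi>
    using assms(1-10) by unfold_locales blast+
  fix t x
  assume t: "t \<in> {0..T}"
  have 1: "viscosity_subsolution T b \<sigma> g h \<Phi> U u\<^sub>1" "viscosity_supersolution T b \<sigma> g h \<Phi> U u\<^sub>1"
    and 2: "viscosity_subsolution T b \<sigma> g h \<Phi> U u\<^sub>2" "viscosity_supersolution T b \<sigma> g h \<Phi> U u\<^sub>2"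
    using assms(11,13) by (auto simp: viscosity_solution_def)
  show "u\<^sub>1 t x = u\<^sub>2 t x"
    by (rule antisym[OF comparison_closed[OF 1(1) 2(2) assms(12,14) t] comparison_closed[OF 2(1) 1(2) assms(14,12) t]])
qed

end
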